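(* Let $A>0$, $1<p<\infty$, $0<\varepsilon<\frac{1}{7\sqrt{2}}$, $\alpha=\frac{49\varepsilon^2}{1-49\varepsilon^2}$, and set $d=\left\lfloor 4\bigl(A+(A/\varepsilon)^{2/p}\bigr)^2\right\rfloor+1$. If $\{e_k\}_{k=1}^{N} \subset L^2(\mathbb{R})$ is an orthonormal set such that for all $1\leq k\leq N$, $$|\mu_p(e_k)|,\ |\mu_p(\widehat{e_k})|,\ \Delta_p(e_k),\ \Delta_p(\widehat{e_k})\leq A,$$ then $$N \leq N_{\mathbb{C}}^s(\alpha,d)\leq N_{\mathbb{R}}^s(\alpha,2d).$$
   Context: The Fourier transform is $\widehat{f}(\xi)=\int f(t)e^{-2i\pi t\xi}\,dt$ for $f\in L^1(\mathbb{R})$, extended to $L^2(\mathbb{R})$ as usual. For $p>1$ and $f\in L^2(\mathbb{R})$ with $\|f\|_2=1$, the $p$-variance is $\Delta_p^2(f)=\inf_{a\in\mathbb{R}}\int|t-a|^p|f(t)|^2\,dt$ and the $p$-dispersion is $\Delta_p(f)=\sqrt{\Delta_p^2(f)}$; when it is finite the infimum is attained at a unique $a\in\mathbb{R}$, called the $p$-mean and denoted $\mu_p(f)$. Spherical codes: let $\mathbb{K}=\mathbb{R}$ or $\mathbb{C}$ and $d\ge1$; $\mathbb{S}_d$ is the unit sphere of $\mathbb{K}^d$ with the standard scalar product. For $A'\subset\{z\in\mathbb{K}:|z|\le1\}$, a spherical $A'$-code is a finite subset $V\subset\mathbb{S}_d$ such that $\langle u,v\rangle\in A'$ whenever $u,v\in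 V$, $u\neq v$; $N_{\mathbb{K}}(A',d)$ is the maximal cardinality of a spherical $A'$-code. Set $N_{\mathbb{R}}^s(\alpha,d)=N_{\mathbb{R}}([-\alpha,\alpha],d)$ and $N_{\mathbb{C}}^s(\alpha,d)=N_{\mathbb{C}}(\{z\in\mathbb{C}:|z|\le\alpha\},d)$. *)

theory Defs
  imports "HOL-Analysis.Analysis" "Jordan_Normal_Form.Conjugate" "Jordan_Normal_Form.Matrix"
begin

section \<open>Square-integrable functions and orthonormal families\<close>

text \<open>Elements of $L^2$ over the reals are represented by functions; modifying a function on a null
  set affects none of the notions below.\<close>

definition square_integrable :: "(real \<Rightarrow> complex) \<Rightarrow> bool" where
  "square_integrable f \<longleftrightarrow>
     f \<in> borel_measurable lebesgue \<and> integrable lebesgue (\<lambda>t. (norm (f t))\<^sup>2)"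

definition orthonormal_family :: "'i set \<Rightarrow> ('i \<Rightarrow> real \<Rightarrow> complex) \<Rightarrow> bool" where
  "orthonormal_family I e \<longleftrightarrow>
     (\<forall>k\<in>I. square_integrable (e k)) \<and>
     (\<forall>j\<in>I. \<forall>k\<in>I. (LINT t|lebesgue. e j t * cnj (e k t)) = (if j = k then 1 else 0))"


section \<open>Fourier transform\<close>

definition fourier_L1 :: "(real \<Rightarrow> complex) \<Rightarrow> real \<Rightarrow> complex" where
  "fourier_L1 f \<xi> = (LINT t|lebesgue. f t * exp (- 2 * \<i> * of_real pi * of_real t * of_real \<xi>))"

text \<open>For square-integrable \<open>f\<close>, the truncations of \<open>f\<close> to \<open>{-n..n}\<close> are integrable and converge
  to \<open>f\<close> in $L^2$, so the extension of the transform to $L^2$ sends \<open>f\<close> to the $L^2$-limit of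
  their transforms. This determines the limit up to a null set; \<open>fourier_L2\<close> picks a
  representative.\<close>

definition is_fourier_L2 :: "(real \<Rightarrow> complex) \<Rightarrow> (real \<Rightarrow> complex) \<Rightarrow> bool" where
  "is_fourier_L2 f g \<longleftrightarrow>
     square_integrable g \<and>
     (\<lambda>n::nat. \<integral>\<^sup>+\<xi>. ennreal ((norm (fourier_L1 (\<lambda>t. indicator {- real n..real n} t * f t) \<xi> - g \<xi>))\<^sup>2)
        \<partial>lebesgue) \<longlonglongrightarrow> 0"

definition fourier_L2 :: "(real \<Rightarrow> complex) \<Rightarrow> real \<Rightarrow> complex" where
  "fourier_L2 f = (SOME g. is_fourier_L2 f g)"


section \<open>Variance, dispersion and mean of order \<open>p\<close>\<close>

definition p_moment :: "real \<Rightarrow> (real \<Rightarrow> complex) \<Rightarrow> real \<Rightarrow> ennreal" where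
  "p_moment p f a = (\<integral>\<^sup>+t. ennreal (\<bar>t - a\<bar> powr p * (norm (f t))\<^sup>2) \<partial>lebesgue)"

definition p_variance :: "real \<Rightarrow> (real \<Rightarrow> complex) \<Rightarrow> ennreal" where
  "p_variance p f = (INF a. p_moment p f a)"

definition p_dispersion :: "real \<Rightarrow> (real \<Rightarrow> complex) \<Rightarrow> ennreal" where
  "p_dispersion p f =
     (if p_variance p f = \<infinity> then \<infinity> else ennreal (sqrt (enn2real (p_variance p f))))"

text \<open>Meaningful only when the variance is finite; otherwise every point is a minimiser and the
  value is unspecified.\<close>

definition p_mean :: "real \<Rightarrow> (real \<Rightarrow> complex) \<Rightarrow> real" where
  "p_mean p f = (THE a. p_moment p f a = p_variance p f)"


section \<open>Spherical codes\<close>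

text \<open>The scalar product \<open>u \<bullet>c v\<close> is linear in \<open>u\<close> and conjugate-linear in \<open>v\<close>; on the reals,
  \<open>conjugate\<close> is the identity.\<close>

definition spherical_code :: "'a::conjugatable_field set \<Rightarrow> nat \<Rightarrow> 'a Matrix.vec set \<Rightarrow> bool" where
  "spherical_code A d V \<longleftrightarrow>
     finite V \<and> V \<subseteq> {v \<in> carrier_vec d. v \<bullet>c v = 1} \<and>
     (\<forall>u\<in>V. \<forall>v\<in>V. u \<noteq> v \<longrightarrow> u \<bullet>c v \<in> A)"

text \<open>The supremum in \<open>enat\<close> is the maximal cardinality when the cardinalities are bounded, and
  \<open>\<infinity>\<close> when they are not.\<close>

definition max_code :: "'a::conjugatable_field set \<Rightarrow> nat \<Rightarrow> enat" where
  "max_code A d = (SUP V\<in>{V. spherical_code A d V}. enat (card V))"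

definition max_code_real :: "real \<Rightarrow> nat \<Rightarrow> enat" where
  "max_code_real \<alpha> d = max_code {-\<alpha>..\<alpha>} d"

definition max_code_complex :: "real \<Rightarrow> nat \<Rightarrow> enat" where
  "max_code_complex \<alpha> d = max_code {z::complex. norm z \<le> \<alpha>} d"

end

theory Submission
  imports Defs
begin

text \<open>
  Put $T = A + (A/\varepsilon)^{2/p}$. By Markov's inequality each $e_k$ and each $\widehat{e_k}$ has mass
  at most $\varepsilon^2$ outside $[-T,T]$. On the span of the $e_k$, identified with $\mathbb{C}^N$,
  let $q(f)$ be the mass of $f$ plus the mass of $\widehat f$ outside $[-T,T]$, so that
  $q(e_k) \le 2\varepsilon^2$. The $d > 4T^2$ linear conditions that $\widehat f$ has integral zero on $d$
  consecutive intervals of length $1/(2T)$ covering $[-T,T)$ force $\|f\|^2 \le 19\, q(f)$: up to the two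
  tails, all integrals of $\widehat f$ over the grid intervals vanish, and these are Fourier
  coefficients of $f|_{[-T,T]}$ times a function bounded below. By the minimax principle all but the first $d$
  eigenvalues of $q$ are at least $1/19$, so the projections of the $e_k$ to the first $d$ eigenvectors are
  within $\sqrt{38}\,\varepsilon$ of the $e_k$; normalised, they form a code in $\mathbb{C}^d$ with the
  required bound.
\<close>

section \<open>Square-integrable functions\<close>

text \<open>The cell conditions are never imposed on the \<open>e k\<close> themselves. They are
  test functionals for the minimax principle: every subspace of dimension d + 1 contains a nonzero
  vector satisfying all d of them. The cell length 1/(2T) is dual to the period 2T, which is why
  cell integrals are Fourier coefficients, and covering [-T,T) takes 4T^2 such cells; this explains
  the square in d.

  Projecting costs only a quadratic error. Write e_k = p_k + r_k with p_k in the span of the first d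
  eigenvectors and r_k orthogonal to it. Then <p_j,p_k> = \<delta>_jk - <r_j,r_k>, so the Gram
  matrix is off by at most 38 \<epsilon>^2, although each vector moves by up to a multiple of
  \<epsilon>. The eigenvectors diagonalise q as well, hence q(r_k) \<le> q(e_k), while q(r_k) is at
  least |r_k|^2 / 19; together these bound r_k.\<close>

definition sqnorm :: "(real \<Rightarrow> complex) \<Rightarrow> real" where
  "sqnorm f = (LINT t|lebesgue. (norm (f t))\<^sup>2)"

lemma sqnorm_nonneg [simp]: "0 \<le> sqnorm f"
  by (simp add: sqnorm_def)

lemma nn_integral_eq_sqnorm:
  assumes "square_integrable f"
  shows "(\<integral>\<^sup>+t. ennreal ((norm (f t))\<^sup>2) \<partial>lebesgue) = ennreal (sqnorm f)"
  using assms unfolding square_integrable_def sqnorm_def by (intro nn_integral_eq_integral) auto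

lemma square_integrable_iff_nn:
  "square_integrable f \<longleftrightarrow>
     f \<in> borel_measurable lebesgue \<and> (\<integral>\<^sup>+t. ennreal ((norm (f t))\<^sup>2) \<partial>lebesgue) < \<infinity>"
proof -
  have "f \<in> borel_measurable lebesgue \<Longrightarrow> (\<lambda>t. (norm (f t))\<^sup>2) \<in> borel_measurable lebesgue" by measurable
  then show ?thesis unfolding square_integrable_def integrable_iff_bounded by auto
qed

lemma square_integrable_measurable: "square_integrable f \<Longrightarrow> f \<in> borel_measurable lebesgue"
  by (simp add: square_integrable_def)

lemma square_integrable_bound:
  assumes "f \<in> borel_measurable lebesgue" and "square_integrable g"
    and "\<And>t. norm (f t) \<le> norm (g t)"
  shows "square_integrable f"
  unfolding square_integrable_def
proof
  show "integrable lebesgue (\<lambda>t. (norm (f t))\<^sup>2)"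
    by (rule Bochner_Integration.integrable_bound[of _ "\<lambda>t. (norm (g t))\<^sup>2"])
       (use assms in \<open>auto simp: square_integrable_def intro!: power_mono\<close>)
qed (use assms in auto)

lemma square_integrable_zero: "square_integrable (\<lambda>t. 0)"
  by (simp add: square_integrable_def)

lemma square_integrable_add:
  assumes "square_integrable f" "square_integrable g"
  shows "square_integrable (\<lambda>t. f t + g t)"
  unfolding square_integrable_def
proof
  have [measurable]: "f \<in> borel_measurable lebesgue" "g \<in> borel_measurable lebesgue"
    using assms by (auto simp: square_integrable_def)
  have *: "(norm (f t + g t))\<^sup>2 \<le> 2 * (norm (f t))\<^sup>2 + 2 * (norm (g t))\<^sup>2" for t
  proof -
    have "(norm (f t + g t))\<^sup>2 \<le> (norm (f t) + norm (g t))\<^sup>2" by (intro power_mono norm_triangle_ineq) auto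
    also have "\<dots> \<le> 2 * (norm (f t))\<^sup>2 + 2 * (norm (g t))\<^sup>2"
      using zero_le_power2[of "norm (f t) - norm (g t)"] unfolding power2_diff power2_sum by linarith
    finally show ?thesis .
  qed
  show "integrable lebesgue (\<lambda>t. (norm (f t + g t))\<^sup>2)"
    by (rule Bochner_Integration.integrable_bound[of _ "\<lambda>t. 2 * (norm (f t))\<^sup>2 + 2 * (norm (g t))\<^sup>2"])
       (use assms * in \<open>auto simp: square_integrable_def\<close>)
qed (use assms in \<open>auto simp: square_integrable_def\<close>)

lemma square_integrable_cmult:
  assumes "square_integrable f" shows "square_integrable (\<lambda>t. c * f t)"
  using assms by (auto simp: square_integrable_def norm_mult power_mult_distrib)

lemma square_integrable_sum:
  assumes "\<And>k. k \<in> I \<Longrightarrow> square_integrable (f k)"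
  shows "square_integrable (\<lambda>t. \<Sum>k\<in>I. f k t)"
  using assms by (induction I rule: infinite_finite_induct)
    (auto simp: square_integrable_zero intro!: square_integrable_add)

lemma square_integrable_diff:
  assumes "square_integrable f" "square_integrable g"
  shows "square_integrable (\<lambda>t. f t - g t)"
  using square_integrable_add[OF assms(1) square_integrable_cmult[OF assms(2), of "-1"]] by simp

lemma square_integrable_bounded_mult:
  assumes "square_integrable f" "h \<in> borel_measurable lebesgue" "\<And>t. norm (h t) \<le> B"
  shows "square_integrable (\<lambda>t. h t * f t)"
proof (rule square_integrable_bound[OF _ square_integrable_cmult[OF assms(1), of "of_real B"]])
  have "0 \<le> B" using assms(3) norm_ge_zero order_trans by blast
  then show "norm (h t * f t) \<le> norm (of_real B * f t)" for t
    using assms(3)[of t] by (simp add: norm_mult mult_right_mono)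
qed (use assms in \<open>auto simp: square_integrable_def\<close>)

lemma square_integrable_indicator_mult:
  assumes "square_integrable f" "S \<in> sets lebesgue"
  shows "square_integrable (\<lambda>t. indicator S t * f t)"
  by (rule square_integrable_bounded_mult[OF assms(1), where B = 1])
     (use assms(2) in \<open>auto simp: indicator_def\<close>)

lemma borel_measurable_cnj [measurable (raw)]:
  "f \<in> borel_measurable M \<Longrightarrow> (\<lambda>t. cnj (f t)) \<in> borel_measurable M"
  by (rule measurable_compose[OF _ borel_measurable_continuous_onI]) (auto intro: continuous_intros)

lemma square_integrable_cnj: "square_integrable f \<Longrightarrow> square_integrable (\<lambda>t. cnj (f t))"
  by (auto simp: square_integrable_def intro: borel_measurable_cnj)

lemma sqnorm_cnj [simp]: "sqnorm (\<lambda>t. cnj (f t)) = sqnorm f"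
  by (simp add: sqnorm_def)

lemma sqnorm_cmult: "sqnorm (\<lambda>t. c * f t) = (norm c)\<^sup>2 * sqnorm f"
  by (simp add: sqnorm_def norm_mult power_mult_distrib)

lemma square_integrable_mult_integrable:
  assumes "square_integrable f" "square_integrable g"
  shows "integrable lebesgue (\<lambda>t. f t * g t)"
proof (rule Bochner_Integration.integrable_bound[of _ "\<lambda>t. (norm (f t))\<^sup>2 + (norm (g t))\<^sup>2"])
  have "norm (f t * g t) \<le> (norm (f t))\<^sup>2 + (norm (g t))\<^sup>2" for t
    using zero_le_power2[of "norm (f t) - norm (g t)"] mult_nonneg_nonneg[OF norm_ge_zero[of "f t"] norm_ge_zero[of "g t"]]
    unfolding power2_diff norm_mult by linarith
  then show "AE t in lebesgue. norm (f t * g t) \<le> norm ((norm (f t))\<^sup>2 + (norm (g t))\<^sup>2)" by auto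
qed (use assms in \<open>auto simp: square_integrable_def\<close>)

lemma square_integrable_Cauchy_Schwarz:
  assumes "square_integrable f" "square_integrable g"
  shows "(norm (LINT t|lebesgue. f t * g t))\<^sup>2 \<le> sqnorm f * sqnorm g"
proof -
  have [measurable]: "f \<in> borel_measurable lebesgue" "g \<in> borel_measurable lebesgue"
    using assms by (auto simp: square_integrable_def)
  have "ennreal (norm (LINT t|lebesgue. f t * g t)) \<le> (\<integral>\<^sup>+t. norm (f t * g t) \<partial>lebesgue)"
    by (intro integral_norm_bound_ennreal square_integrable_mult_integrable assms)
  then have "(ennreal (norm (LINT t|lebesgue. f t * g t)))\<^sup>2 \<le> (\<integral>\<^sup>+t. ennreal (norm (f t)) * ennreal (norm (g t)) \<partial>lebesgue)\<^sup>2"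
    by (intro power_mono) (auto simp: norm_mult ennreal_mult)
  also have "\<dots> \<le> (\<integral>\<^sup>+t. (ennreal (norm (f t)))\<^sup>2 \<partial>lebesgue) * (\<integral>\<^sup>+t. (ennreal (norm (g t)))\<^sup>2 \<partial>lebesgue)"
    by (rule Cauchy_Schwarz_nn_integral) auto
  also have "\<dots> = ennreal (sqnorm f * sqnorm g)"
    by (simp add: ennreal_power nn_integral_eq_sqnorm assms ennreal_mult)
  finally show ?thesis by (simp add: ennreal_power)
qed

lemma square_integrable_indicator_Icc: "square_integrable (indicator {a..b})"
  and square_integrable_indicator_Ico: "square_integrable (indicator {a..<b})"
proof -
  have *: "square_integrable (indicator S)" if "S \<in> lmeasurable" for S :: "real set"
  proof -
    have "(\<lambda>t. (norm (indicator S t :: complex))\<^sup>2) = indicator S" by (auto simp: indicator_def)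
    with that show ?thesis
      by (auto simp: square_integrable_def fmeasurable_def intro!: integrable_real_indicator)
  qed
  show "square_integrable (indicator {a..b})" by (rule *) simp
  have "{a..<b} \<in> lmeasurable"
    by (intro bounded_set_imp_lmeasurable) auto
  then show "square_integrable (indicator {a..<b})" by (rule *)
qed

text \<open>Bounded support puts an L2 function into L1, where \<open>fourier_L1\<close> is
  meaningful; every transform of a truncation relies on this.\<close>

lemma square_integrable_integrable:
  assumes "square_integrable f" "\<And>t. t \<notin> {a..b} \<Longrightarrow> f t = 0"
  shows "integrable lebesgue f"
proof -
  have "(\<lambda>t. indicator {a..b} t * f t) = f"
    using assms(2) by (fastforce simp: indicator_def)
  then show ?thesis
    using square_integrable_mult_integrable[OF square_integrable_indicator_Icc assms(1), of a b] by simp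
qed

lemma indicator_scaleR_complex: "indicator S t *\<^sub>R (z :: complex) = indicator S t * z"
  by (simp add: indicator_def)

lemma integrable_indicator_continuous:
  fixes h :: "real \<Rightarrow> complex"
  assumes "continuous_on UNIV h"
  shows "integrable lebesgue (\<lambda>t. indicator {a..b} t * h t)"
proof -
  have "set_integrable lborel {a..b} h"
    unfolding set_integrable_def
    by (intro borel_integrable_compact continuous_on_subset[OF assms]) auto
  then have "integrable lborel (\<lambda>t. indicator {a..b} t * h t)"
    unfolding set_integrable_def indicator_scaleR_complex .
  then show ?thesis by (simp add: integrable_completion)
qed

lemma fourier_L1_cis: "fourier_L1 f \<xi> = (LINT t|lebesgue. f t * cis (- 2 * pi * t * \<xi>))"
  unfolding fourier_L1_def cis_conv_exp by (simp add: mult_ac)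

lemma integral_cis_Icc:
  assumes "c \<noteq> 0" "a \<le> b"
  shows "(LINT t|lebesgue. indicator {a..b} t * cis (c * t)) = (cis (c * b) - cis (c * a)) / (\<i> * c)"
proof -
  have "(LINT t|lborel. indicator {a..b} t *\<^sub>R cis (c * t)) = cis (c * b) / (\<i> * c) - cis (c * a) / (\<i> * c)"
  proof (rule integral_FTC_Icc)
    fix x
    have "((\<lambda>t. cis (c * t)) has_derivative (\<lambda>t. (c * t) *\<^sub>R (\<i> * cis (c * x)))) (at x within {a..b})"
      by (intro has_derivative_cis derivative_eq_intros) auto
    then have "((\<lambda>t. cis (c * t)) has_vector_derivative (c *\<^sub>R (\<i> * cis (c * x)))) (at x within {a..b})"
      unfolding has_vector_derivative_def by (simp add: mult.commute)
    then have "((\<lambda>t. cis (c * t) / (\<i> * c)) has_vector_derivative (c *\<^sub>R (\<i> * cis (c * x))) / (\<i> * c)) (at x within {a..b})"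
      by (rule has_vector_derivative_divide)
    moreover have "(c *\<^sub>R (\<i> * cis (c * x))) / (\<i> * c) = cis (c * x)"
      using assms(1) by (simp add: scaleR_conv_of_real)
    ultimately show "((\<lambda>t. cis (c * t) / (\<i> * c)) has_vector_derivative cis (c * x)) (at x within {a..b})" by simp
  qed (use assms in \<open>auto intro!: continuous_intros\<close>)
  moreover have "(LINT t|lborel. indicator {a..b} t *\<^sub>R cis (c * t)) = (LINT t|lborel. indicator {a..b} t * cis (c * t))"
    by (simp add: indicator_scaleR_complex)
  moreover have meas: "(\<lambda>t. cis (c * t)) \<in> borel_measurable borel"
    by (intro borel_measurable_continuous_onI continuous_intros)
  moreover have "(LINT t|lebesgue. indicator {a..b} t * cis (c * t)) = (LINT t|lborel. indicator {a..b} t * cis (c * t))"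
    by (intro integral_completion) (use meas in measurable)
  ultimately show ?thesis by (simp add: diff_divide_distrib)
qed

section \<open>Fourier series on an interval\<close>

text \<open>Fatou's lemma for bounds that may move with n. It passes from bounded windows to the
  whole line, from a subsequence to its L2 limit, and from nearly minimal moments to a minimal
  one.\<close>

lemma nn_integral_Fatou_bound:
  fixes u :: "nat \<Rightarrow> 'a \<Rightarrow> ennreal"
  assumes "\<And>n. u n \<in> borel_measurable M"
    and "AE x in M. (\<lambda>n. u n x) \<longlonglongrightarrow> v x"
    and "eventually (\<lambda>n. (\<integral>\<^sup>+x. u n x \<partial>M) \<le> C n) sequentially" and "C \<longlonglongrightarrow> c"
  shows "(\<integral>\<^sup>+x. v x \<partial>M) \<le> c"
proof -
  have "(\<integral>\<^sup>+x. v x \<partial>M) = (\<integral>\<^sup>+x. liminf (\<lambda>n. u n x) \<partial>M)"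
    by (rule nn_integral_cong_AE) (use assms(2) in \<open>auto elim!: eventually_mono intro!: lim_imp_Liminf[symmetric]\<close>)
  also have "\<dots> \<le> liminf (\<lambda>n. \<integral>\<^sup>+x. u n x \<partial>M)"
    by (intro nn_integral_liminf assms(1))
  also have "\<dots> \<le> liminf C"
    by (rule Liminf_mono[OF assms(3)])
  also have "\<dots> = c"
    using assms(4) by (intro lim_imp_Liminf) auto
  finally show ?thesis .
qed

section \<open>Orthogonality and Bessel's inequality for exponentials of period 2T\<close>

lemma integral_cis_period:
  fixes n :: int
  assumes "T > 0"
  shows "(LINT t|lebesgue. indicator {-T..T} t * cis (pi * n * t / T)) = (if n = 0 then of_real (2 * T) else 0)"
proof (cases "n = 0")
  case True
  have "(LINT t|lebesgue. indicator {-T..T} t *\<^sub>R (1 :: complex)) = measure lebesgue {-T..T} *\<^sub>R 1"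
    by simp
  from this[unfolded indicator_scaleR_complex] True assms show ?thesis
    by (simp add: scaleR_conv_of_real)
next
  case False
  have "sin (pi * n) = 0" by simp
  then have "cis (pi * n) = cis (- (pi * n))" by (simp add: complex_eq_iff)
  with integral_cis_Icc[of "pi * n / T" "-T" T] assms False show ?thesis
    by simp
qed

text \<open>The j-th term has frequency j/(2T): the period is the length of [-T,T], and pairing with
  the term gives \<open>fourier_L1\<close> at j/(2T).\<close>

definition trig :: "real \<Rightarrow> int set \<Rightarrow> (int \<Rightarrow> complex) \<Rightarrow> real \<Rightarrow> complex" where
  "trig T J c t = (\<Sum>j\<in>J. c j * cis (pi * j * t / T))"

lemma continuous_on_trig [continuous_intros]: "continuous_on S (trig T J c)"
  unfolding trig_def [abs_def] divide_inverse by (intro continuous_intros)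

lemma square_integrable_continuous_Icc:
  fixes h :: "real \<Rightarrow> complex"
  assumes "continuous_on UNIV h"
  shows "square_integrable (\<lambda>t. indicator {a..b} t * h t)"
proof -
  have "continuous_on UNIV (\<lambda>t. h t * cnj (h t))" by (intro continuous_intros assms)
  from integrable_indicator_continuous[OF this]
  have "integrable lebesgue (\<lambda>t. norm (indicator {a..b} t * (h t * cnj (h t))))" by (rule integrable_norm)
  moreover have "norm (indicator {a..b} t * (h t * cnj (h t))) = (norm (indicator {a..b} t * h t))\<^sup>2" for t
    by (auto simp: indicator_def norm_mult power2_eq_square)
  moreover have "(\<lambda>t. indicator {a..b} t * h t) \<in> borel_measurable lebesgue"
    using integrable_indicator_continuous[OF assms] by (rule borel_measurable_integrable)
  ultimately show ?thesis by (simp add: square_integrable_def)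
qed

text \<open>Parseval for finite sums: after expanding the square, \<open>integral_cis_period\<close>
  leaves only the diagonal.\<close>

lemma sqnorm_trig:
  assumes "T > 0" "finite J"
  shows "sqnorm (\<lambda>t. indicator {-T..T} t * trig T J c t) = 2 * T * (\<Sum>j\<in>J. (norm (c j))\<^sup>2)"
proof -
  have int: "integrable lebesgue (\<lambda>t. indicator {-T..T} t * cis (pi * of_int n * t / T))" for n :: int
    unfolding divide_inverse by (intro integrable_indicator_continuous continuous_intros)
  have eq: "of_real ((norm (indicator {-T..T} t * trig T J c t))\<^sup>2) =
      (\<Sum>j\<in>J. \<Sum>k\<in>J. c j * cnj (c k) * (indicator {-T..T} t * cis (pi * of_int (j - k) * t / T)))" for t
  proof -
    have "complex_of_real ((norm (indicator {-T..T} t * trig T J c t))\<^sup>2) = indicator {-T..T} t * (trig T J c t * cnj (trig T J c t))"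
      by (simp add: complex_norm_square indicator_def del: of_real_power)
    also have "trig T J c t * cnj (trig T J c t) =
        (\<Sum>j\<in>J. \<Sum>k\<in>J. c j * cis (pi * j * t / T) * (cnj (c k) * cis (- (pi * k * t / T))))"
      by (simp add: trig_def sum_product cis_cnj)
    also have "indicator {-T..T} t * \<dots> = (\<Sum>j\<in>J. \<Sum>k\<in>J. indicator {-T..T} t * (c j * cis (pi * j * t / T) * (cnj (c k) * cis (- (pi * k * t / T)))))"
      by (simp only: sum_distrib_left)
    also have "\<dots> = (\<Sum>j\<in>J. \<Sum>k\<in>J. c j * cnj (c k) * (indicator {-T..T} t * cis (pi * of_int (j - k) * t / T)))"
    proof (intro sum.cong refl)
      fix j k :: int
      have "cis (pi * of_int (j - k) * t / T) = cis (pi * j * t / T) * cis (- (pi * k * t / T))"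
        by (simp add: cis_mult algebra_simps diff_divide_distrib)
      then show "indicator {-T..T} t * (c j * cis (pi * j * t / T) * (cnj (c k) * cis (- (pi * k * t / T))))
          = c j * cnj (c k) * (indicator {-T..T} t * cis (pi * of_int (j - k) * t / T))"
        by (simp only: mult_ac)
    qed
    finally show ?thesis .
  qed
  have "complex_of_real (sqnorm (\<lambda>t. indicator {-T..T} t * trig T J c t)) =
      (LINT t|lebesgue. (\<Sum>j\<in>J. \<Sum>k\<in>J. c j * cnj (c k) * (indicator {-T..T} t * cis (pi * of_int (j - k) * t / T))))"
    unfolding sqnorm_def integral_complex_of_real[symmetric] eq ..
  also have "\<dots> = (\<Sum>j\<in>J. \<Sum>k\<in>J. c j * cnj (c k) * (if j - k = 0 then of_real (2 * T) else 0))"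
    using int by (simp add: Bochner_Integration.integral_sum integral_cis_period[OF assms(1)] del: of_int_diff)
  also have "\<dots> = (\<Sum>j\<in>J. c j * cnj (c j) * of_real (2 * T))"
    using assms(2) by (intro sum.cong refl) (simp add: if_distrib sum.delta' cong: if_cong)
  also have "\<dots> = of_real (2 * T * (\<Sum>j\<in>J. (norm (c j))\<^sup>2))"
    by (simp add: complex_norm_square sum_distrib_left mult_ac del: of_real_power)
  finally show ?thesis using of_real_eq_iff by blast
qed

lemma integrable_mult_cis:
  assumes "integrable lebesgue f"
  shows "integrable lebesgue (\<lambda>t. f t * cis (- 2 * pi * t * \<xi>))"
proof (rule Bochner_Integration.integrable_bound[OF assms])
  have "(\<lambda>t. cis (- 2 * pi * t * \<xi>)) \<in> borel_measurable lebesgue"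
    by (intro measurable_completion) (auto intro!: borel_measurable_continuous_onI continuous_intros)
  then show "(\<lambda>t. f t * cis (- 2 * pi * t * \<xi>)) \<in> borel_measurable lebesgue"
    using assms by auto
qed (auto simp: norm_mult)

lemma integral_mult_trig:
  assumes "square_integrable G" "\<And>t. t \<notin> {-T..T} \<Longrightarrow> G t = 0"
  shows "(LINT t|lebesgue. G t * cnj (indicator {-T..T} t * trig T J c t)) =
    (\<Sum>j\<in>J. cnj (c j) * fourier_L1 G (j / (2 * T)))"
proof -
  have G: "integrable lebesgue G" using assms by (rule square_integrable_integrable)
  note int = integrable_mult_cis[OF G]
  have "G t * cnj (indicator {-T..T} t * trig T J c t) = (\<Sum>j\<in>J. cnj (c j) * (G t * cis (- 2 * pi * t * (j / (2 * T)))))" for t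
  proof (cases "t \<in> {-T..T}")
    case True
    then show ?thesis by (simp add: trig_def sum_distrib_left cis_cnj mult_ac)
  qed (use assms(2) in auto)
  then show ?thesis
    unfolding fourier_L1_cis
    by (simp only: Bochner_Integration.integral_sum integrable_mult_right int integral_mult_right_zero)
qed

text \<open>Duality: pair G with the trigonometric polynomial whose coefficients are the Fourier
  coefficients of G. The pairing equals their square sum S, and Cauchy-Schwarz bounds S^2 by 2T S
  times the squared norm of G. The shift s is absorbed by the modulation H, which does not change
  the norm.\<close>

lemma bessel_fourier_L1:
  fixes J :: "int set"
  assumes "T > 0" "finite J" and G: "square_integrable G" "\<And>t. t \<notin> {-T..T} \<Longrightarrow> G t = 0"
  shows "(\<Sum>j\<in>J. (norm (fourier_L1 G (s + j / (2 * T))))\<^sup>2) \<le> 2 * T * sqnorm G"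
proof -
  define H where "H t = cis (- 2 * pi * t * s) * G t" for t
  have H: "square_integrable H" "\<And>t. t \<notin> {-T..T} \<Longrightarrow> H t = 0"
    unfolding H_def
    by (rule square_integrable_bounded_mult[OF G(1), where B = 1], intro measurable_completion)
      (auto intro!: borel_measurable_continuous_onI continuous_intros simp: G(2))
  have sq: "sqnorm H = sqnorm G" by (simp add: sqnorm_def H_def norm_mult)
  have shift: "fourier_L1 H \<xi> = fourier_L1 G (s + \<xi>)" for \<xi>
  proof -
    have "cis (- 2 * pi * t * (s + \<xi>)) = cis (- 2 * pi * t * s) * cis (- 2 * pi * t * \<xi>)" for t
      by (simp add: cis_mult algebra_simps)
    then show ?thesis unfolding fourier_L1_cis H_def by (simp only: mult_ac)
  qed
  define a where "a j = fourier_L1 H (of_int j / (2 * T))" for j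
  define S where "S = (\<Sum>j\<in>J. (norm (a j))\<^sup>2)"
  have "(norm (LINT t|lebesgue. H t * cnj (indicator {-T..T} t * trig T J a t)))\<^sup>2
      \<le> sqnorm H * (2 * T * S)"
  proof -
    have "(norm (LINT t|lebesgue. H t * cnj (indicator {-T..T} t * trig T J a t)))\<^sup>2
        \<le> sqnorm H * sqnorm (\<lambda>t. cnj (indicator {-T..T} t * trig T J a t))"
      by (intro square_integrable_Cauchy_Schwarz H square_integrable_cnj square_integrable_continuous_Icc continuous_intros)
    then show ?thesis unfolding sqnorm_cnj sqnorm_trig[OF assms(1,2)] S_def .
  qed
  moreover have "(LINT t|lebesgue. H t * cnj (indicator {-T..T} t * trig T J a t)) = of_real S"
  proof -
    have "(LINT t|lebesgue. H t * cnj (indicator {-T..T} t * trig T J a t)) = (\<Sum>j\<in>J. cnj (a j) * a j)"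
      unfolding a_def by (rule integral_mult_trig[OF H])
    then show ?thesis by (simp only: S_def of_real_sum complex_norm_square mult.commute)
  qed
  ultimately have "S * S \<le> (2 * T * sqnorm G) * S" by (simp add: sq power2_eq_square mult_ac)
  moreover have "S \<ge> 0" by (simp add: S_def sum_nonneg)
  moreover have "0 \<le> 2 * T * sqnorm G" using assms(1) by simp
  ultimately have "S \<le> 2 * T * sqnorm G" by (cases "S = 0") auto
  then show ?thesis by (simp add: S_def a_def shift)
qed

text \<open>Dominated convergence along sequences. Continuity serves as the source of measurability
  of the transform.\<close>

lemma continuous_on_fourier_L1:
  assumes "integrable lebesgue f"
  shows "continuous_on UNIV (fourier_L1 f)"
proof (rule continuous_at_imp_continuous_on, rule ballI)
  fix \<xi> :: real
  show "isCont (fourier_L1 f) \<xi>"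
    unfolding continuous_at_sequentially comp_def
  proof (intro allI impI)
    fix x :: "nat \<Rightarrow> real" assume x: "x \<longlonglongrightarrow> \<xi>"
    show "(\<lambda>n. fourier_L1 f (x n)) \<longlonglongrightarrow> fourier_L1 f \<xi>"
      unfolding fourier_L1_cis
    proof (rule integral_dominated_convergence[where w = "\<lambda>t. norm (f t)"])
      have [measurable]: "(\<lambda>t. cis (- 2 * pi * t * y)) \<in> borel_measurable lebesgue" for y
        by (intro measurable_completion) (auto intro!: borel_measurable_continuous_onI continuous_intros)
      have [measurable]: "f \<in> borel_measurable lebesgue" using assms by auto
      show "(\<lambda>t. f t * cis (- 2 * pi * t * \<xi>)) \<in> borel_measurable lebesgue" by measurable
      show "(\<lambda>t. f t * cis (- 2 * pi * t * x n)) \<in> borel_measurable lebesgue" for n by measurable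
      show "AE t in lebesgue. (\<lambda>n. f t * cis (- 2 * pi * t * x n)) \<longlonglongrightarrow> f t * cis (- 2 * pi * t * \<xi>)"
        by (intro always_eventually allI tendsto_intros x)
    qed (use assms in \<open>auto simp: norm_mult\<close>)
  qed
qed

text \<open>Bessel's inequality for the frequencies \<open>s + j / (2 * T)\<close>, integrated over \<open>s\<close> in one period.\<close>

lemma nn_integral_fourier_L1_le:
  assumes "T > 0" and G: "square_integrable G" "\<And>t. t \<notin> {-T..T} \<Longrightarrow> G t = 0"
  shows "(\<integral>\<^sup>+\<xi>. ennreal ((norm (fourier_L1 G \<xi>))\<^sup>2) \<partial>lebesgue) \<le> ennreal (sqnorm G)"
proof -
  define l where "l = 1 / (2 * T)"
  have l: "l > 0" using assms(1) by (simp add: l_def)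
  define h where "h \<xi> = ennreal ((norm (fourier_L1 G \<xi>))\<^sup>2)" for \<xi>
  have [measurable]: "fourier_L1 G \<in> borel_measurable borel"
    by (intro borel_measurable_continuous_onI continuous_on_fourier_L1 square_integrable_integrable[OF G])
  have [measurable]: "h \<in> borel_measurable borel" unfolding h_def by measurable
  have bound: "(\<integral>\<^sup>+\<xi>. h \<xi> * indicator {- real n * l..<real n * l} \<xi> \<partial>lborel) \<le> ennreal (sqnorm G)" for n
  proof -
    let ?J = "{- int n..<int n}"
    have "(\<integral>\<^sup>+\<xi>. h \<xi> * indicator {- real n * l..<real n * l} \<xi> \<partial>lborel)
        \<le> (\<integral>\<^sup>+\<xi>. (\<Sum>j\<in>?J. h \<xi> * indicator {j * l..<(j + 1) * l} \<xi>) \<partial>lborel)"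
    proof (rule nn_integral_mono)
      fix \<xi> :: real
      show "h \<xi> * indicator {- real n * l..<real n * l} \<xi> \<le> (\<Sum>j\<in>?J. h \<xi> * indicator {j * l..<(j + 1) * l} \<xi>)"
      proof (cases "\<xi> \<in> {- real n * l..<real n * l}")
        case True
        define j where "j = \<lfloor>\<xi> / l\<rfloor>"
        have "real_of_int j \<le> \<xi> / l" "\<xi> / l < real_of_int j + 1" by (auto simp: j_def)
        then have 1: "\<xi> \<in> {j * l..<(j + 1) * l}" using l by (auto simp: field_simps)
        have "- real n \<le> \<xi> / l" "\<xi> / l < real n" using True l by (auto simp: field_simps)
        then have 2: "j \<in> ?J" unfolding j_def by (auto simp: le_floor_iff floor_less_iff)
        have "h \<xi> * indicator {- real n * l..<real n * l} \<xi> = h \<xi> * indicator {j * l..<(j + 1) * l} \<xi>"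
          using True 1 by simp
        also have "\<dots> \<le> (\<Sum>j\<in>?J. h \<xi> * indicator {j * l..<(j + 1) * l} \<xi>)"
          using 2 by (intro member_le_sum) auto
        finally show ?thesis .
      qed simp
    qed
    also have "\<dots> = (\<Sum>j\<in>?J. \<integral>\<^sup>+\<xi>. h \<xi> * indicator {j * l..<(j + 1) * l} \<xi> \<partial>lborel)"
      by (intro nn_integral_sum) simp
    also have "\<dots> = (\<Sum>j\<in>?J. \<integral>\<^sup>+s. h (s + j / (2 * T)) * indicator {0..<l} s \<partial>lborel)"
    proof (intro sum.cong refl)
      fix j :: int
      have "(\<integral>\<^sup>+\<xi>. h \<xi> * indicator {j * l..<(j + 1) * l} \<xi> \<partial>lborel) =
          (\<integral>\<^sup>+s. h (j * l + 1 * s) * indicator {j * l..<(j + 1) * l} (j * l + 1 * s) \<partial>lborel)"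
        by (subst nn_integral_real_affine[where c = 1 and t = "j * l"]) auto
      also have "\<dots> = (\<integral>\<^sup>+s. h (s + j / (2 * T)) * indicator {0..<l} s \<partial>lborel)"
        by (intro nn_integral_cong) (auto simp: l_def indicator_def algebra_simps add_divide_distrib)
      finally show "(\<integral>\<^sup>+\<xi>. h \<xi> * indicator {j * l..<(j + 1) * l} \<xi> \<partial>lborel) = \<dots>" .
    qed
    also have "\<dots> = (\<integral>\<^sup>+s. (\<Sum>j\<in>?J. h (s + j / (2 * T)) * indicator {0..<l} s) \<partial>lborel)"
      by (intro nn_integral_sum[symmetric]) simp
    \<comment> \<open>All cells now lie over the same s, so a single Bessel sum bounds the
      integrand; the length l of the period then cancels the factor 2T.\<close>
    also have "\<dots> \<le> (\<integral>\<^sup>+s. ennreal (2 * T * sqnorm G) * indicator {0..<l} s \<partial>lborel)"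
    proof (rule nn_integral_mono)
      fix s :: real
      have "(\<Sum>j\<in>?J. h (s + j / (2 * T))) \<le> ennreal (2 * T * sqnorm G)"
        unfolding h_def by (subst sum_ennreal) (auto intro!: ennreal_leI bessel_fourier_L1 assms)
      then show "(\<Sum>j\<in>?J. h (s + j / (2 * T)) * indicator {0..<l} s) \<le> ennreal (2 * T * sqnorm G) * indicator {0..<l} s"
        by (simp flip: sum_distrib_right add: mult_right_mono)
    qed
    also have "\<dots> = ennreal (2 * T * sqnorm G) * ennreal l"
      using l by (simp add: nn_integral_cmult)
    also have "\<dots> = ennreal (sqnorm G)"
      using l assms(1) by (simp add: l_def flip: ennreal_mult)
    finally show ?thesis .
  qed
  have "(\<integral>\<^sup>+\<xi>. h \<xi> \<partial>lborel) \<le> ennreal (sqnorm G)"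
  proof (rule nn_integral_Fatou_bound[where u = "\<lambda>n \<xi>. h \<xi> * indicator {- real n * l..<real n * l} \<xi>", OF _ _ _ tendsto_const])
    show "(\<lambda>\<xi>. h \<xi> * indicator {- real n * l..<real n * l} \<xi>) \<in> borel_measurable lborel" for n
      by measurable
    show "AE \<xi> in lborel. (\<lambda>n. h \<xi> * indicator {- real n * l..<real n * l} \<xi>) \<longlonglongrightarrow> h \<xi>"
    proof (rule AE_I2, rule tendsto_eventually)
      fix \<xi> :: real
      obtain N :: nat where N: "\<bar>\<xi>\<bar> / l < real N" using reals_Archimedean2 by blast
      show "eventually (\<lambda>n. h \<xi> * indicator {- real n * l..<real n * l} \<xi> = h \<xi>) sequentially"
        using eventually_ge_at_top[of N]
      proof eventually_elim
        case (elim n)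
        then have "\<bar>\<xi>\<bar> < real n * l" using N l
          by (smt (verit, best) of_nat_mono pos_divide_less_eq mult_right_mono)
        then have "\<xi> \<in> {- real n * l..<real n * l}" by auto
        then show ?case by simp
      qed
    qed
  qed (use bound in auto)
  then show ?thesis by (simp add: nn_integral_completion h_def)
qed

section \<open>The Fourier transform on $L^2$\<close>

text \<open>Along a subsequence whose increments \<open>D k\<close> have squared norm at most \<open>4 ^ -k\<close>, the series of
  \<open>2 ^ k * \<bar>D k\<bar>\<^sup>2\<close> is integrable, and \<open>\<bar>D k\<bar> \<le> 2 ^ k * \<bar>D k\<bar>\<^sup>2 + 2 ^ -k\<close> gives pointwise
  convergence almost everywhere.\<close>

lemma L2_complete:
  fixes u :: "nat \<Rightarrow> 'a \<Rightarrow> complex"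
  assumes [measurable]: "\<And>n. u n \<in> borel_measurable M"
    and cauchy: "\<And>m n. m \<le> n \<Longrightarrow> (\<integral>\<^sup>+x. ennreal ((norm (u n x - u m x))\<^sup>2) \<partial>M) \<le> \<tau> m"
    and tau: "\<tau> \<longlonglongrightarrow> 0"
  obtains g where "g \<in> borel_measurable M"
    "\<And>m. (\<integral>\<^sup>+x. ennreal ((norm (u m x - g x))\<^sup>2) \<partial>M) \<le> \<tau> m"
proof -
  have "\<exists>N. \<forall>n\<ge>N. \<tau> n \<le> ennreal ((1/4) ^ k)" for k :: nat
  proof -
    have "0 < ennreal ((1/4) ^ k)" by simp
    from order_tendstoD(2)[OF tau this] show ?thesis
      by (auto simp: eventually_sequentially intro: less_imp_le)
  qed
  then obtain N where N: "\<And>k n. N k \<le> n \<Longrightarrow> \<tau> n \<le> ennreal ((1/4) ^ k)" by metis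
  \<comment> \<open>The partial sums make \<open>r\<close> monotone and at least \<open>N k\<close>;
    the summand k makes it unbounded.\<close>
  define r where "r k = k + (\<Sum>i\<le>k. N i)" for k
  have r_Suc: "r k \<le> r (Suc k)" and r_ge: "k \<le> r k" and r_N: "N k \<le> r k" for k
    by (auto simp: r_def intro!: trans_le_add2 member_le_sum)
  define D where "D k x = u (r (Suc k)) x - u (r k) x" for k x
  have [measurable]: "D k \<in> borel_measurable M" for k unfolding D_def by measurable
  have D: "(\<integral>\<^sup>+x. ennreal (2 ^ k * (norm (D k x))\<^sup>2) \<partial>M) \<le> ennreal ((1/2) ^ k)" for k
  proof -
    have "(\<integral>\<^sup>+x. ennreal (2 ^ k * (norm (D k x))\<^sup>2) \<partial>M) = ennreal (2 ^ k) * (\<integral>\<^sup>+x. ennreal ((norm (D k x))\<^sup>2) \<partial>M)"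
      by (subst nn_integral_cmult[symmetric]) (auto simp: ennreal_mult)
    also have "\<dots> \<le> ennreal (2 ^ k) * ennreal ((1/4) ^ k)"
      unfolding D_def using cauchy[OF r_Suc] N[OF r_N] by (intro mult_left_mono) (auto intro: order_trans)
    also have "\<dots> = ennreal ((1/2) ^ k)"
      by (simp flip: ennreal_mult power_mult_distrib)
    finally show ?thesis .
  qed
  have "(\<integral>\<^sup>+x. (\<Sum>k. ennreal (2 ^ k * (norm (D k x))\<^sup>2)) \<partial>M) = (\<Sum>k. \<integral>\<^sup>+x. ennreal (2 ^ k * (norm (D k x))\<^sup>2) \<partial>M)"
    by (intro nn_integral_suminf) measurable
  also have "\<dots> \<le> (\<Sum>k. ennreal ((1/2) ^ k))"
    by (intro suminf_le D) auto
  also have "\<dots> = ennreal (\<Sum>k. (1/2) ^ k)"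
    by (intro suminf_ennreal2 summable_geometric) auto
  also have "\<dots> < \<infinity>" by simp
  finally have "AE x in M. (\<Sum>k. ennreal (2 ^ k * (norm (D k x))\<^sup>2)) \<noteq> \<infinity>"
    by (intro nn_integral_PInf_AE) auto
  then have conv: "AE x in M. (\<lambda>k. u (r k) x) \<longlonglongrightarrow> lim (\<lambda>k. u (r k) x)"
  proof eventually_elim
    case (elim x)
    then have 1: "summable (\<lambda>k. 2 ^ k * (norm (D k x))\<^sup>2)"
      by (intro summable_suminf_not_top) auto
    have "summable (\<lambda>k. D k x)"
    proof (rule summable_comparison_test'[where N = 0])
      show "summable (\<lambda>k. 2 ^ k * (norm (D k x))\<^sup>2 + (1/2) ^ k)"
        by (intro summable_add 1 summable_geometric) auto
      fix k :: nat
      let ?d = "norm (D k x)" and ?p = "(2 :: real) ^ k"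
      have "0 \<le> (?p * ?d - 1)\<^sup>2" by simp
      then have "2 * (?p * ?d) \<le> ?p * (?p * ?d\<^sup>2) + 1" by (simp add: power2_eq_square algebra_simps)
      then have "2 * ?d \<le> ?p * ?d\<^sup>2 + 1 / ?p" by (simp add: field_simps)
      then show "?d \<le> ?p * ?d\<^sup>2 + (1/2) ^ k"
        unfolding power_one_over using norm_ge_zero[of "D k x"] by linarith
    qed
    then have "convergent (\<lambda>n. \<Sum>k<n. D k x)" by (simp add: summable_iff_convergent)
    then have "convergent (\<lambda>n. u (r 0) x + (\<Sum>k<n. D k x))"
      by (intro convergent_add convergent_const)
    also have "(\<lambda>n. u (r 0) x + (\<Sum>k<n. D k x)) = (\<lambda>k. u (r k) x)"
      unfolding D_def using sum_lessThan_telescope[of "\<lambda>k. u (r k) x"] by auto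
    finally show ?case by (simp add: convergent_LIMSEQ_iff)
  qed
  show ?thesis
  proof
    \<comment> \<open>Where the subsequence diverges, \<open>lim\<close> is an unspecified value; by
      \<open>conv\<close> this happens only on a null set.\<close>
    show "(\<lambda>x. lim (\<lambda>k. u (r k) x)) \<in> borel_measurable M" by measurable
    fix m
    show "(\<integral>\<^sup>+x. ennreal ((norm (u m x - lim (\<lambda>k. u (r k) x)))\<^sup>2) \<partial>M) \<le> \<tau> m"
    proof (rule nn_integral_Fatou_bound[where u = "\<lambda>k x. ennreal ((norm (u m x - u (r k) x))\<^sup>2)", OF _ _ _ tendsto_const])
      show "AE x in M. (\<lambda>k. ennreal ((norm (u m x - u (r k) x))\<^sup>2)) \<longlonglongrightarrow> ennreal ((norm (u m x - lim (\<lambda>k. u (r k) x)))\<^sup>2)"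
        using conv by eventually_elim (intro tendsto_intros)
      show "eventually (\<lambda>k. (\<integral>\<^sup>+x. ennreal ((norm (u m x - u (r k) x))\<^sup>2) \<partial>M) \<le> \<tau> m) sequentially"
        using eventually_ge_at_top[of m]
      proof eventually_elim
        case (elim k)
        then have "m \<le> r k" using r_ge order_trans by blast
        from cauchy[OF this] show ?case by (simp add: norm_minus_commute)
      qed
    qed measurable
  qed
qed

lemma sqnorm_dominated_tendsto:
  assumes "\<And>n. h n \<in> borel_measurable lebesgue" "f \<in> borel_measurable lebesgue"
    and "square_integrable w"
    and "AE t in lebesgue. (\<lambda>n. h n t) \<longlonglongrightarrow> f t"
    and "\<And>n. AE t in lebesgue. norm (h n t) \<le> norm (w t)"
  shows "(\<lambda>n. sqnorm (h n)) \<longlonglongrightarrow> sqnorm f"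
  unfolding sqnorm_def
proof (rule integral_dominated_convergence[where w = "\<lambda>t. (norm (w t))\<^sup>2"])
  show "AE t in lebesgue. (\<lambda>n. (norm (h n t))\<^sup>2) \<longlonglongrightarrow> (norm (f t))\<^sup>2"
    using assms(4) by eventually_elim (intro tendsto_intros)
  show "AE t in lebesgue. norm ((norm (h n t))\<^sup>2) \<le> (norm (w t))\<^sup>2" for n
    using assms(5)[of n] by eventually_elim (auto intro: power_mono)
qed (use assms in \<open>auto simp: square_integrable_def\<close>)

lemma eventually_mem_Icc_nat: "eventually (\<lambda>n::nat. t \<in> {- real n..real n}) sequentially"
proof -
  obtain N :: nat where "\<bar>t\<bar> \<le> real N" using real_arch_simple by blast
  then show ?thesis unfolding eventually_sequentially by (intro exI[of _ N]) force
qed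

lemma sqnorm_tail_tendsto_zero:
  assumes "square_integrable f"
  shows "(\<lambda>n::nat. sqnorm (\<lambda>t. indicator (- {- real n..real n}) t * f t)) \<longlonglongrightarrow> 0"
proof -
  have "(\<lambda>n::nat. sqnorm (\<lambda>t. indicator (- {- real n..real n}) t * f t)) \<longlonglongrightarrow> sqnorm (\<lambda>t. 0)"
  proof (rule sqnorm_dominated_tendsto[OF _ _ assms])
    show "AE t in lebesgue. (\<lambda>n::nat. indicator (- {- real n..real n}) t * f t) \<longlonglongrightarrow> 0"
    proof (rule AE_I2, rule tendsto_eventually)
      fix t
      show "eventually (\<lambda>n::nat. indicator (- {- real n..real n}) t * f t = 0) sequentially"
        using eventually_mem_Icc_nat[of t] by eventually_elim simp
    qed
    show "(\<lambda>t. indicator (- {- real n..real n}) t * f t) \<in> borel_measurable lebesgue" for n :: nat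
      by (intro square_integrable_measurable square_integrable_indicator_mult assms) auto
  qed (auto simp: indicator_def)
  then show ?thesis by (simp add: sqnorm_def)
qed

lemma sqnorm_mono:
  assumes "f \<in> borel_measurable lebesgue" and "square_integrable g"
    and "\<And>t. norm (f t) \<le> norm (g t)"
  shows "sqnorm f \<le> sqnorm g"
  unfolding sqnorm_def using assms square_integrable_bound[OF assms]
  by (intro integral_mono) (auto simp: square_integrable_def intro!: power_mono)

lemma fourier_L1_diff:
  assumes "integrable lebesgue f" "integrable lebesgue g"
  shows "fourier_L1 (\<lambda>t. f t - g t) \<xi> = fourier_L1 f \<xi> - fourier_L1 g \<xi>"
  unfolding fourier_L1_cis left_diff_distrib
  using assms by (intro Bochner_Integration.integral_diff integrable_mult_cis)

lemma borel_measurable_fourier_L1: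
  assumes "integrable lebesgue f"
  shows "fourier_L1 f \<in> borel_measurable lebesgue"
  by (intro measurable_completion) (auto intro!: borel_measurable_continuous_onI continuous_on_fourier_L1 assms)

lemma square_integrable_fourier_L1:
  assumes "square_integrable f" "\<And>t. t \<notin> {a..b} \<Longrightarrow> f t = 0"
  shows "square_integrable (fourier_L1 f)"
proof -
  \<comment> \<open>A symmetric window containing {a..b}; the 1 keeps it of positive length when a =
    b = 0.\<close>
  let ?T = "\<bar>a\<bar> + \<bar>b\<bar> + 1"
  have T: "f t = 0" if "t \<notin> {-?T..?T}" for t using that by (intro assms(2)) auto
  have "(\<integral>\<^sup>+\<xi>. ennreal ((norm (fourier_L1 f \<xi>))\<^sup>2) \<partial>lebesgue) \<le> ennreal (sqnorm f)"
    by (rule nn_integral_fourier_L1_le[where T = ?T]) (use T assms in auto)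
  also have "\<dots> < \<infinity>" by simp
  finally show ?thesis
    unfolding square_integrable_iff_nn
    by (auto intro!: borel_measurable_fourier_L1 square_integrable_integrable[OF assms])
qed

text \<open>Two truncations differ only in the tail of f, whose mass \<open>\<tau> m\<close> tends
  to 0. The contraction on compactly supported functions carries this over to the transforms, and
  \<open>L2_complete\<close> supplies the limit.\<close>

lemma fourier_L2_limit:
  assumes f: "square_integrable f"
  obtains g where "is_fourier_L2 f g" "sqnorm g \<le> sqnorm f"
proof -
  define fn where "fn n t = indicator {- real n..real n} t * f t" for n :: nat and t
  define \<tau> where "\<tau> n = ennreal (sqnorm (\<lambda>t. indicator (- {- real n..real n}) t * f t))" for n :: nat
  have fn: "square_integrable (fn n)" for n
    unfolding fn_def by (intro square_integrable_indicator_mult f) auto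
  have fn0: "fn n t = 0" if "t \<notin> {- real n..real n}" for n t using that by (simp add: fn_def)
  have fn_int: "integrable lebesgue (fn n)" for n
    by (rule square_integrable_integrable[OF fn fn0])
  have tau0: "\<tau> \<longlonglongrightarrow> 0"
    unfolding \<tau>_def using tendsto_ennrealI[OF sqnorm_tail_tendsto_zero[OF f]] by simp
  have cauchy: "(\<integral>\<^sup>+\<xi>. ennreal ((norm (fourier_L1 (fn n) \<xi> - fourier_L1 (fn m) \<xi>))\<^sup>2) \<partial>lebesgue) \<le> \<tau> m" if "m \<le> n" for m n
  proof -
    have "(\<integral>\<^sup>+\<xi>. ennreal ((norm (fourier_L1 (\<lambda>t. fn n t - fn m t) \<xi>))\<^sup>2) \<partial>lebesgue) \<le> ennreal (sqnorm (\<lambda>t. fn n t - fn m t))"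
    proof (rule nn_integral_fourier_L1_le[where T = "real n + 1"])
      show "fn n t - fn m t = 0" if "t \<notin> {- (real n + 1)..real n + 1}" for t
        using that \<open>m \<le> n\<close> by (subst (1 2) fn0) auto
    qed (auto intro: square_integrable_diff fn)
    also have "\<dots> \<le> \<tau> m" unfolding \<tau>_def
      using that f
      by (intro ennreal_leI sqnorm_mono square_integrable_measurable square_integrable_diff fn square_integrable_indicator_mult)
         (auto simp: fn_def indicator_def)
    finally show ?thesis by (simp add: fourier_L1_diff fn_int)
  qed
  obtain g where g [measurable]: "g \<in> borel_measurable lebesgue"
    and lim: "\<And>m. (\<integral>\<^sup>+\<xi>. ennreal ((norm (fourier_L1 (fn m) \<xi> - g \<xi>))\<^sup>2) \<partial>lebesgue) \<le> \<tau> m"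
    using L2_complete[of "\<lambda>n. fourier_L1 (fn n)" lebesgue \<tau>, OF _ cauchy tau0] borel_measurable_fourier_L1[OF fn_int]
    by blast
  \<comment> \<open>The truncation with n = 0 lives on the single point 0, so its transform
    vanishes. The error estimate at index 0 thereby becomes the norm bound on g.\<close>
  have "fourier_L1 (fn 0) \<xi> = (LINT t::real|lebesgue. 0)" for \<xi>
    unfolding fourier_L1_cis
  proof (rule Bochner_Integration.integral_cong_AE)
    have "AE t in lebesgue. t \<noteq> 0" 
      by (rule AE_I[where N = "{0}"]) auto
    then show "AE t in lebesgue. fn 0 t * cis (- 2 * pi * t * \<xi>) = 0"
      by eventually_elim (simp add: fn_def)
  qed (use integrable_mult_cis[OF fn_int] in auto)
  then have "(\<integral>\<^sup>+\<xi>. ennreal ((norm (g \<xi>))\<^sup>2) \<partial>lebesgue) \<le> \<tau> 0"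
    using lim[of 0] by simp
  also have "\<tau> 0 \<le> ennreal (sqnorm f)"
    unfolding \<tau>_def using f
    by (intro ennreal_leI sqnorm_mono square_integrable_measurable[OF square_integrable_indicator_mult]) (auto simp: indicator_def)
  finally have le: "(\<integral>\<^sup>+\<xi>. ennreal ((norm (g \<xi>))\<^sup>2) \<partial>lebesgue) \<le> ennreal (sqnorm f)" .
  also have "\<dots> < \<infinity>" by simp
  finally have gs: "square_integrable g" by (simp add: square_integrable_iff_nn g)
  have "sqnorm g \<le> sqnorm f" using le by (simp add: nn_integral_eq_sqnorm gs)
  moreover have "is_fourier_L2 f g"
    unfolding is_fourier_L2_def fn_def[symmetric, abs_def]
    using gs tendsto_sandwich[OF always_eventually always_eventually tendsto_const tau0, of "\<lambda>m. (\<integral>\<^sup>+\<xi>. ennreal ((norm (fourier_L1 (fn m) \<xi> - g \<xi>))\<^sup>2) \<partial>lebesgue)"] lim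
    by simp
  ultimately show ?thesis using that by blast
qed

lemma is_fourier_L2_fourier_L2: "square_integrable f \<Longrightarrow> is_fourier_L2 f (fourier_L2 f)"
  unfolding fourier_L2_def by (metis fourier_L2_limit someI_ex)

lemma sigma_finite_lebesgue: "sigma_finite_measure (lebesgue :: real measure)"
proof
  show "\<exists>A. countable A \<and> A \<subseteq> sets (lebesgue :: real measure) \<and> \<Union> A = space lebesgue \<and> (\<forall>a\<in>A. emeasure lebesgue a \<noteq> \<infinity>)"
  proof (intro exI[of _ "range (\<lambda>n::nat. {- real n..real n})"] conjI ballI)
    have "x \<in> (\<Union>n::nat. {- real n..real n})" for x
      using eventually_mem_Icc_nat[of x] by (auto simp: eventually_sequentially)
    then show "\<Union> (range (\<lambda>n::nat. {- real n..real n})) = space lebesgue" by auto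
  qed auto
qed

text \<open>Fubini, since the kernel is symmetric in t and \<xi> and has modulus 1, so the double
  integral converges absolutely.\<close>

lemma fourier_L1_multiplication:
  assumes f: "integrable lebesgue f" and h: "integrable lebesgue h"
  shows "(LINT \<xi>|lebesgue. h \<xi> * fourier_L1 f \<xi>) = (LINT t|lebesgue. f t * fourier_L1 h t)"
proof -
  interpret L: sigma_finite_measure "lebesgue :: real measure" by (rule sigma_finite_lebesgue)
  interpret P: pair_sigma_finite "lebesgue :: real measure" "lebesgue :: real measure" ..
  have [measurable]: "f \<in> borel_measurable lebesgue" "h \<in> borel_measurable lebesgue" using f h by auto
  have [measurable]: "(\<lambda>x::real. x) \<in> borel_measurable lebesgue" by (intro measurable_completion) simp
  have c [measurable]: "cis \<in> borel_measurable borel"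
    by (intro borel_measurable_continuous_onI continuous_intros)
  have [measurable]: "(\<lambda>p. fst p :: real) \<in> borel_measurable (lebesgue \<Otimes>\<^sub>M lebesgue)"
    "(\<lambda>p. snd p :: real) \<in> borel_measurable (lebesgue \<Otimes>\<^sub>M lebesgue)"
    by (rule measurable_compose[OF measurable_fst], simp, rule measurable_compose[OF measurable_snd], simp)
  let ?F = "\<lambda>t \<xi>. h \<xi> * (f t * cis (- 2 * pi * t * \<xi>))"
  have "integrable (lebesgue \<Otimes>\<^sub>M lebesgue) (case_prod ?F)"
  proof (rule P.Fubini_integrable)
    have "(\<lambda>p. cis (- 2 * pi * fst p * snd p)) \<in> borel_measurable (lebesgue \<Otimes>\<^sub>M lebesgue)"
      by (rule measurable_compose[OF _ c]) measurable
    then show "case_prod ?F \<in> borel_measurable (lebesgue \<Otimes>\<^sub>M lebesgue)"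
      unfolding case_prod_beta by measurable
    show "integrable lebesgue (\<lambda>t. LINT \<xi>|lebesgue. norm (case (t, \<xi>) of (t, \<xi>) \<Rightarrow> ?F t \<xi>))"
      using f h by (simp add: norm_mult)
    show "AE t in lebesgue. integrable lebesgue (\<lambda>\<xi>. case (t, \<xi>) of (t, \<xi>) \<Rightarrow> ?F t \<xi>)"
    proof (rule AE_I2)
      fix t
      have "integrable lebesgue (\<lambda>\<xi>. f t * (h \<xi> * cis (- 2 * pi * \<xi> * t)))"
        by (intro integrable_mult_right integrable_mult_cis h)
      then show "integrable lebesgue (\<lambda>\<xi>. case (t, \<xi>) of (t, \<xi>) \<Rightarrow> ?F t \<xi>)"
        by (simp add: mult_ac)
    qed
  qed
  from P.Fubini_integral[OF this]
  have "(LINT \<xi>|lebesgue. LINT t|lebesgue. ?F t \<xi>) = (LINT t|lebesgue. LINT \<xi>|lebesgue. ?F t \<xi>)" .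
  moreover have "(LINT t|lebesgue. ?F t \<xi>) = h \<xi> * fourier_L1 f \<xi>" for \<xi>
    by (simp add: fourier_L1_cis)
  moreover have "(LINT \<xi>|lebesgue. ?F t \<xi>) = f t * fourier_L1 h t" for t
  proof -
    have "(LINT \<xi>|lebesgue. ?F t \<xi>) = (LINT \<xi>|lebesgue. f t * (h \<xi> * cis (- 2 * pi * \<xi> * t)))"
      by (intro Bochner_Integration.integral_cong refl) (simp add: mult_ac)
    then show ?thesis by (simp add: fourier_L1_cis)
  qed
  ultimately show ?thesis by (simp only:)
qed

text \<open>All that is needed of the transform on $L^2$: the multiplication formula against interval
  indicators. Unlike \<open>is_fourier_L2\<close> it is visibly linear in the pair.\<close>

definition fourier_pair :: "(real \<Rightarrow> complex) \<Rightarrow> (real \<Rightarrow> complex) \<Rightarrow> bool" where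
  "fourier_pair f g \<longleftrightarrow> square_integrable f \<and> square_integrable g \<and>
     (\<forall>a b. (LINT \<xi>|lebesgue. indicator {a..<b} \<xi> * g \<xi>) =
            (LINT t|lebesgue. f t * fourier_L1 (indicator {a..<b}) t))"

lemma square_integrable_fourier_L1_Ico: "square_integrable (fourier_L1 (indicator {a..<b}))"
  by (rule square_integrable_fourier_L1[where a = a and b = b]) (auto simp: square_integrable_indicator_Ico)

text \<open>The formula holds for the truncations of f by \<open>fourier_L1_multiplication\<close>.
  On the frequency side it passes to the limit by Cauchy-Schwarz and L2 convergence, on the time
  side by dominated convergence, because the transform of an interval indicator is again in
  L2.\<close>

lemma is_fourier_L2_imp_fourier_pair:
  assumes f: "square_integrable f" and g: "is_fourier_L2 f g"
  shows "fourier_pair f g"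
proof -
  have gs: "square_integrable g" using g by (simp add: is_fourier_L2_def)
  define fn where "fn n t = indicator {- real n..real n} t * f t" for n :: nat and t
  have fn: "square_integrable (fn n)" for n
    unfolding fn_def by (intro square_integrable_indicator_mult f) auto
  have fn0: "fn n t = 0" if "t \<notin> {- real n..real n}" for n t using that by (simp add: fn_def)
  have fn_int: "integrable lebesgue (fn n)" for n
    by (rule square_integrable_integrable[OF fn fn0])
  have Ffn: "square_integrable (fourier_L1 (fn n))" for n
    by (rule square_integrable_fourier_L1[OF fn fn0])
  have dsq: "square_integrable (\<lambda>\<xi>. fourier_L1 (fn n) \<xi> - g \<xi>)" for n
    by (intro square_integrable_diff Ffn gs)
  have "(\<lambda>n. ennreal (sqnorm (\<lambda>\<xi>. fourier_L1 (fn n) \<xi> - g \<xi>))) \<longlonglongrightarrow> ennreal 0"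
    using g unfolding is_fourier_L2_def fn_def[symmetric, abs_def] by (simp add: nn_integral_eq_sqnorm dsq)
  then have lim: "(\<lambda>n. sqnorm (\<lambda>\<xi>. fourier_L1 (fn n) \<xi> - g \<xi>)) \<longlonglongrightarrow> 0"
    by (subst (asm) tendsto_ennreal_iff) auto
  have "(LINT \<xi>|lebesgue. indicator {a..<b} \<xi> * g \<xi>) = (LINT t|lebesgue. f t * fourier_L1 (indicator {a..<b}) t)" for a b
  proof -
    let ?h = "indicator {a..<b} :: real \<Rightarrow> complex"
    have hs: "square_integrable ?h" by (rule square_integrable_indicator_Ico)
    have hi: "integrable lebesgue ?h"
      by (rule square_integrable_integrable[OF hs, of a b]) auto
    have Fh: "square_integrable (fourier_L1 ?h)" by (rule square_integrable_fourier_L1_Ico)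
    have lim_left: "(\<lambda>n. LINT \<xi>|lebesgue. ?h \<xi> * fourier_L1 (fn n) \<xi>) \<longlonglongrightarrow> (LINT \<xi>|lebesgue. ?h \<xi> * g \<xi>)"
    proof (rule LIM_zero_cancel, rule tendsto_norm_zero_cancel, rule Lim_null_comparison)
      show "(\<lambda>n. sqrt (sqnorm ?h * sqnorm (\<lambda>\<xi>. fourier_L1 (fn n) \<xi> - g \<xi>))) \<longlonglongrightarrow> 0"
        using tendsto_real_sqrt[OF tendsto_mult_right_zero[OF lim]] by simp
      show "\<forall>\<^sub>F n in sequentially. norm (norm ((LINT \<xi>|lebesgue. ?h \<xi> * fourier_L1 (fn n) \<xi>) - (LINT \<xi>|lebesgue. ?h \<xi> * g \<xi>)))
          \<le> sqrt (sqnorm ?h * sqnorm (\<lambda>\<xi>. fourier_L1 (fn n) \<xi> - g \<xi>))"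
      proof (intro always_eventually allI)
        fix n
        have "(LINT \<xi>|lebesgue. ?h \<xi> * fourier_L1 (fn n) \<xi>) - (LINT \<xi>|lebesgue. ?h \<xi> * g \<xi>)
            = (LINT \<xi>|lebesgue. ?h \<xi> * (fourier_L1 (fn n) \<xi> - g \<xi>))"
          unfolding right_diff_distrib
          by (intro Bochner_Integration.integral_diff[symmetric] square_integrable_mult_integrable hs Ffn gs)
        then show "norm (norm ((LINT \<xi>|lebesgue. ?h \<xi> * fourier_L1 (fn n) \<xi>) - (LINT \<xi>|lebesgue. ?h \<xi> * g \<xi>)))
          \<le> sqrt (sqnorm ?h * sqnorm (\<lambda>\<xi>. fourier_L1 (fn n) \<xi> - g \<xi>))"
          using square_integrable_Cauchy_Schwarz[OF hs dsq[of n]] by (auto intro: real_le_rsqrt)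
      qed
    qed
    have eq: "(LINT \<xi>|lebesgue. ?h \<xi> * fourier_L1 (fn n) \<xi>) = (LINT t|lebesgue. fn n t * fourier_L1 ?h t)" for n
      by (intro fourier_L1_multiplication fn_int hi)
    have lim_right: "(\<lambda>n. LINT t|lebesgue. fn n t * fourier_L1 ?h t) \<longlonglongrightarrow> (LINT t|lebesgue. f t * fourier_L1 ?h t)"
    proof (rule integral_dominated_convergence[where w = "\<lambda>t. norm (f t * fourier_L1 ?h t)"])
      show "integrable lebesgue (\<lambda>t. norm (f t * fourier_L1 ?h t))"
        by (intro integrable_norm square_integrable_mult_integrable f Fh)
      show "AE t in lebesgue. (\<lambda>n. fn n t * fourier_L1 ?h t) \<longlonglongrightarrow> f t * fourier_L1 ?h t"
      proof (rule AE_I2, rule tendsto_eventually)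
        fix t
        show "eventually (\<lambda>n. fn n t * fourier_L1 ?h t = f t * fourier_L1 ?h t) sequentially"
          using eventually_mem_Icc_nat[of t] by eventually_elim (simp add: fn_def)
      qed
      show "AE t in lebesgue. norm (fn n t * fourier_L1 ?h t) \<le> norm (f t * fourier_L1 ?h t)" for n
        by (auto simp: fn_def indicator_def)
    qed (use square_integrable_mult_integrable[OF f Fh] square_integrable_mult_integrable[OF fn Fh] in auto)
    show ?thesis by (rule LIMSEQ_unique[OF lim_left[unfolded eq] lim_right])
  qed
  then show ?thesis unfolding fourier_pair_def using f gs by blast
qed

text \<open>Provides a transform of the outer piece of f whose energy is controlled by that
  piece.\<close>

lemma fourier_pair_exists:
  assumes "square_integrable f"
  obtains g where "fourier_pair f g" "sqnorm g \<le> sqnorm f"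
  using fourier_L2_limit[OF assms] is_fourier_L2_imp_fourier_pair[OF assms] by metis

text \<open>Stands in for linearity of \<open>fourier_L2\<close>, whose values are arbitrary
  representatives: a combination of chosen transforms is a transform of the combination.\<close>

lemma fourier_pair_sum:
  assumes "\<And>k. k \<in> I \<Longrightarrow> fourier_pair (f k) (g k)"
  shows "fourier_pair (\<lambda>t. \<Sum>k\<in>I. c k * f k t) (\<lambda>\<xi>. \<Sum>k\<in>I. c k * g k \<xi>)"
  unfolding fourier_pair_def
proof (intro conjI allI)
  have sq: "square_integrable (f k)" "square_integrable (g k)" if "k \<in> I" for k
    using assms[OF that] by (auto simp: fourier_pair_def)
  show "square_integrable (\<lambda>t. \<Sum>k\<in>I. c k * f k t)" "square_integrable (\<lambda>t. \<Sum>k\<in>I. c k * g k t)"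
    by (intro square_integrable_sum square_integrable_cmult sq; assumption)+
  fix a b
  let ?h = "indicator {a..<b} :: real \<Rightarrow> complex"
  have "(LINT \<xi>|lebesgue. ?h \<xi> * (\<Sum>k\<in>I. c k * g k \<xi>)) = (LINT \<xi>|lebesgue. (\<Sum>k\<in>I. c k * (?h \<xi> * g k \<xi>)))"
    by (simp add: sum_distrib_left mult_ac)
  also have "\<dots> = (\<Sum>k\<in>I. c k * (LINT \<xi>|lebesgue. ?h \<xi> * g k \<xi>))"
    by (simp only: Bochner_Integration.integral_sum integrable_mult_right square_integrable_mult_integrable
        square_integrable_indicator_Ico sq integral_mult_right_zero)
  also have "\<dots> = (\<Sum>k\<in>I. c k * (LINT t|lebesgue. f k t * fourier_L1 ?h t))"
    using assms by (intro sum.cong refl) (simp add: fourier_pair_def)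
  also have "\<dots> = (LINT t|lebesgue. (\<Sum>k\<in>I. c k * (f k t * fourier_L1 ?h t)))"
    by (simp only: Bochner_Integration.integral_sum integrable_mult_right square_integrable_mult_integrable
        square_integrable_fourier_L1_Ico sq integral_mult_right_zero)
  also have "\<dots> = (LINT t|lebesgue. (\<Sum>k\<in>I. c k * f k t) * fourier_L1 ?h t)"
    by (simp only: sum_distrib_right mult.assoc)
  finally show "(LINT \<xi>|lebesgue. ?h \<xi> * (\<Sum>k\<in>I. c k * g k \<xi>)) = \<dots>" .
qed

section \<open>Completeness of the trigonometric system\<close>

text \<open>The existential hides index set and coefficients, so that closure under sums and
  products can be stated, as Stone-Weierstrass requires.\<close>

definition trig_poly :: "real \<Rightarrow> (real \<Rightarrow> complex) \<Rightarrow> bool" where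
  "trig_poly T \<tau> \<longleftrightarrow> (\<exists>J c. finite J \<and> \<tau> = trig T J c)"

lemma trig_poly_monomial: "trig_poly T (\<lambda>t. c * cis (pi * of_int j * t / T))"
  unfolding trig_poly_def
  by (intro exI[of _ "{j}"] exI[of _ "\<lambda>_. c"]) (simp add: trig_def fun_eq_iff)

lemma trig_poly_const: "trig_poly T (\<lambda>t. c)"
  using trig_poly_monomial[of T c 0] by simp

lemma trig_poly_add:
  assumes "trig_poly T f" "trig_poly T g"
  shows "trig_poly T (\<lambda>t. f t + g t)"
proof -
  obtain J c K d where JK: "finite J" "f = trig T J c" "finite K" "g = trig T K d"
    using assms unfolding trig_poly_def by blast
  \<comment> \<open>Coefficients are extended by 0 to the common index set.\<close>
  have *: "trig T L e t = (\<Sum>j\<in>J \<union> K. (if j \<in> L then e j else 0) * cis (pi * j * t / T))"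
    if "L \<subseteq> J \<union> K" for L e t
    unfolding trig_def using JK that by (intro sum.mono_neutral_cong_left) auto
  have "(\<lambda>t. f t + g t) = trig T (J \<union> K) (\<lambda>j. (if j \<in> J then c j else 0) + (if j \<in> K then d j else 0))"
  proof (rule ext)
    fix t
    show "f t + g t = trig T (J \<union> K) (\<lambda>j. (if j \<in> J then c j else 0) + (if j \<in> K then d j else 0)) t"
      using *[of J c t] *[of K d t] by (simp add: JK(2,4) trig_def[of T "J \<union> K"] distrib_right sum.distrib)
  qed
  then show ?thesis unfolding trig_poly_def using JK by blast
qed

lemma trig_poly_sum:
  "(\<And>k. k \<in> I \<Longrightarrow> trig_poly T (f k)) \<Longrightarrow> trig_poly T (\<lambda>t. \<Sum>k\<in>I. f k t)"
  by (induction I rule: infinite_finite_induct) (auto intro: trig_poly_const trig_poly_add)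

lemma trig_poly_mult:
  assumes "trig_poly T f" "trig_poly T g"
  shows "trig_poly T (\<lambda>t. f t * g t)"
proof -
  obtain J c K d where JK: "f = trig T J c" "g = trig T K d"
    using assms unfolding trig_poly_def by blast
  have "cis (pi * of_int (j + k) * t / T) = cis (pi * of_int j * t / T) * cis (pi * of_int k * t / T)" for j k t
    by (simp add: cis_mult distrib_left distrib_right add_divide_distrib)
  then have "(\<lambda>t. f t * g t) = (\<lambda>t. \<Sum>j\<in>J. \<Sum>k\<in>K. (c j * d k) * cis (pi * of_int (j + k) * t / T))"
    unfolding JK trig_def sum_product by (simp only: mult_ac)
  then show ?thesis by (simp only: trig_poly_sum trig_poly_monomial)
qed

text \<open>Induction over polynomial functions. A real-linear function is determined by its values
  at 1 and \<i>, and Euler's formulas turn cosine and sine into the frequencies 1 and -1.\<close>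

lemma trig_poly_real_polynomial:
  fixes p :: "complex \<Rightarrow> real"
  assumes "real_polynomial_function p"
  shows "trig_poly T (\<lambda>t. of_real (p (cis (pi * t / T))))"
  using assms
proof induction
  case (linear f)
  interpret bounded_linear f by fact
  have f: "f z = Re z * f 1 + Im z * f \<i>" for z
  proof -
    have "f z = f (Re z *\<^sub>R 1 + Im z *\<^sub>R \<i>)" by (intro arg_cong[of _ _ f]) (simp add: complex_eq_iff)
    then show ?thesis by (simp only: add scaleR real_scaleR_def)
  qed
  have "(\<lambda>t. complex_of_real (f (cis (pi * t / T)))) =
    (\<lambda>t. ((f 1 - \<i> * f \<i>) / 2) * cis (pi * of_int 1 * t / T) + ((f 1 + \<i> * f \<i>) / 2) * cis (pi * of_int (-1) * t / T))"
    by (rule ext, subst f) (simp add: complex_eq_iff field_simps)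
  then show ?case by (simp only: trig_poly_add trig_poly_monomial)
qed (auto intro: trig_poly_const trig_poly_add trig_poly_mult)

lemma trig_poly_polynomial:
  fixes p :: "complex \<Rightarrow> complex"
  assumes "polynomial_function p"
  shows "trig_poly T (\<lambda>t. p (cis (pi * t / T)))"
proof -
  have "real_polynomial_function (\<lambda>z. Re (p z))" "real_polynomial_function (\<lambda>z. Im (p z))"
    using assms bounded_linear_Re bounded_linear_Im unfolding polynomial_function_def comp_def by blast+
  then have "trig_poly T (\<lambda>t. of_real (Re (p (cis (pi * t / T)))) + \<i> * of_real (Im (p (cis (pi * t / T)))))"
    by (intro trig_poly_add trig_poly_mult trig_poly_const trig_poly_real_polynomial)
  then show ?thesis by (simp flip: complex_eq)
qed

text \<open>\<open>Arg\<close> jumps at -1, but on the unit circle its absolute value is continuous;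
  this formula shows it.\<close>

lemma abs_Arg_eq_arccos:
  assumes "norm z = 1"
  shows "\<bar>Arg z\<bar> = arccos (Re z)"
proof -
  have "z \<noteq> 0" using assms by auto
  then have "cis (Arg z) = z" using assms by (simp add: cis_Arg sgn_div_norm)
  then have "Re z = cos (Arg z)" by (metis cis.sel(1))
  then show ?thesis using Arg_bounded[of z] by (auto intro!: arccos_cos_eq_abs[symmetric])
qed

lemma Arg_minus_one: "Arg (-1) = pi"
  using Arg_cis[of pi] by simp

text \<open>Wrap [-T,T] around the unit circle. As h vanishes at both ends, the wrapped function H
  stays continuous across the branch cut, and Stone-Weierstrass approximates it by polynomials in
  the circle variable, which unwrap to trigonometric polynomials.\<close>

lemma trig_approx:
  fixes h :: "real \<Rightarrow> complex"
  assumes T: "T > 0" and h: "continuous_on UNIV h" "h T = 0" "h (-T) = 0" and e: "e > 0"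
  obtains J c where "finite J" "\<And>t. t \<in> {-T..T} \<Longrightarrow> norm (h t - trig T J c t) < e"
proof -
  define H where "H z = h (T / pi * Arg z)" for z :: complex
  have "continuous_on (sphere 0 1) H"
  proof (rule continuous_on_eq_continuous_within[THEN iffD2], rule ballI)
    fix z :: complex assume z: "z \<in> sphere 0 1"
    show "continuous (at z within sphere 0 1) H"
    proof (cases "z \<in> \<real>\<^sub>\<le>\<^sub>0")
      case False
      have "isCont (\<lambda>z. h (T / pi * Arg z)) z"
        by (rule isCont_o2[where g = h])
          (use continuous_at_Arg[OF False] h(1) in \<open>auto intro!: continuous_intros simp: continuous_on_eq_continuous_at\<close>)
      then show ?thesis unfolding H_def by (rule continuous_at_imp_continuous_at_within)
    next
      case True
      with z have z1: "z = -1"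
        by (auto simp: complex_nonpos_Reals_iff complex_eq_iff cmod_def power2_eq_1_iff)
      \<comment> \<open>Near -1 the sign of \<open>Arg w\<close> is unknown, so both candidates are
        added. This majorant is continuous on the circle and vanishes at -1.\<close>
      let ?k = "\<lambda>w. norm (h (T / pi * arccos (Re w))) + norm (h (- (T / pi * arccos (Re w))))"
      have "continuous_on (sphere 0 1) ?k"
      proof -
        have "-1 \<le> Re w \<and> Re w \<le> 1" if "w \<in> sphere 0 1" for w
          using that abs_Re_le_cmod[of w] by auto
        then have "continuous_on (sphere 0 1) (\<lambda>w. arccos (Re w))" by (intro continuous_intros) auto
        then show ?thesis
          by (intro continuous_on_add continuous_on_norm continuous_on_minus continuous_on_mult
              continuous_on_const continuous_on_compose2[OF h(1)] subset_UNIV)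
      qed
      then have "(?k \<longlongrightarrow> ?k z) (at z within sphere 0 1)"
        using z by (simp add: continuous_on_def)
      then have k: "(?k \<longlongrightarrow> 0) (at z within sphere 0 1)" using h z1 by simp
      have "(H \<longlongrightarrow> 0) (at z within sphere 0 1)"
      proof (rule Lim_null_comparison[OF _ k])
        have "norm (H w) \<le> ?k w" if "w \<in> sphere 0 1" for w
        proof -
          have "Arg w = arccos (Re w) \<or> Arg w = - arccos (Re w)"
            using abs_Arg_eq_arccos[of w] that by auto
          then show ?thesis unfolding H_def by auto
        qed
        then show "\<forall>\<^sub>F w in at z within sphere 0 1. norm (H w) \<le> ?k w"
          by (auto simp: eventually_at_filter)
      qed
      moreover have "H z = 0" using h T z1 by (simp add: H_def Arg_minus_one)
      ultimately show ?thesis by (simp add: continuous_within)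
    qed
  qed
  from Stone_Weierstrass_polynomial_function[OF compact_sphere this e]
  obtain p where p: "polynomial_function p" "\<And>z. z \<in> sphere 0 1 \<Longrightarrow> norm (H z - p z) < e" by blast
  obtain J c where Jc: "finite J" "(\<lambda>t. p (cis (pi * t / T))) = trig T J c"
    using trig_poly_polynomial[OF p(1)] unfolding trig_poly_def by blast
  show ?thesis
  proof (rule that[OF Jc(1)])
    fix t assume t: "t \<in> {-T..T}"
    have "H (cis (pi * t / T)) = h t"
    \<comment> \<open>At t = -T the argument comes back as pi, so H returns h T; the two end values
      agree because both are 0.\<close>
    proof (cases "t = -T")
      case True
      have "cis (- pi) = -1" by (simp add: complex_eq_iff)
      with True T h show ?thesis by (simp add: H_def Arg_minus_one)
    next
      case False
      with t T have "-1 < t / T" "t / T \<le> 1" by (auto simp: field_simps)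
      then have "pi * (-1) < pi * (t / T)" "pi * (t / T) \<le> pi * 1"
        by (intro mult_strict_left_mono mult_left_mono; simp)+
      then have "pi * t / T \<in> {-pi<..pi}" by simp
      from Arg_cis[OF this] T show ?thesis by (simp add: H_def)
    qed
    then show "norm (h t - trig T J c t) < e"
      unfolding Jc(2)[symmetric] using p(2)[of "cis (pi * t / T)"] by simp
  qed
qed

text \<open>The estimate \<open>P h\<close> holds for trigonometric polynomials by Cauchy--Schwarz on the coefficients, it
  survives dominated limits, and for \<open>h = G\<close> it is the claim.\<close>

lemma fourier_L1_completeness:
  assumes T: "T > 0" and G: "square_integrable G" "\<And>t. t \<notin> {-T..T} \<Longrightarrow> G t = 0"
    and bound: "\<And>J. finite J \<Longrightarrow> (\<Sum>j\<in>J. (norm (fourier_L1 G (of_int j / (2 * T))))\<^sup>2) \<le> M"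
  shows "2 * T * sqnorm G \<le> M"
proof -
  define I where "I = {-T..T}"
  define P where "P h \<longleftrightarrow> (norm (LINT t|lebesgue. G t * cnj (indicator I t * h t)))\<^sup>2
      \<le> M / (2 * T) * sqnorm (\<lambda>t. indicator I t * h t)" for h
  have [measurable]: "G \<in> borel_measurable lebesgue" using G(1) by (rule square_integrable_measurable)
  have [measurable]: "I \<in> sets lebesgue" by (simp add: I_def)
  \<comment> \<open>Both sides of \<open>P\<close> converge under domination on I by a single L2
    function; the steps below climb from trigonometric polynomials to G through this
    closure.\<close>
  have closed: "P H"
    if P: "\<And>n. P (h n)" and [measurable]: "\<And>n. h n \<in> borel_measurable lebesgue" "H \<in> borel_measurable lebesgue"
      and lim: "AE t in lebesgue. t \<in> I \<longrightarrow> (\<lambda>n. h n t) \<longlonglongrightarrow> H t"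
      and w: "square_integrable w" and le: "\<And>n t. t \<in> I \<Longrightarrow> norm (h n t) \<le> norm (w t)"
    for h :: "nat \<Rightarrow> real \<Rightarrow> complex" and H w
  proof -
    have lim': "AE t in lebesgue. (\<lambda>n. indicator I t * h n t) \<longlonglongrightarrow> indicator I t * H t"
      using lim by eventually_elim (auto simp: indicator_def intro: tendsto_intros)
    have le': "norm (indicator I t * h n t) \<le> norm (w t)" for n t
      using le[of t n] by (auto simp: indicator_def)
    have "(\<lambda>n. sqnorm (\<lambda>t. indicator I t * h n t)) \<longlonglongrightarrow> sqnorm (\<lambda>t. indicator I t * H t)"
      by (rule sqnorm_dominated_tendsto[OF _ _ w lim']) (use le' in auto)
    moreover have "(\<lambda>n. LINT t|lebesgue. G t * cnj (indicator I t * h n t)) \<longlonglongrightarrow> (LINT t|lebesgue. G t * cnj (indicator I t * H t))"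
    proof (rule integral_dominated_convergence[where w = "\<lambda>t. norm (G t * w t)"])
      show "AE t in lebesgue. (\<lambda>n. G t * cnj (indicator I t * h n t)) \<longlonglongrightarrow> G t * cnj (indicator I t * H t)"
        using lim' by eventually_elim (rule tendsto_mult[OF tendsto_const tendsto_cnj])
      show "integrable lebesgue (\<lambda>t. norm (G t * w t))"
        by (intro integrable_norm square_integrable_mult_integrable G(1) w)
      show "AE t in lebesgue. norm (G t * cnj (indicator I t * h n t)) \<le> norm (G t * w t)" for n
        using le'[of _ n] by (intro AE_I2) (simp add: norm_mult mult_left_mono del: complex_cnj_mult)
    qed measurable
    ultimately show ?thesis
      unfolding P_def using P[unfolded P_def]
      by (intro LIMSEQ_le[where X = "\<lambda>n. (norm (LINT t|lebesgue. G t * cnj (indicator I t * h n t)))\<^sup>2"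
            and Y = "\<lambda>n. M / (2 * T) * sqnorm (\<lambda>t. indicator I t * h n t)"] tendsto_intros) auto
  qed
  have trig: "P (trig T J c)" if "finite J" for J c
  proof -
    let ?a = "\<lambda>j. fourier_L1 G (of_int j / (2 * T))"
    have "norm (\<Sum>j\<in>J. cnj (c j) * ?a j) \<le> (\<Sum>j\<in>J. norm (c j) * norm (?a j))"
      by (rule order_trans[OF norm_sum]) (simp add: norm_mult)
    then have "(norm (\<Sum>j\<in>J. cnj (c j) * ?a j))\<^sup>2 \<le> (\<Sum>j\<in>J. norm (c j) * norm (?a j))\<^sup>2"
      by (intro power_mono) auto
    also have "\<dots> \<le> (\<Sum>j\<in>J. (norm (c j))\<^sup>2) * (\<Sum>j\<in>J. (norm (?a j))\<^sup>2)"
      by (rule Cauchy_Schwarz_ineq_sum)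
    also have "\<dots> \<le> (\<Sum>j\<in>J. (norm (c j))\<^sup>2) * M"
      by (intro mult_left_mono bound that sum_nonneg) auto
    also have "\<dots> = M / (2 * T) * (2 * T * (\<Sum>j\<in>J. (norm (c j))\<^sup>2))"
      using T by simp
    also have "(\<Sum>j\<in>J. cnj (c j) * ?a j) = (LINT t|lebesgue. G t * cnj (indicator {-T..T} t * trig T J c t))"
      by (rule integral_mult_trig[OF G, symmetric])
    finally show ?thesis
      unfolding P_def I_def sqnorm_trig[OF T that] .
  qed
  have cont0: "P h" if h: "continuous_on UNIV h" "h T = 0" "h (-T) = 0" for h
  proof -
    have "\<exists>J c. finite J \<and> (\<forall>t\<in>I. norm (h t - trig T J c t) < inverse (real (Suc n)))" for n
      using trig_approx[OF T h, of "inverse (real (Suc n))"] unfolding I_def by (metis inverse_Suc)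
    then obtain J c where Jc: "\<And>n. finite (J n)" "\<And>n t. t \<in> I \<Longrightarrow> norm (h t - trig T (J n) (c n) t) < inverse (real (Suc n))"
      by metis
    show ?thesis
    proof (rule closed[where h = "\<lambda>n. trig T (J n) (c n)"])
      show "P (trig T (J n) (c n))" for n by (rule trig[OF Jc(1)])
      show "trig T (J n) (c n) \<in> borel_measurable lebesgue" for n
        by (intro measurable_completion) (auto intro!: borel_measurable_continuous_onI continuous_intros)
      show "h \<in> borel_measurable lebesgue"
        by (intro measurable_completion) (auto intro!: borel_measurable_continuous_onI h)
      show "AE t in lebesgue. t \<in> I \<longrightarrow> (\<lambda>n. trig T (J n) (c n) t) \<longlonglongrightarrow> h t"
      proof (intro AE_I2 impI)
        fix t assume t: "t \<in> I"
        have "(\<lambda>n. norm (h t - trig T (J n) (c n) t)) \<longlonglongrightarrow> 0"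
          by (rule tendsto_sandwich[OF _ _ tendsto_const LIMSEQ_inverse_real_of_nat])
            (intro always_eventually allI less_imp_le[OF Jc(2)[OF t]] norm_ge_zero)+
        from tendsto_diff[OF tendsto_const[of "h t"] tendsto_norm_zero_cancel[OF this]]
        show "(\<lambda>n. trig T (J n) (c n) t) \<longlonglongrightarrow> h t" by simp
      qed
      \<comment> \<open>The approximation error is at most 1 for every n, so |h| + 1 dominates all
        approximants.\<close>
      show "square_integrable (\<lambda>t. indicator {-T..T} t * (of_real (norm (h t) + 1)))"
        by (intro square_integrable_continuous_Icc continuous_intros h)
      show "norm (trig T (J n) (c n) t) \<le> norm (indicator {-T..T} t * complex_of_real (norm (h t) + 1))" if t: "t \<in> I" for n t
      proof -
        have "norm (trig T (J n) (c n) t) \<le> norm (h t) + norm (h t - trig T (J n) (c n) t)"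
          by (metis norm_minus_commute norm_triangle_sub)
        also have "\<dots> \<le> norm (h t) + 1"
          using Jc(2)[OF t, of n] inverse_le_1_iff[of "real (Suc n)"] by linarith
        also have "\<dots> = norm (indicator {-T..T} t * complex_of_real (norm (h t) + 1))"
          using t by (simp add: I_def norm_mult del: of_real_add)
        finally show ?thesis .
      qed
    qed
  qed
  have w: "square_integrable (\<lambda>t. indicator {-T..T} t * of_real m)" for m
    by (intro square_integrable_continuous_Icc continuous_intros)
  have cont: "P h" if h: "continuous_on UNIV h" "\<And>t. norm (h t) \<le> m" for h m
  proof -
    \<comment> \<open>A continuous trapezoid that is 0 at the end points and equals 1 eventually at
      each interior point; the two end points form a null set.\<close>
    define cut where "cut n t = min 1 (real n * max 0 (T - \<bar>t\<bar>))" for n :: nat and t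
    have cut_cont: "continuous_on UNIV (cut n)" for n
      unfolding cut_def by (intro continuous_intros)
    have ch: "continuous_on UNIV (\<lambda>t. of_real (cut n t) * h t)" for n
      by (intro continuous_intros cut_cont h)
    show ?thesis
    proof (rule closed[OF _ _ _ _ w[of m]])
      show "P (\<lambda>t. of_real (cut n t) * h t)" for n
        by (rule cont0[OF ch]) (use T in \<open>auto simp: cut_def\<close>)
      show "(\<lambda>t. of_real (cut n t) * h t) \<in> borel_measurable lebesgue" for n
        by (intro measurable_completion) (auto intro!: borel_measurable_continuous_onI ch)
      show "h \<in> borel_measurable lebesgue"
        by (intro measurable_completion) (auto intro!: borel_measurable_continuous_onI h)
      have "AE t in lebesgue. t \<noteq> T \<and> t \<noteq> -T"
        using AE_not_in[of "{-T, T}" lebesgue] negligible_finite[of "{-T, T}"]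
        by (simp add: negligible_iff_null_sets conj_commute)
      then show "AE t in lebesgue. t \<in> I \<longrightarrow> (\<lambda>n. of_real (cut n t) * h t) \<longlonglongrightarrow> h t"
      proof eventually_elim
        case (elim t)
        show ?case
        proof (rule impI, rule tendsto_eventually)
          assume "t \<in> I"
          with elim have t: "0 < T - \<bar>t\<bar>" by (auto simp: I_def)
          obtain N :: nat where N: "1 / (T - \<bar>t\<bar>) \<le> real N" using real_arch_simple by blast
          have "cut n t = 1" if "N \<le> n" for n
          proof -
            have "1 / (T - \<bar>t\<bar>) \<le> real n" using N that by (meson of_nat_mono order_trans)
            then show ?thesis using t by (simp add: cut_def field_simps)
          qed
          then show "eventually (\<lambda>n. of_real (cut n t) * h t = h t) sequentially"
            unfolding eventually_sequentially by (intro exI[of _ N]) auto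
        qed
      qed
      show "norm (of_real (cut n t) * h t) \<le> norm (indicator {-T..T} t * complex_of_real m)" if "t \<in> I" for n t
      proof -
        have "\<bar>cut n t\<bar> \<le> 1" by (auto simp: cut_def)
        then have "\<bar>cut n t\<bar> * norm (h t) \<le> 1 * norm (h t)" by (intro mult_right_mono) auto
        also have "\<dots> \<le> \<bar>m\<bar>" using h(2)[of t] by linarith
        finally show ?thesis using that by (simp add: norm_mult I_def)
      qed
    qed
  qed
  have bdd: "P H" if H: "H \<in> borel_measurable lebesgue" "\<And>t. norm (H t) \<le> m" for H m
  proof -
    have m: "0 \<le> m" using H(2) norm_ge_zero order_trans by blast
    obtain N g where N: "negligible N" and g: "\<And>n. continuous_on UNIV (g n)"
      and glim: "\<And>x. x \<notin> N \<Longrightarrow> (\<lambda>n. g n x) \<longlonglongrightarrow> H x"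
      using lebesgue_measurable_imp_measurable_on[OF H(1), of UNIV] unfolding measurable_on_def by auto
    \<comment> \<open>The continuous functions approximating H need not respect its bound.
      Projecting onto the disc of radius m keeps them continuous, bounds them by m, and fixes the
      values of H.\<close>
    define q where "q = closest_point (cball (0 :: complex) m)"
    have q_cont: "continuous_on UNIV q"
      unfolding q_def using m by (intro continuous_on_closest_point) auto
    have q_le: "norm (q z) \<le> m" for z
      using closest_point_in_set[of "cball 0 m" z] m by (auto simp: q_def)
    have q_id: "q z = z" if "norm z \<le> m" for z
      unfolding q_def using that by (intro closest_point_self) auto
    have qg: "continuous_on UNIV (\<lambda>t. q (g n t))" for n
      by (rule continuous_on_compose2[OF q_cont g]) auto
    show ?thesis
    proof (rule closed[OF _ _ H(1) _ w[of m]])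
      show "P (\<lambda>t. q (g n t))" for n by (rule cont[OF qg q_le])
      show "(\<lambda>t. q (g n t)) \<in> borel_measurable lebesgue" for n
        by (intro measurable_completion) (auto intro!: borel_measurable_continuous_onI qg)
      have "AE t in lebesgue. t \<notin> N"
        using N by (auto simp: negligible_iff_null_sets intro: AE_not_in)
      then show "AE t in lebesgue. t \<in> I \<longrightarrow> (\<lambda>n. q (g n t)) \<longlonglongrightarrow> H t"
      proof eventually_elim
        case (elim t)
        have "(\<lambda>n. q (g n t)) \<longlonglongrightarrow> q (H t)"
          using q_cont by (intro isCont_tendsto_compose[OF _ glim[OF elim]]) (simp add: continuous_on_eq_continuous_at)
        then show ?case using q_id[OF H(2)] by simp
      qed
      show "norm (q (g n t)) \<le> norm (indicator {-T..T} t * complex_of_real m)" if "t \<in> I" for n t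
        using q_le[of "g n t"] that m by (simp add: norm_mult I_def)
    qed
  qed
  \<comment> \<open>Cutting off large values reduces G to the bounded case, with G itself as the
    dominating function.\<close>
  define Gn where "Gn n t = (if norm (G t) \<le> real n then G t else 0)" for n :: nat and t
  have [measurable]: "Gn n \<in> borel_measurable lebesgue" for n unfolding Gn_def by measurable
  have "P G"
  proof (rule closed[OF _ _ _ _ G(1)])
    show "P (Gn n)" for n by (rule bdd[where m = "real n"]) (auto simp: Gn_def)
    show "AE t in lebesgue. t \<in> I \<longrightarrow> (\<lambda>n. Gn n t) \<longlonglongrightarrow> G t"
    proof (intro AE_I2 impI tendsto_eventually)
      fix t
      obtain N :: nat where "norm (G t) \<le> real N" using real_arch_simple by blast
      then show "eventually (\<lambda>n. Gn n t = G t) sequentially"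
        unfolding eventually_sequentially Gn_def by (intro exI[of _ N]) force
    qed
    show "norm (Gn n t) \<le> norm (G t)" for n t by (simp add: Gn_def)
  qed measurable
  moreover have IG: "indicator I t * G t = G t" for t
    using G(2)[of t] by (cases "t \<in> I") (auto simp: I_def)
  moreover have "(LINT t|lebesgue. G t * cnj (G t)) = of_real (sqnorm G)"
    by (simp add: sqnorm_def complex_norm_square flip: integral_complex_of_real del: of_real_power)
  ultimately have "sqnorm G * sqnorm G \<le> M / (2 * T) * sqnorm G"
    unfolding P_def by (simp add: power2_eq_square)
  \<comment> \<open>The empty set of frequencies already forces M to be nonnegative, which settles
    the case that G has norm 0.\<close>
  moreover have "0 \<le> M" using bound[of "{}"] by simp
  ultimately have "sqnorm G \<le> M / (2 * T)"
    using T sqnorm_nonneg[of G] by (cases "sqnorm G = 0") (auto simp del: times_divide_eq_left)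
  then show ?thesis using T by (simp add: field_simps)
qed

section \<open>Phase-space concentration\<close>

text \<open>Cauchy-Schwarz on each cell costs its length l, and the cells are disjoint, so the local
  energies add up to at most the energy on S.\<close>

lemma sum_cell_integrals_le:
  fixes J :: "int set" and a l :: real
  assumes g: "square_integrable g" and l: "l > 0" and J: "finite J" and S: "S \<in> sets lebesgue"
    and sub: "\<And>j. j \<in> J \<Longrightarrow> {a + of_int j * l..<a + (of_int j + 1) * l} \<subseteq> S"
  shows "(\<Sum>j\<in>J. (norm (LINT \<xi>|lebesgue. indicator {a + of_int j * l..<a + (of_int j + 1) * l} \<xi> * g \<xi>))\<^sup>2)
    \<le> l * sqnorm (\<lambda>\<xi>. indicator S \<xi> * g \<xi>)"
proof -
  define C where "C j = {a + real_of_int j * l..<a + (real_of_int j + 1) * l}" for j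
  have C_sets: "C j \<in> sets lebesgue" for j by (simp add: C_def)
  have Cg: "square_integrable (\<lambda>\<xi>. indicator (C j) \<xi> * g \<xi>)" for j
    by (intro square_integrable_indicator_mult g C_sets)
  have C_norm: "sqnorm (indicator (C j)) = l" for j
  proof -
    have "sqnorm (indicator (C j)) = (LINT t|lebesgue. indicator (C j) t)"
      unfolding sqnorm_def by (intro Bochner_Integration.integral_cong refl) (simp add: indicator_def)
    also have "\<dots> = l" using l by (simp add: C_def algebra_simps)
    finally show ?thesis .
  qed
  have mem: "\<xi> \<in> C j \<longleftrightarrow> \<lfloor>(\<xi> - a) / l\<rfloor> = j" for \<xi> j
    unfolding C_def floor_eq_iff using l by (auto simp: field_simps)
  have pt: "(\<Sum>j\<in>J. (norm (indicator (C j) \<xi> * g \<xi>))\<^sup>2) \<le> (norm (indicator S \<xi> * g \<xi>))\<^sup>2" for \<xi>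
  proof -
    have "(\<Sum>j\<in>J. (norm (indicator (C j) \<xi> * g \<xi>))\<^sup>2) = (\<Sum>j\<in>J. if j = \<lfloor>(\<xi> - a) / l\<rfloor> then (norm (g \<xi>))\<^sup>2 else 0)"
      by (intro sum.cong refl) (auto simp: indicator_def mem)
    also have "\<dots> \<le> (norm (indicator S \<xi> * g \<xi>))\<^sup>2"
    proof (cases "\<lfloor>(\<xi> - a) / l\<rfloor> \<in> J")
      case True
      have "\<xi> \<in> C \<lfloor>(\<xi> - a) / l\<rfloor>" by (simp add: mem)
      then have "\<xi> \<in> S" using sub[OF True] by (auto simp: C_def)
      then show ?thesis using J by simp
    qed (use J in simp)
    finally show ?thesis .
  qed
  have "(norm (LINT \<xi>|lebesgue. indicator (C j) \<xi> * g \<xi>))\<^sup>2 \<le> l * sqnorm (\<lambda>\<xi>. indicator (C j) \<xi> * g \<xi>)" for j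
  proof -
    \<comment> \<open>Repeating the indicator localises g before Cauchy-Schwarz, so that only its
      energy on this cell appears.\<close>
    have eq: "(LINT \<xi>|lebesgue. indicator (C j) \<xi> * g \<xi>) = (LINT \<xi>|lebesgue. indicator (C j) \<xi> * (indicator (C j) \<xi> * g \<xi>))"
      by (intro Bochner_Integration.integral_cong refl) (simp add: indicator_def)
    have "square_integrable (indicator (C j))" unfolding C_def by (rule square_integrable_indicator_Ico)
    from square_integrable_Cauchy_Schwarz[OF this Cg[of j]]
    show ?thesis unfolding eq C_norm .
  qed
  then have "(\<Sum>j\<in>J. (norm (LINT \<xi>|lebesgue. indicator (C j) \<xi> * g \<xi>))\<^sup>2) \<le> (\<Sum>j\<in>J. l * sqnorm (\<lambda>\<xi>. indicator (C j) \<xi> * g \<xi>))"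
    by (intro sum_mono)
  also have "\<dots> = l * (LINT \<xi>|lebesgue. (\<Sum>j\<in>J. (norm (indicator (C j) \<xi> * g \<xi>))\<^sup>2))"
    using Cg by (subst Bochner_Integration.integral_sum) (auto simp: sqnorm_def square_integrable_def sum_distrib_left)
  also have "\<dots> \<le> l * sqnorm (\<lambda>\<xi>. indicator S \<xi> * g \<xi>)"
    unfolding sqnorm_def
    using Cg square_integrable_indicator_mult[OF g S] l
    by (intro mult_left_mono integral_mono pt Bochner_Integration.integrable_sum) (auto simp: square_integrable_def)
  finally show ?thesis by (simp add: C_def)
qed

section \<open>The Fourier transform of a single cell\<close>

lemma integral_lebesgue_shift:
  fixes h :: "real \<Rightarrow> complex"
  assumes [measurable]: "h \<in> borel_measurable borel"
  shows "(LINT t|lebesgue. h t) = (LINT t|lebesgue. h (s + t))"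
proof -
  have "(LINT t|lborel. h t) = (LINT t|lborel. h (s + t))"
    using lborel_integral_real_affine[of 1 h s] by simp
  then show ?thesis by (simp add: integral_completion)
qed

lemma borel_measurable_indicator_cis:
  "(\<lambda>t. indicator {a..<b} t * cis (- 2 * pi * t * x)) \<in> borel_measurable borel"
proof -
  have "(\<lambda>t. cis (- 2 * pi * t * x)) \<in> borel_measurable borel"
    by (intro borel_measurable_continuous_onI continuous_intros)
  then show ?thesis by simp
qed

text \<open>All cells are translates of one, so their transforms differ only by modulations; these
  modulations become the Fourier exponentials.\<close>

lemma fourier_L1_indicator_shift:
  "fourier_L1 (indicator {a + s..<b + s}) x = cis (- 2 * pi * s * x) * fourier_L1 (indicator {a..<b}) x"
proof -
  have "fourier_L1 (indicator {a + s..<b + s}) x =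
      (LINT t|lebesgue. indicator {a + s..<b + s} (s + t) * cis (- 2 * pi * (s + t) * x))"
    unfolding fourier_L1_cis by (rule integral_lebesgue_shift[OF borel_measurable_indicator_cis])
  also have "\<dots> = (LINT t|lebesgue. cis (- 2 * pi * s * x) * (indicator {a..<b} t * cis (- 2 * pi * t * x)))"
  proof (intro Bochner_Integration.integral_cong refl)
    fix t
    have "indicator {a + s..<b + s} (s + t) = (indicator {a..<b} t :: complex)" by (auto simp: indicator_def)
    moreover have "cis (- 2 * pi * (s + t) * x) = cis (- 2 * pi * s * x) * cis (- 2 * pi * t * x)"
      by (simp add: cis_mult algebra_simps)
    ultimately show "indicator {a + s..<b + s} (s + t) * cis (- 2 * pi * (s + t) * x) =
        cis (- 2 * pi * s * x) * (indicator {a..<b} t * cis (- 2 * pi * t * x))"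
      by (simp only: mult_ac)
  qed
  finally show ?thesis by (simp add: fourier_L1_cis)
qed

lemma norm_fourier_L1_indicator_le:
  assumes "a \<le> b"
  shows "norm (fourier_L1 (indicator {a..<b}) x) \<le> b - a"
proof -
  have "norm (fourier_L1 (indicator {a..<b}) x) \<le> (LINT t|lebesgue. norm (indicator {a..<b} t * cis (- 2 * pi * t * x)))"
    unfolding fourier_L1_cis by (rule integral_norm_bound)
  also have "\<dots> = (LINT t|lebesgue. indicator {a..<b} t)"
    by (intro Bochner_Integration.integral_cong refl) (simp add: norm_mult indicator_def)
  also have "\<dots> = b - a" using assms by simp
  finally show ?thesis .
qed

text \<open>For x at most 2 the Maclaurin error x^3 / 6 is at most 2x/3. The range reaches 2 so that
  the crude bound pi < 4 covers arguments up to pi/2.\<close>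

lemma sin_ge_third:
  fixes x :: real
  assumes "0 \<le> x" "x \<le> 2"
  shows "x / 3 \<le> sin x"
proof -
  have "\<bar>sin x - (\<Sum>m<3. sin_coeff m * x ^ m)\<bar> \<le> inverse (fact 3) * \<bar>x\<bar> ^ 3"
    by (rule Maclaurin_sin_bound)
  moreover have "(\<Sum>m<3. sin_coeff m * x ^ m) = x"
    by (simp add: eval_nat_numeral sin_coeff_def)
  moreover have "x ^ 3 \<le> 4 * x"
    using mult_left_mono[OF mult_mono[OF assms(2,2)] assms(1)] assms by (simp add: power3_eq_cube mult_ac)
  ultimately have "\<bar>sin x - x\<bar> * 6 \<le> 4 * x" using assms by (simp add: fact_numeral)
  then have "\<bar>sin x - x\<bar> \<le> 2 / 3 * x" by simp
  from abs_le_D2[OF this] show ?thesis by simp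
qed

text \<open>Centring the interval changes only the phase and leaves sin(pi x l) / (pi x), whose sine
  has argument at most pi/2 in modulus; \<open>sin_ge_third\<close> then gives l/3.\<close>

lemma norm_fourier_L1_indicator_ge:
  assumes l: "l > 0" and x: "\<bar>x\<bar> * l \<le> 1 / 2"
  shows "l / 3 \<le> norm (fourier_L1 (indicator {a..<a + l}) x)"
proof -
  let ?m = "a + l / 2"
  have "fourier_L1 (indicator {- (l / 2) + ?m..<l / 2 + ?m}) x = cis (- 2 * pi * ?m * x) * fourier_L1 (indicator {- (l / 2)..<l / 2}) x"
    by (rule fourier_L1_indicator_shift)
  moreover have "{- (l / 2) + ?m..<l / 2 + ?m} = {a..<a + l}" by (simp add: add.commute)
  ultimately have eq: "norm (fourier_L1 (indicator {a..<a + l}) x) = norm (fourier_L1 (indicator {- (l / 2)..<l / 2}) x)"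
    by (simp add: norm_mult)
  have "fourier_L1 (indicator {- (l / 2)..<l / 2}) x = (LINT t|lebesgue. indicator {- (l / 2)..l / 2} t * cis (- 2 * pi * x * t))"
    unfolding fourier_L1_cis
  proof (rule Bochner_Integration.integral_cong_AE)
    have "AE t in lebesgue. t \<noteq> l / 2" by (rule AE_I[where N = "{l / 2}"]) auto
    then show "AE t in lebesgue. indicator {- (l / 2)..<l / 2} t * cis (- 2 * pi * t * x) = indicator {- (l / 2)..l / 2} t * cis (- 2 * pi * x * t)"
      by eventually_elim (auto simp: indicator_def mult_ac)
    show "(\<lambda>t. indicator {- (l / 2)..<l / 2} t * cis (- 2 * pi * t * x)) \<in> borel_measurable lebesgue"
      by (rule measurable_completion) (use borel_measurable_indicator_cis[of "- (l / 2)" "l / 2" x] in simp)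
    show "(\<lambda>t. indicator {- (l / 2)..l / 2} t * cis (- 2 * pi * x * t)) \<in> borel_measurable lebesgue"
      by (intro borel_measurable_integrable integrable_indicator_continuous continuous_intros)
  qed
  moreover have "l / 3 \<le> norm (LINT t|lebesgue. indicator {- (l / 2)..l / 2} t * cis (- 2 * pi * x * t))"
  proof (cases "x = 0")
    case True
    have "(LINT t|lebesgue. indicator {- (l / 2)..l / 2} t *\<^sub>R (1 :: complex)) = measure lebesgue {- (l / 2)..l / 2} *\<^sub>R 1"
      by simp
    from this[unfolded indicator_scaleR_complex] True l show ?thesis by simp
  next
    case False
    have "(LINT t|lebesgue. indicator {- (l / 2)..l / 2} t * cis (- 2 * pi * x * t)) =
        (cis (- 2 * pi * x * (l / 2)) - cis (- 2 * pi * x * (- (l / 2)))) / (\<i> * of_real (- 2 * pi * x))"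
      by (rule integral_cis_Icc) (use False l in auto)
    also have "cis (- 2 * pi * x * (l / 2)) - cis (- 2 * pi * x * (- (l / 2))) = - 2 * \<i> * of_real (sin (pi * x * l))"
      by (simp add: complex_eq_iff mult.assoc)
    finally have "norm (LINT t|lebesgue. indicator {- (l / 2)..l / 2} t * cis (- 2 * pi * x * t)) = \<bar>sin (pi * x * l)\<bar> / (pi * \<bar>x\<bar>)"
      using False by (simp add: norm_mult norm_divide mult_ac)
    also have "\<bar>sin (pi * x * l)\<bar> = \<bar>sin (pi * (\<bar>x\<bar> * l))\<bar>" by (cases "x \<ge> 0") (auto simp: mult.assoc)
    also have "pi * (\<bar>x\<bar> * l) / 3 / (pi * \<bar>x\<bar>) \<le> \<bar>sin (pi * (\<bar>x\<bar> * l))\<bar> / (pi * \<bar>x\<bar>)"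
    proof (intro divide_right_mono order_trans[OF sin_ge_third abs_ge_self])
      have "pi * (\<bar>x\<bar> * l) \<le> 4 * (1 / 2)" using pi_less_4 x l by (intro mult_mono) auto
      then show "pi * (\<bar>x\<bar> * l) \<le> 2" by simp
    qed (use l in auto)
    finally show ?thesis using False by simp
  qed
  ultimately show ?thesis unfolding eq by simp
qed

text \<open>The cell integrals of the transform of \<open>f\<close> restricted to \<open>{-T<..<T}\<close> are the Fourier
  coefficients, on \<open>{-T..T}\<close>, of that restriction times the transform \<open>h\<close> of one cell, and
  \<open>\<bar>h\<bar>\<close> is bounded below there. The \<open>d\<close> cells on which the integrals of \<open>g\<close> vanish cover
  \<open>{-T..<T}\<close>, so all nonzero cell integrals are controlled by the two tails.\<close>

lemma concentration_bound:
  assumes fg: "fourier_pair f g" and T: "T > 0" and d: "4 * T\<^sup>2 \<le> real d"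
    and zero: "\<And>j. j < d \<Longrightarrow>
      (LINT \<xi>|lebesgue. indicator {- T + real j * (1 / (2 * T))..<- T + (real j + 1) * (1 / (2 * T))} \<xi> * g \<xi>) = 0"
  shows "sqnorm f \<le> 19 * (sqnorm (\<lambda>t. indicator {t. T \<le> \<bar>t\<bar>} t * f t) + sqnorm (\<lambda>\<xi>. indicator {\<xi>. T \<le> \<bar>\<xi>\<bar>} \<xi> * g \<xi>))"
proof -
  define l where "l = 1 / (2 * T)"
  have l: "l > 0" and Tl: "2 * T * l = 1" using T by (auto simp: l_def)
  define C where "C j = {- T + real_of_int j * l..<- T + (real_of_int j + 1) * l}" for j
  define out where "out = {t::real. T \<le> \<bar>t\<bar>}"
  have "closed out" unfolding out_def by (intro closed_Collect_le continuous_intros)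
  then have out: "out \<in> sets lebesgue" and outc: "- out \<in> sets lebesgue" by auto
  have f: "square_integrable f" and g: "square_integrable g" using fg by (auto simp: fourier_pair_def)
  define f2 where "f2 t = indicator out t * f t" for t
  define f1 where "f1 t = indicator (- out) t * f t" for t
  have f1: "square_integrable f1" and f2: "square_integrable f2"
    unfolding f1_def f2_def by (rule square_integrable_indicator_mult[OF f outc], rule square_integrable_indicator_mult[OF f out])
  have split: "sqnorm f = sqnorm f1 + sqnorm f2"
  proof -
    have "sqnorm f = (LINT t|lebesgue. (norm (f1 t))\<^sup>2 + (norm (f2 t))\<^sup>2)"
      unfolding sqnorm_def f1_def f2_def by (intro Bochner_Integration.integral_cong refl) (auto simp: indicator_def)
    then show ?thesis using f1 f2 by (simp add: sqnorm_def square_integrable_def)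
  qed
  \<comment> \<open>The transform of the inner piece \<open>f1\<close> is represented by g - g2, so
    that the vanishing cell integrals of g can be exploited.\<close>
  obtain g2 where g2: "fourier_pair f2 g2" "sqnorm g2 \<le> sqnorm f2" using fourier_pair_exists[OF f2] .
  have g2s: "square_integrable g2" using g2 by (simp add: fourier_pair_def)
  define h where "h = fourier_L1 (indicator (C 0))"
  have hC: "h = fourier_L1 (indicator {-T..<-T + l})" by (simp add: h_def C_def)
  have h_le: "norm (h t) \<le> l" for t unfolding hC using norm_fourier_L1_indicator_le[of "-T" "-T + l" t] l by simp
  have h_ge: "l / 3 \<le> norm (h t)" if "\<bar>t\<bar> \<le> T" for t
    unfolding hC
  proof (rule norm_fourier_L1_indicator_ge[OF l])
    have "\<bar>t\<bar> * l \<le> T * l" using that l by simp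
    then show "\<bar>t\<bar> * l \<le> 1 / 2" using Tl by simp
  qed
  have h_meas: "h \<in> borel_measurable lebesgue"
    unfolding hC using square_integrable_fourier_L1_Ico by (rule square_integrable_measurable)
  define G where "G t = h t * f1 t" for t
  have G: "square_integrable G" unfolding G_def by (rule square_integrable_bounded_mult[OF f1 h_meas h_le])
  have G0: "G t = 0" if "t \<notin> {-T..T}" for t using that by (auto simp: G_def f1_def out_def indicator_def)
  have coeff: "fourier_L1 G (of_int j / (2 * T)) =
      (LINT \<xi>|lebesgue. indicator (C j) \<xi> * g \<xi>) - (LINT \<xi>|lebesgue. indicator (C j) \<xi> * g2 \<xi>)" for j
  proof -
    let ?K = "fourier_L1 (indicator (C j))"
    have K: "?K t = cis (- 2 * pi * t * (of_int j / (2 * T))) * h t" for t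
    proof -
      have "?K t = fourier_L1 (indicator {- T + of_int j * l..<(- T + l) + of_int j * l}) t"
        by (simp add: C_def algebra_simps)
      also have "\<dots> = cis (- 2 * pi * (of_int j * l) * t) * h t"
        unfolding hC by (rule fourier_L1_indicator_shift)
      finally show ?thesis by (simp add: l_def mult_ac)
    qed
    have Ks: "square_integrable ?K" unfolding C_def by (rule square_integrable_fourier_L1_Ico)
    have "(LINT \<xi>|lebesgue. indicator (C j) \<xi> * g \<xi>) - (LINT \<xi>|lebesgue. indicator (C j) \<xi> * g2 \<xi>)
        = (LINT t|lebesgue. f t * ?K t) - (LINT t|lebesgue. f2 t * ?K t)"
      using fg g2(1) by (simp add: fourier_pair_def C_def)
    also have "\<dots> = (LINT t|lebesgue. f t * ?K t - f2 t * ?K t)"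
      by (intro Bochner_Integration.integral_diff[symmetric] square_integrable_mult_integrable f f2 Ks)
    also have "\<dots> = fourier_L1 G (of_int j / (2 * T))"
      unfolding fourier_L1_cis[of G]
    proof (intro Bochner_Integration.integral_cong refl)
      fix t
      have "f t * ?K t - f2 t * ?K t = f1 t * ?K t" by (auto simp: f1_def f2_def indicator_def)
      then show "f t * ?K t - f2 t * ?K t = G t * cis (- 2 * pi * t * (of_int j / (2 * T)))"
        unfolding K G_def by (simp only: mult_ac)
    qed
    finally show ?thesis by simp
  qed
  define q where "q = sqnorm f2 + sqnorm (\<lambda>\<xi>. indicator out \<xi> * g \<xi>)"
  have "2 * T * sqnorm G \<le> 2 * l * q"
  proof (rule fourier_L1_completeness[OF T G G0])
    fix J :: "int set" assume J: "finite J"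
    let ?c = "\<lambda>j. LINT \<xi>|lebesgue. indicator (C j) \<xi> * g \<xi>"
    let ?b = "\<lambda>j. LINT \<xi>|lebesgue. indicator (C j) \<xi> * g2 \<xi>"
    have c0: "?c j = 0" if "0 \<le> j" "j < int d" for j
      using zero[of "nat j"] that by (simp add: C_def l_def)
    have "(\<Sum>j\<in>J. (norm (?c j))\<^sup>2) = (\<Sum>j\<in>J - {0..<int d}. (norm (?c j))\<^sup>2)"
      using J c0 by (intro sum.mono_neutral_right) auto
    also have "\<dots> \<le> l * sqnorm (\<lambda>\<xi>. indicator out \<xi> * g \<xi>)"
      unfolding C_def
    proof (rule sum_cell_integrals_le[OF g l _ out])
      fix j assume j: "j \<in> J - {0..<int d}"
      show "{- T + of_int j * l..<- T + (of_int j + 1) * l} \<subseteq> out"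
      proof (cases "j < 0")
        case True
        then have "(real_of_int j + 1) * l \<le> 0" using l by (intro mult_nonpos_nonneg) auto
        then show ?thesis by (auto simp: out_def)
      next
        case False
        with j have "real d \<le> of_int j" by auto
        \<comment> \<open>A cell with index at least d starts at -T + 4T^2 l = T or later, hence
          lies in the tail.\<close>
        then have "4 * T\<^sup>2 \<le> of_int j" using d by simp
        then have "4 * T\<^sup>2 * l \<le> of_int j * l" using l by (intro mult_right_mono) auto
        moreover have "4 * T\<^sup>2 * l = 2 * T" using T by (simp add: l_def power2_eq_square)
        ultimately show ?thesis by (auto simp: out_def)
      qed
    qed (use J in auto)
    finally have c: "(\<Sum>j\<in>J. (norm (?c j))\<^sup>2) \<le> l * sqnorm (\<lambda>\<xi>. indicator out \<xi> * g \<xi>)" .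
    \<comment> \<open>No cell integral of g2 is known to vanish, so its whole energy is charged;
      that is at most the outer mass of f.\<close>
    have "(\<Sum>j\<in>J. (norm (?b j))\<^sup>2) \<le> l * sqnorm (\<lambda>\<xi>. indicator UNIV \<xi> * g2 \<xi>)"
      unfolding C_def by (rule sum_cell_integrals_le[OF g2s l J]) auto
    also have "\<dots> \<le> l * sqnorm f2" using g2(2) l by simp
    finally have b: "(\<Sum>j\<in>J. (norm (?b j))\<^sup>2) \<le> l * sqnorm f2" .
    have "(norm (?c j - ?b j))\<^sup>2 \<le> 2 * (norm (?c j))\<^sup>2 + 2 * (norm (?b j))\<^sup>2" for j
    proof -
      have "(norm (?c j - ?b j))\<^sup>2 \<le> (norm (?c j) + norm (?b j))\<^sup>2"
        by (intro power_mono norm_triangle_ineq4) auto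
      also have "\<dots> \<le> 2 * (norm (?c j))\<^sup>2 + 2 * (norm (?b j))\<^sup>2"
        using zero_le_power2[of "norm (?c j) - norm (?b j)"] unfolding power2_diff power2_sum by linarith
      finally show ?thesis .
    qed
    then have "(\<Sum>j\<in>J. (norm (fourier_L1 G (of_int j / (2 * T))))\<^sup>2) \<le> (\<Sum>j\<in>J. 2 * (norm (?c j))\<^sup>2 + 2 * (norm (?b j))\<^sup>2)"
      unfolding coeff by (intro sum_mono)
    also have "\<dots> = 2 * (\<Sum>j\<in>J. (norm (?c j))\<^sup>2) + 2 * (\<Sum>j\<in>J. (norm (?b j))\<^sup>2)"
      by (simp add: sum.distrib sum_distrib_left)
    also have "\<dots> \<le> 2 * (l * sqnorm (\<lambda>\<xi>. indicator out \<xi> * g \<xi>)) + 2 * (l * sqnorm f2)"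
      using b c by linarith
    also have "\<dots> = 2 * l * q" by (simp add: q_def algebra_simps)
    finally show "(\<Sum>j\<in>J. (norm (fourier_L1 G (of_int j / (2 * T))))\<^sup>2) \<le> 2 * l * q" .
  qed
  moreover have "(l / 3)\<^sup>2 * sqnorm f1 \<le> sqnorm G"
  proof -
    have "sqnorm (\<lambda>t. of_real (l / 3) * f1 t) \<le> sqnorm G"
    proof (rule sqnorm_mono[OF _ G])
      show "(\<lambda>t. of_real (l / 3) * f1 t) \<in> borel_measurable lebesgue"
        by (intro square_integrable_measurable square_integrable_cmult f1)
      show "norm (of_real (l / 3) * f1 t) \<le> norm (G t)" for t
      proof (cases "\<bar>t\<bar> \<le> T")
        case True
        have "norm (of_real (l / 3) * f1 t) = l / 3 * norm (f1 t)"
          unfolding norm_mult norm_of_real using l by simp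
        also have "\<dots> \<le> norm (h t) * norm (f1 t)" by (intro mult_right_mono h_ge[OF True]) simp
        finally show ?thesis by (simp only: G_def norm_mult)
      qed (simp add: f1_def out_def)
    qed
    then show ?thesis by (simp only: sqnorm_cmult norm_of_real power2_abs)
  qed
  then have "2 * T * ((l / 3)\<^sup>2 * sqnorm f1) \<le> 2 * T * sqnorm G" using T by simp
  moreover have "2 * T * ((l / 3)\<^sup>2 * sqnorm f1) = l * (sqnorm f1 / 9)"
    using Tl by (simp add: power2_eq_square)
  ultimately have "l * (sqnorm f1 / 9) \<le> l * (2 * q)" by simp
  \<comment> \<open>18 = 9 * 2, with 9 from the lower bound l/3 on |h| and 2 from splitting the
    square of a difference. The outer piece of f raises it to 19.\<close>
  then have "sqnorm f1 \<le> 18 * q" using l by (simp add: mult_le_cancel_left)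
  moreover have "sqnorm f2 \<le> q" by (simp add: q_def)
  ultimately have "sqnorm f1 + sqnorm f2 \<le> 19 * q" by linarith
  then show ?thesis unfolding split q_def f2_def[abs_def] out_def .
qed

section \<open>Existence of the \<open>p\<close>-mean and tail bounds\<close>

text \<open>Strict convexity of |x|^p. For different absolute values, compare the mean value theorem
  on the two halves, using that z^(p-1) is strictly increasing; for x = -y the left side is
  0.\<close>

lemma abs_powr_midpoint_less:
  fixes p x y :: real
  assumes p: "p > 1" and "x \<noteq> y"
  shows "\<bar>(x + y) / 2\<bar> powr p < (\<bar>x\<bar> powr p + \<bar>y\<bar> powr p) / 2"
proof -
  have strict: "((u + v) / 2) powr p < (u powr p + v powr p) / 2" if uv: "0 \<le> v" "v < u" for u v :: real
  proof -
    define m where "m = (u + v) / 2"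
    have m: "v < m" "m < u" "u - m = m - v" using uv by (auto simp: m_def field_simps)
    have mvt: "\<exists>z. a < z \<and> z < b \<and> b powr p - a powr p = (b - a) * (p * z powr (p - 1))" if "0 \<le> a" "a < b" for a b
    proof -
      have d: "((\<lambda>x. x powr p) has_real_derivative p * x powr (p - 1)) (at x)" if "x > 0" for x
        using that by (auto intro!: derivative_eq_intros simp: powr_diff)
      have "\<exists>l z. a < z \<and> z < b \<and> ((\<lambda>x. x powr p) has_real_derivative l) (at z) \<and> b powr p - a powr p = (b - a) * l"
      proof (rule MVT[OF \<open>a < b\<close>])
        show "continuous_on {a..b} (\<lambda>x. x powr p)"
          using that p by (intro continuous_on_powr' continuous_intros) auto
        show "(\<lambda>x. x powr p) differentiable (at x)" if "a < x" "x < b" for x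
          using d[of x] that \<open>0 \<le> a\<close> by (auto intro: differentiableI simp: real_differentiable_def)
      qed
      then obtain l z where z: "a < z" "z < b" "((\<lambda>x. x powr p) has_real_derivative l) (at z)" "b powr p - a powr p = (b - a) * l"
        by blast
      have "l = p * z powr (p - 1)" using DERIV_unique[OF z(3) d] z(1) that by simp
      with z show ?thesis by blast
    qed
    obtain z1 where z1: "v < z1" "z1 < m" "m powr p - v powr p = (m - v) * (p * z1 powr (p - 1))"
      using mvt[of v m] uv m by blast
    obtain z2 where z2: "m < z2" "z2 < u" "u powr p - m powr p = (u - m) * (p * z2 powr (p - 1))"
      using mvt[of m u] uv m by auto
    have "z1 powr (p - 1) < z2 powr (p - 1)" using z1 z2 uv p by (intro powr_less_mono2) auto
    then have "(m - v) * (p * z1 powr (p - 1)) < (m - v) * (p * z2 powr (p - 1))"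
      using m p by (intro mult_strict_left_mono) auto
    then have "m powr p - v powr p < u powr p - m powr p" using z1(3) z2(3) m(3) by simp
    then show ?thesis by (simp add: m_def)
  qed
  have tri: "\<bar>(x + y) / 2\<bar> powr p \<le> ((\<bar>x\<bar> + \<bar>y\<bar>) / 2) powr p"
    using p by (intro powr_mono2) auto
  consider "\<bar>x\<bar> < \<bar>y\<bar>" | "\<bar>y\<bar> < \<bar>x\<bar>" | "x = - y" "y \<noteq> 0" using assms by linarith
  then show ?thesis
  proof cases
    case 1
    with strict[of "\<bar>x\<bar>" "\<bar>y\<bar>"] tri show ?thesis by (simp add: add.commute)
  next
    case 2
    with strict[of "\<bar>y\<bar>" "\<bar>x\<bar>"] tri show ?thesis by (simp add: add.commute)
  next
    case 3
    then show ?thesis by simp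
  qed
qed

lemma borel_measurable_moment_integrand:
  assumes "f \<in> borel_measurable lebesgue"
  shows "(\<lambda>t. \<bar>t - a\<bar> powr p * (norm (f t))\<^sup>2) \<in> borel_measurable lebesgue"
proof -
  have "(\<lambda>t. \<bar>t - a\<bar> powr p) \<in> borel_measurable lebesgue" by (intro measurable_completion) simp
  with assms show ?thesis by simp
qed

text \<open>The midpoint m of two minimisers has moment at most their average, hence equality holds.
  The convexity defect is then 0 almost everywhere, and strict convexity leaves only f = 0.\<close>

lemma p_moment_minimizer_unique:
  assumes p: "p > 1" and f: "square_integrable f" "sqnorm f \<noteq> 0"
    and fin: "p_variance p f < \<infinity>" and ab: "p_moment p f a = p_variance p f" "p_moment p f b = p_variance p f"
  shows "a = b"
proof (rule ccontr)
  assume "a \<noteq> b"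
  define m where "m = (a + b) / 2"
  let ?g = "\<lambda>a t. \<bar>t - a\<bar> powr p * (norm (f t))\<^sup>2"
  have meas: "?g x \<in> borel_measurable lebesgue" for x
    using f by (intro borel_measurable_moment_integrand square_integrable_measurable)
  have int: "integrable lebesgue (?g x)" if "p_moment p f x = p_variance p f" for x
    using that fin meas by (intro integrableI_nonneg) (auto simp: p_moment_def)
  have less: "\<bar>t - m\<bar> powr p < (\<bar>t - a\<bar> powr p + \<bar>t - b\<bar> powr p) / 2" for t
  proof -
    have "((t - a) + (t - b)) / 2 = t - m" by (simp add: m_def field_simps)
    from abs_powr_midpoint_less[OF p, of "t - a" "t - b", unfolded this] \<open>a \<noteq> b\<close> show ?thesis by simp
  qed
  have gm: "?g m t \<le> (?g a t + ?g b t) / 2" for t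
    using mult_right_mono[OF less_imp_le[OF less[of t]], of "(norm (f t))\<^sup>2"] by (simp add: algebra_simps add_divide_distrib)
  have intm: "integrable lebesgue (?g m)"
    by (rule Bochner_Integration.integrable_bound[OF integrable_divide_zero[OF Bochner_Integration.integrable_add[OF int[OF ab(1)] int[OF ab(2)]], of 2] meas])
       (use gm in \<open>auto intro!: AE_I2 simp: abs_mult\<close>)
  have mom: "p_moment p f x = ennreal (LINT t|lebesgue. ?g x t)" if "integrable lebesgue (?g x)" for x
    unfolding p_moment_def using that by (intro nn_integral_eq_integral) auto
  have "p_variance p f \<le> p_moment p f m" unfolding p_variance_def by (rule INF_lower) simp
  then have "(LINT t|lebesgue. ?g a t) \<le> (LINT t|lebesgue. ?g m t)" "(LINT t|lebesgue. ?g b t) \<le> (LINT t|lebesgue. ?g m t)"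
    using ab mom[OF intm] mom[OF int[OF ab(1)]] mom[OF int[OF ab(2)]]
    by (metis (no_types, lifting) ennreal_le_iff Bochner_Integration.integral_nonneg mult_nonneg_nonneg powr_ge_zero zero_le_power2)+
  moreover have "(LINT t|lebesgue. (?g a t + ?g b t) / 2 - ?g m t) = ((LINT t|lebesgue. ?g a t) + (LINT t|lebesgue. ?g b t)) / 2 - (LINT t|lebesgue. ?g m t)"
    using int[OF ab(1)] int[OF ab(2)] intm by simp
  ultimately have le: "(LINT t|lebesgue. (?g a t + ?g b t) / 2 - ?g m t) \<le> 0" by simp
  have ge: "0 \<le> (?g a t + ?g b t) / 2 - ?g m t" for t using gm[of t] by simp
  have "(LINT t|lebesgue. (?g a t + ?g b t) / 2 - ?g m t) = 0"
    using le by (intro antisym Bochner_Integration.integral_nonneg ge)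
  then have "AE t in lebesgue. (?g a t + ?g b t) / 2 - ?g m t = 0"
    using int[OF ab(1)] int[OF ab(2)] intm ge
    by (subst (asm) integral_nonneg_eq_0_iff_AE) auto
  then have "AE t in lebesgue. (norm (f t))\<^sup>2 = 0"
  proof eventually_elim
    case (elim t)
    then have "((\<bar>t - a\<bar> powr p + \<bar>t - b\<bar> powr p) / 2 - \<bar>t - m\<bar> powr p) * (norm (f t))\<^sup>2 = 0"
      by (simp add: algebra_simps add_divide_distrib)
    with less[of t] show ?case by simp
  qed
  then have "sqnorm f = (LINT t::real|lebesgue. 0)"
    unfolding sqnorm_def using f(1) by (intro Bochner_Integration.integral_cong_AE) (auto simp: square_integrable_def)
  with f(2) show False by simp
qed

text \<open>Direct method: a minimising sequence stays bounded because f has positive mass s in some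
  window, and Fatou's lemma handles the limit of a convergent subsequence.\<close>

lemma p_moment_minimizer_exists:
  assumes p: "p > 1" and f: "square_integrable f" "sqnorm f \<noteq> 0"
    and fin: "p_variance p f < \<infinity>"
  obtains a where "p_moment p f a = p_variance p f"
proof -
  define V where "V = enn2real (p_variance p f)"
  have V: "p_variance p f = ennreal V" "0 \<le> V" using fin by (auto simp: V_def)
  have "\<exists>a. p_moment p f a < ennreal (V + inverse (real (Suc n)))" for n
  proof -
    have "p_variance p f < ennreal (V + inverse (real (Suc n)))"
      using V(2) by (simp add: V(1) ennreal_less_iff)
    then show ?thesis unfolding p_variance_def INF_less_iff by auto
  qed
  then obtain a where a: "\<And>n. p_moment p f (a n) < ennreal (V + inverse (real (Suc n)))" by metis
  have meas: "(\<lambda>t. \<bar>t - x\<bar> powr p * (norm (f t))\<^sup>2) \<in> borel_measurable lebesgue" for x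
    using f by (intro borel_measurable_moment_integrand square_integrable_measurable)
  have "sqnorm f > 0" using f(2) sqnorm_nonneg[of f] by linarith
  from order_tendstoD(2)[OF sqnorm_tail_tendsto_zero[OF f(1)] this]
  obtain N :: nat where N: "sqnorm (\<lambda>t. indicator (- {- real N..real N}) t * f t) < sqnorm f"
    by (auto simp: eventually_sequentially)
  define s where "s = sqnorm (\<lambda>t. indicator {- real N..real N} t * f t)"
  have ins: "square_integrable (\<lambda>t. indicator {- real N..real N} t * f t)"
    by (intro square_integrable_indicator_mult f) auto
  have s: "s > 0"
  proof -
    have outs: "square_integrable (\<lambda>t. indicator (- {- real N..real N}) t * f t)"
      by (intro square_integrable_indicator_mult f) auto
    have "sqnorm f = (LINT t|lebesgue. (norm (indicator {- real N..real N} t * f t))\<^sup>2 + (norm (indicator (- {- real N..real N}) t * f t))\<^sup>2)"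
      unfolding sqnorm_def by (intro Bochner_Integration.integral_cong refl) (auto simp: indicator_def)
    also have "\<dots> = s + sqnorm (\<lambda>t. indicator (- {- real N..real N}) t * f t)"
      unfolding s_def sqnorm_def
      by (rule Bochner_Integration.integral_add) (use ins outs in \<open>simp_all add: square_integrable_def\<close>)
    finally show ?thesis using N by simp
  qed
  \<comment> \<open>The summand 1 keeps the distance c of \<open>a n\<close> from the window at
    least 1, so c \<le> c^p and the moment is at least c s; the last summand then contradicts a
    moment below V + 1.\<close>
  have bnd: "\<bar>a n\<bar> \<le> real N + 1 + (V + 1) / s" for n
  proof (rule ccontr)
    assume "\<not> \<bar>a n\<bar> \<le> real N + 1 + (V + 1) / s"
    then have an: "\<bar>a n\<bar> - real N > 1 + (V + 1) / s" by simp
    have "0 \<le> (V + 1) / s" using V(2) s by simp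
    let ?c = "\<bar>a n\<bar> - real N"
    have c1: "?c \<ge> 1" using an \<open>0 \<le> (V + 1) / s\<close> by linarith
    have "ennreal (?c * s) = (\<integral>\<^sup>+t. ennreal ?c * ennreal ((norm (indicator {- real N..real N} t * f t))\<^sup>2) \<partial>lebesgue)"
      using c1 ins s by (subst nn_integral_cmult) (auto simp: square_integrable_def nn_integral_eq_sqnorm[OF ins] s_def ennreal_mult)
    also have "\<dots> \<le> p_moment p f (a n)"
      unfolding p_moment_def
    proof (rule nn_integral_mono)
      fix t
      show "ennreal ?c * ennreal ((norm (indicator {- real N..real N} t * f t))\<^sup>2) \<le> ennreal (\<bar>t - a n\<bar> powr p * (norm (f t))\<^sup>2)"
      proof (cases "t \<in> {- real N..real N}")
        case True
        then have t: "?c \<le> \<bar>t - a n\<bar>" by auto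
        have "?c \<le> \<bar>t - a n\<bar> powr 1" using t c1 by simp
        also have "\<dots> \<le> \<bar>t - a n\<bar> powr p" using t c1 p by (intro powr_mono) auto
        finally show ?thesis using True c1
          by (auto simp flip: ennreal_mult intro!: ennreal_leI mult_right_mono)
      qed simp
    qed
    also have "\<dots> < ennreal (V + inverse (real (Suc n)))" by (rule a)
    also have "\<dots> \<le> ennreal (V + 1)"
      using inverse_le_1_iff[of "real (Suc n)"] by (intro ennreal_leI) linarith
    finally have "?c * s < V + 1" using c1 s V(2) by (subst (asm) ennreal_less_iff) auto
    then have "?c < (V + 1) / s" using s by (simp add: field_simps)
    with an show False by simp
  qed
  have "bounded (range a)" by (rule boundedI[where B = "real N + 1 + (V + 1) / s"]) (use bnd in auto)
  then obtain x r where r: "strict_mono (r :: nat \<Rightarrow> nat)" "(a \<circ> r) \<longlonglongrightarrow> x"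
    using bounded_imp_convergent_subsequence by blast
  have "p_moment p f x \<le> ennreal V"
    unfolding p_moment_def
  proof (rule nn_integral_Fatou_bound[where u = "\<lambda>n t. ennreal (\<bar>t - a (r n)\<bar> powr p * (norm (f t))\<^sup>2)"
        and C = "\<lambda>n. ennreal (V + inverse (real (Suc (r n))))"])
    show "(\<lambda>t. ennreal (\<bar>t - a (r n)\<bar> powr p * (norm (f t))\<^sup>2)) \<in> borel_measurable lebesgue" for n
      using meas by measurable
    show "AE t in lebesgue. (\<lambda>n. ennreal (\<bar>t - a (r n)\<bar> powr p * (norm (f t))\<^sup>2)) \<longlonglongrightarrow> ennreal (\<bar>t - x\<bar> powr p * (norm (f t))\<^sup>2)"
    proof (rule AE_I2)
      fix t
      have "(\<lambda>n. \<bar>t - a (r n)\<bar>) \<longlonglongrightarrow> \<bar>t - x\<bar>"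
        using r(2) by (intro tendsto_intros) (simp add: comp_def)
      then have "(\<lambda>n. \<bar>t - a (r n)\<bar> powr p) \<longlonglongrightarrow> \<bar>t - x\<bar> powr p"
        using p by (intro tendsto_powr' tendsto_const) auto
      then show "(\<lambda>n. ennreal (\<bar>t - a (r n)\<bar> powr p * (norm (f t))\<^sup>2)) \<longlonglongrightarrow> ennreal (\<bar>t - x\<bar> powr p * (norm (f t))\<^sup>2)"
        by (intro tendsto_ennrealI tendsto_mult tendsto_const)
    qed
    show "\<forall>\<^sub>F n in sequentially. (\<integral>\<^sup>+t. ennreal (\<bar>t - a (r n)\<bar> powr p * (norm (f t))\<^sup>2) \<partial>lebesgue) \<le> ennreal (V + inverse (real (Suc (r n))))"
      using a unfolding p_moment_def by (intro always_eventually allI less_imp_le)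
    have "(\<lambda>n. V + inverse (real (Suc (r n)))) \<longlonglongrightarrow> V + 0"
      using LIMSEQ_subseq_LIMSEQ[OF LIMSEQ_inverse_real_of_nat r(1)] by (intro tendsto_add tendsto_const) (simp add: comp_def)
    then show "(\<lambda>n. ennreal (V + inverse (real (Suc (r n))))) \<longlonglongrightarrow> ennreal V"
      by (intro tendsto_ennrealI) simp
  qed
  moreover have "p_variance p f \<le> p_moment p f x" unfolding p_variance_def by (rule INF_lower) simp
  ultimately show ?thesis using that[of x] V(1) by simp
qed

lemma p_moment_p_mean:
  assumes "p > 1" "square_integrable f" "sqnorm f \<noteq> 0" "p_variance p f < \<infinity>"
  shows "p_moment p f (p_mean p f) = p_variance p f"
  unfolding p_mean_def
  by (rule theI') (metis p_moment_minimizer_exists[OF assms] p_moment_minimizer_unique[OF assms])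

text \<open>Markov's inequality: beyond T the distance to the mean is at least (A/\<epsilon>)^(2/p),
  so the weight is at least (A/\<epsilon>)^2, while the whole moment is at most A^2.\<close>

lemma sqnorm_tail_le:
  assumes A: "A > 0" and p: "p > 1" and \<epsilon>: "\<epsilon> > 0" and f: "square_integrable f"
    and mean: "\<bar>p_mean p f\<bar> \<le> A" and disp: "p_dispersion p f \<le> ennreal A"
    and T: "T = A + (A / \<epsilon>) powr (2 / p)"
  shows "sqnorm (\<lambda>t. indicator {t. T \<le> \<bar>t\<bar>} t * f t) \<le> \<epsilon>\<^sup>2"
proof -
  define out where "out = {t::real. T \<le> \<bar>t\<bar>}"
  have "closed out" unfolding out_def by (intro closed_Collect_le continuous_intros)
  then have out: "out \<in> sets lebesgue" by auto
  have fo: "square_integrable (\<lambda>t. indicator out t * f t)" by (intro square_integrable_indicator_mult f out)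
  have "sqnorm (\<lambda>t. indicator out t * f t) \<le> \<epsilon>\<^sup>2"
  \<comment> \<open>The norm of f is not fixed. If it is 0, every point minimises the moment and
    \<open>p_mean\<close> is unspecified, but then the tail is 0 as well.\<close>
  proof (cases "sqnorm f = 0")
    case True
    have "sqnorm (\<lambda>t. indicator out t * f t) \<le> sqnorm f"
      by (rule sqnorm_mono[OF square_integrable_measurable[OF fo] f]) (simp add: indicator_def)
    then show ?thesis using True zero_le_power2[of \<epsilon>] by linarith
  next
    case False
    have fin: "p_variance p f \<noteq> \<infinity>" using disp by (auto simp: p_dispersion_def top_unique)
    then have "sqrt (enn2real (p_variance p f)) \<le> A"
      using disp A by (simp add: p_dispersion_def)
    then have "enn2real (p_variance p f) \<le> A\<^sup>2" by (simp add: sqrt_le_D)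
    then have "p_variance p f \<le> ennreal (A\<^sup>2)"
      using fin by (metis ennreal_enn2real_if ennreal_leI infinity_ennreal_def)
    moreover have "p_moment p f (p_mean p f) = p_variance p f"
      by (rule p_moment_p_mean[OF p f False]) (use fin in \<open>simp add: less_top\<close>)
    ultimately have mom: "p_moment p f (p_mean p f) \<le> ennreal (A\<^sup>2)" by simp
    have "ennreal ((A / \<epsilon>)\<^sup>2 * sqnorm (\<lambda>t. indicator out t * f t)) =
        (\<integral>\<^sup>+t. ennreal ((A / \<epsilon>)\<^sup>2) * ennreal ((norm (indicator out t * f t))\<^sup>2) \<partial>lebesgue)"
      using fo by (subst nn_integral_cmult) (auto simp: square_integrable_def nn_integral_eq_sqnorm[OF fo] ennreal_mult)
    also have "\<dots> \<le> p_moment p f (p_mean p f)"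
      unfolding p_moment_def
    proof (rule nn_integral_mono)
      fix t
      show "ennreal ((A / \<epsilon>)\<^sup>2) * ennreal ((norm (indicator out t * f t))\<^sup>2) \<le> ennreal (\<bar>t - p_mean p f\<bar> powr p * (norm (f t))\<^sup>2)"
      proof (cases "t \<in> out")
        case True
        then have "(A / \<epsilon>) powr (2 / p) \<le> \<bar>t - p_mean p f\<bar>" using mean by (auto simp: out_def T)
        then have "((A / \<epsilon>) powr (2 / p)) powr p \<le> \<bar>t - p_mean p f\<bar> powr p"
          using p by (intro powr_mono2) auto
        moreover have "((A / \<epsilon>) powr (2 / p)) powr p = (A / \<epsilon>)\<^sup>2"
          using A \<epsilon> p by (simp add: powr_powr powr_numeral)
        ultimately show ?thesis using True
          by (auto simp flip: ennreal_mult intro!: ennreal_leI mult_right_mono)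
      qed simp
    qed
    also note mom
    finally have "(A / \<epsilon>)\<^sup>2 * sqnorm (\<lambda>t. indicator out t * f t) \<le> A\<^sup>2" by simp
    then show ?thesis using A \<epsilon> by (simp add: power_divide field_simps)
  qed
  then show ?thesis by (simp add: out_def)
qed

section \<open>Hermitian forms\<close>

definition hform :: "'a set \<Rightarrow> ('a \<Rightarrow> 'a \<Rightarrow> complex) \<Rightarrow> ('a \<Rightarrow> complex) \<Rightarrow> ('a \<Rightarrow> complex) \<Rightarrow> complex" where
  "hform I H x y = (\<Sum>j\<in>I. \<Sum>k\<in>I. x j * cnj (y k) * H j k)"

text \<open>As a matrix it makes \<open>hform I kdelta\<close> the standard scalar product of C^I;
  as a column it is a unit vector.\<close>

definition kdelta :: "'a \<Rightarrow> 'a \<Rightarrow> complex" where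
  "kdelta j k = (if j = k then 1 else 0)"

lemma hform_sum_left:
  "hform I H (\<lambda>i. \<Sum>s\<in>S. c s * u s i) y = (\<Sum>s\<in>S. c s * hform I H (u s) y)"
proof -
  have "hform I H (\<lambda>i. \<Sum>s\<in>S. c s * u s i) y = (\<Sum>j\<in>I. \<Sum>k\<in>I. \<Sum>s\<in>S. c s * (u s j * cnj (y k) * H j k))"
    unfolding hform_def by (simp only: sum_distrib_right mult.assoc)
  also have "\<dots> = (\<Sum>j\<in>I. \<Sum>s\<in>S. \<Sum>k\<in>I. c s * (u s j * cnj (y k) * H j k))"
    by (intro sum.cong refl sum.swap)
  also have "\<dots> = (\<Sum>s\<in>S. \<Sum>j\<in>I. \<Sum>k\<in>I. c s * (u s j * cnj (y k) * H j k))"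
    by (rule sum.swap)
  finally show ?thesis unfolding hform_def by (simp only: sum_distrib_left)
qed

lemma hform_cnj:
  assumes "\<And>j k. j \<in> I \<Longrightarrow> k \<in> I \<Longrightarrow> H k j = cnj (H j k)"
  shows "hform I H y x = cnj (hform I H x y)"
proof -
  have "hform I H y x = (\<Sum>j\<in>I. \<Sum>k\<in>I. y j * cnj (x k) * cnj (H k j))"
    unfolding hform_def
  proof (intro sum.cong refl)
    fix j k assume "j \<in> I" "k \<in> I"
    then show "y j * cnj (x k) * H j k = y j * cnj (x k) * cnj (H k j)"
      by (subst assms[of k j]) auto
  qed
  also have "\<dots> = (\<Sum>k\<in>I. \<Sum>j\<in>I. y j * cnj (x k) * cnj (H k j))"
    by (rule sum.swap)
  finally show ?thesis unfolding hform_def by (simp add: mult_ac)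
qed

lemma hform_add_left: "hform I H (\<lambda>i. x i + c * y i) z = hform I H x z + c * hform I H y z"
  unfolding hform_def by (simp add: distrib_right sum.distrib sum_distrib_left mult.assoc)

lemma hform_add_right: "hform I H z (\<lambda>i. x i + c * y i) = hform I H z x + cnj c * hform I H z y"
  unfolding hform_def by (simp add: distrib_right distrib_left sum.distrib sum_distrib_left mult_ac)

lemma hform_kdelta:
  assumes "finite I"
  shows "hform I kdelta x y = (\<Sum>i\<in>I. x i * cnj (y i))"
  unfolding hform_def kdelta_def using assms
  by (intro sum.cong refl) (simp add: if_distrib sum.delta cong: if_cong)

lemma hform_kdelta_self:
  assumes "finite I"
  shows "hform I kdelta x x = of_real (\<Sum>i\<in>I. (norm (x i))\<^sup>2)"
  by (simp add: hform_kdelta[OF assms] complex_norm_square del: of_real_power)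

lemma hform_unit:
  assumes "finite I" "k \<in> I"
  shows "hform I H (\<lambda>i. kdelta i k) (\<lambda>i. kdelta i k) = H k k"
proof -
  have "hform I H (\<lambda>i. kdelta i k) (\<lambda>i. kdelta i k) = (\<Sum>j\<in>I. if j = k then (\<Sum>l\<in>I. if l = k then H k k else 0) else 0)"
    unfolding hform_def kdelta_def by (intro sum.cong refl) (auto intro!: sum.cong)
  then show ?thesis using assms by simp
qed

lemma kdelta_cnj: "kdelta k j = cnj (kdelta j k)"
  by (simp add: kdelta_def)

lemma hform_diff: "hform I (\<lambda>j k. H j k - c * K j k) x y = hform I H x y - c * hform I K x y"
  unfolding hform_def by (simp add: right_diff_distrib sum_subtractf sum_distrib_left mult_ac)

text \<open>Gaussian elimination by induction: the last equation is solved for a pivot unknown p,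
  which is substituted into the others.\<close>

lemma underdetermined_system:
  fixes a :: "nat \<Rightarrow> 'a \<Rightarrow> 'b :: field"
  assumes "finite I" "n < card I"
  shows "\<exists>x. (\<forall>i. i \<notin> I \<longrightarrow> x i = 0) \<and> (\<exists>i\<in>I. x i \<noteq> 0) \<and> (\<forall>j<n. (\<Sum>i\<in>I. a j i * x i) = 0)"
  using assms
proof (induction n arbitrary: I a)
  case 0
  then obtain p where "p \<in> I" by (metis card.empty ex_in_conv less_irrefl)
  then show ?case by (intro exI[of _ "\<lambda>i. if i = p then 1 else 0"]) auto
next
  case (Suc n)
  show ?case
  proof (cases "\<forall>i\<in>I. a n i = 0")
    case True
    then have "(\<Sum>i\<in>I. a n i * x i) = 0" for x by simp
    then show ?thesis using Suc.IH[of I a] Suc.prems by (auto simp: less_Suc_eq)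
  next
    case False
    then obtain p where p: "p \<in> I" "a n p \<noteq> 0" by blast
    let ?I = "I - {p}"
    have fin: "finite ?I" "n < card ?I" using Suc.prems p by (auto simp: card_Diff_singleton)
    from Suc.IH[OF this, of "\<lambda>j i. a j i - a j p * a n i / a n p"]
    obtain x where x: "\<And>i. i \<notin> ?I \<Longrightarrow> x i = 0" "\<exists>i\<in>?I. x i \<noteq> 0"
      "\<And>j. j < n \<Longrightarrow> (\<Sum>i\<in>?I. (a j i - a j p * a n i / a n p) * x i) = 0" by blast
    define s where "s = (\<Sum>i\<in>?I. a n i * x i)"
    \<comment> \<open>The pivot entry is the one that makes the last equation hold.\<close>
    define y where "y = x(p := - s / a n p)"
    have split: "(\<Sum>i\<in>I. a j i * y i) = a j p * (- s / a n p) + (\<Sum>i\<in>?I. a j i * x i)" for j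
    proof -
      have "(\<Sum>i\<in>I. a j i * y i) = a j p * y p + (\<Sum>i\<in>?I. a j i * y i)"
        using Suc.prems(1) p(1) by (rule sum.remove)
      also have "(\<Sum>i\<in>?I. a j i * y i) = (\<Sum>i\<in>?I. a j i * x i)"
        by (intro sum.cong) (auto simp: y_def)
      finally show ?thesis by (simp add: y_def)
    qed
    have "(\<Sum>i\<in>I. a j i * y i) = 0" if "j < Suc n" for j
    proof (cases "j = n")
      case True
      then show ?thesis unfolding split using p(2) by (simp add: s_def)
    next
      case False
      then have "j < n" using that by simp
      have "(\<Sum>i\<in>?I. (a j i - a j p * a n i / a n p) * x i) = (\<Sum>i\<in>?I. a j i * x i) - a j p / a n p * s"
        unfolding s_def sum_distrib_left sum_subtractf[symmetric]
        by (intro sum.cong refl) (simp add: algebra_simps)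
      with x(3)[OF \<open>j < n\<close>] show ?thesis unfolding split by simp
    qed
    moreover have "\<forall>i. i \<notin> I \<longrightarrow> y i = 0" using x(1) p(1) by (auto simp: y_def)
    moreover have "\<exists>i\<in>I. y i \<noteq> 0" using x(2) by (auto simp: y_def)
    ultimately show ?thesis by blast
  qed
qed

text \<open>Vectors of C^I are modelled as functions vanishing off I; in the product topology of the
  function type, Tychonoff's theorem makes this polydisc compact.\<close>

lemma compact_bounded_support:
  "compact {x :: 'a \<Rightarrow> complex. \<forall>i. x i \<in> (if i \<in> I then cball 0 1 else {0})}"
proof -
  let ?S = "\<lambda>i. if i \<in> I then cball 0 1 else {0 :: complex}"
  have "compactin (product_topology (\<lambda>i::'a. euclidean :: complex topology) UNIV) (PiE UNIV ?S)"
    unfolding compactin_PiE by auto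
  then show ?thesis
    by (simp add: euclidean_product_topology PiE_def Pi_def)
qed

lemma continuous_on_hform: "continuous_on S (\<lambda>x. hform I H x x)"
  and continuous_on_hform_left: "continuous_on S (\<lambda>x. hform I H x y)"
proof -
  have *: "continuous_on S (\<lambda>x :: 'a \<Rightarrow> complex. x i)" for i
    by (rule continuous_on_subset[OF continuous_on_product_coordinates]) simp
  show "continuous_on S (\<lambda>x. hform I H x x)" "continuous_on S (\<lambda>x. hform I H x y)"
    unfolding hform_def by (intro continuous_intros *)+
qed

text \<open>First variation: with u isotropic, the form at y + c u is affine in c over the reals,
  and it can stay nonnegative for all c only if its linear part vanishes. Applied to H minus an
  eigenvalue it yields the eigenvector equation.\<close>

lemma hform_zero_of_minimizer:
  assumes herm: "\<And>j k. j \<in> I \<Longrightarrow> k \<in> I \<Longrightarrow> H k j = cnj (H j k)"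
    and psd: "\<And>c. 0 \<le> Re (hform I H (\<lambda>i. y i + c * u i) (\<lambda>i. y i + c * u i))"
    and u: "hform I H u u = 0"
  shows "hform I H u y = 0"
proof (rule ccontr)
  define r where "r = hform I H u y"
  define q where "q = Re (hform I H y y)"
  assume "hform I H u y \<noteq> 0"
  then have r: "(norm r)\<^sup>2 > 0" by (simp add: r_def)
  have yu: "hform I H y u = cnj r" unfolding r_def by (rule hform_cnj[OF herm])
  have "Re (hform I H (\<lambda>i. y i + c * u i) (\<lambda>i. y i + c * u i)) = q + 2 * Re (c * r)" for c
    unfolding hform_add_left hform_add_right u yu r_def[symmetric] by (simp add: q_def)
  with psd have pos: "0 \<le> q + 2 * Re (c * r)" for c by metis
  have "0 \<le> q + 2 * Re (- of_real s * cnj r * r)" for s by (rule pos)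
  moreover have "Re (- of_real s * cnj r * r) = - (s * (norm r)\<^sup>2)" for s
  proof -
    have "cnj r * r = of_real ((norm r)\<^sup>2)" by (simp only: complex_norm_square mult.commute)
    then have "- of_real s * cnj r * r = of_real (- (s * (norm r)\<^sup>2))"
      by (simp only: mult.assoc) simp
    then show ?thesis by (simp only: Re_complex_of_real)
  qed
  ultimately have *: "2 * (s * (norm r)\<^sup>2) \<le> q" for s by (simp add: algebra_simps)
  have "2 * ((\<bar>q\<bar> + 1) / (norm r)\<^sup>2 * (norm r)\<^sup>2) \<le> q" by (rule *)
  with r show False by simp
qed

lemma sum_norm_square_pos:
  assumes "finite I" "\<exists>i\<in>I. x i \<noteq> 0"
  shows "(\<Sum>i\<in>I. (norm (x i))\<^sup>2) > 0"
  using assms by (auto intro!: sum_pos2)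

text \<open>Courant--Fischer: each new vector minimises the form among the unit vectors orthogonal to its predecessors.\<close>

lemma minimizing_system_exists:
  fixes H :: "'a \<Rightarrow> 'a \<Rightarrow> complex"
  assumes I: "finite I" and n: "n \<le> card I"
  shows "\<exists>u. \<forall>i<n. (\<forall>k. k \<notin> I \<longrightarrow> u i k = 0) \<and> (\<Sum>k\<in>I. (norm (u i k))\<^sup>2) = 1 \<and> (\<forall>j<i. hform I kdelta (u i) (u j) = 0) \<and>
     (\<forall>x. (\<forall>k. k \<notin> I \<longrightarrow> x k = 0) \<longrightarrow> (\<forall>j<i. hform I kdelta x (u j) = 0) \<longrightarrow>
        Re (hform I H (u i) (u i)) * (\<Sum>k\<in>I. (norm (x k))\<^sup>2) \<le> Re (hform I H x x))"
  using n
proof (induction n)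
  case (Suc n)
  then obtain u where u: "\<And>i. i < n \<Longrightarrow> (\<forall>k. k \<notin> I \<longrightarrow> u i k = 0) \<and> (\<Sum>k\<in>I. (norm (u i k))\<^sup>2) = 1 \<and> (\<forall>j<i. hform I kdelta (u i) (u j) = 0) \<and>
     (\<forall>x. (\<forall>k. k \<notin> I \<longrightarrow> x k = 0) \<longrightarrow> (\<forall>j<i. hform I kdelta x (u j) = 0) \<longrightarrow>
        Re (hform I H (u i) (u i)) * (\<Sum>k\<in>I. (norm (x k))\<^sup>2) \<le> Re (hform I H x x))"
    using Suc_leD by blast
  define X where "X = {x. (\<forall>k. k \<notin> I \<longrightarrow> x k = 0) \<and> (\<forall>j<n. hform I kdelta x (u j) = 0)}"
  define K where "K = {x \<in> X. hform I kdelta x x = 1}"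
  have scale: "(\<lambda>k. c * x k) \<in> X" if "x \<in> X" for c x
    using that hform_add_left[of I kdelta "\<lambda>_. 0" c x] unfolding X_def by (auto simp: hform_def)
  have scaleK: "(\<lambda>k. of_real (1 / sqrt s) * x k) \<in> K" if "x \<in> X" "s = (\<Sum>k\<in>I. (norm (x k))\<^sup>2)" "s > 0" for x s
  proof -
    have "hform I kdelta (\<lambda>k. of_real (1 / sqrt s) * x k) (\<lambda>k. of_real (1 / sqrt s) * x k) = of_real (1 / s * s)"
      unfolding hform_kdelta_self[OF I] using that(2,3)
      by (simp add: norm_mult power_mult_distrib power_divide norm_divide flip: sum_divide_distrib)
    also have "\<dots> = 1" using that(3) by simp
    finally show ?thesis using scale[OF that(1)] unfolding K_def by blast
  qed
  \<comment> \<open>There are n < card I orthogonality conditions, so a nonzero admissible vector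
    exists.\<close>
  obtain x0 where "x0 \<in> X" "\<exists>i\<in>I. x0 i \<noteq> 0"
  proof -
    obtain x where "\<forall>i. i \<notin> I \<longrightarrow> x i = 0" "\<exists>i\<in>I. x i \<noteq> 0" "\<forall>j<n. (\<Sum>i\<in>I. cnj (u j i) * x i) = 0"
      using underdetermined_system[OF I, of n "\<lambda>j i. cnj (u j i)"] Suc.prems by auto
    then show ?thesis by (intro that[of x]) (auto simp: X_def hform_kdelta[OF I] mult.commute)
  qed
  then have "K \<noteq> {}" using scaleK[OF _ refl] sum_norm_square_pos[OF I] by blast
  moreover have "compact K"
  proof -
    let ?B = "{x :: 'a \<Rightarrow> complex. \<forall>i. x i \<in> (if i \<in> I then cball 0 1 else {0})}"
    \<comment> \<open>The unit constraint bounds every coordinate by 1, so K is a closed part of the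
      compact polydisc.\<close>
    have Keq: "K = ?B \<inter> ({x. hform I kdelta x x = 1} \<inter> (\<Inter>j<n. {x. hform I kdelta x (u j) = 0}))"
    proof (intro equalityI subsetI)
      fix x assume x: "x \<in> K"
      have "norm (x i) \<le> 1" if "i \<in> I" for i
      proof -
        have "complex_of_real (\<Sum>k\<in>I. (norm (x k))\<^sup>2) = 1" unfolding hform_kdelta_self[OF I, symmetric] using x by (simp add: K_def)
        then have "(\<Sum>k\<in>I. (norm (x k))\<^sup>2) = 1" by (simp only: of_real_eq_1_iff)
        moreover have "(norm (x i))\<^sup>2 \<le> (\<Sum>k\<in>I. (norm (x k))\<^sup>2)"
          using I that by (intro member_le_sum) auto
        ultimately show ?thesis by (simp add: abs_square_le_1)
      qed
      then show "x \<in> ?B \<inter> ({x. hform I kdelta x x = 1} \<inter> (\<Inter>j<n. {x. hform I kdelta x (u j) = 0}))"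
        using x by (auto simp: K_def X_def)
    qed (auto simp: K_def X_def split: if_splits)
    have cl: "closed ({x. hform I kdelta x x = 1} \<inter> (\<Inter>j<n. {x. hform I kdelta x (u j) = 0}))"
      by (intro closed_Int closed_INT ballI closed_Collect_eq continuous_on_hform continuous_on_hform_left continuous_on_const)
    show ?thesis unfolding Keq by (rule compact_Int_closed[OF compact_bounded_support cl])
  qed
  ultimately obtain v where v: "v \<in> K" "\<And>x. x \<in> K \<Longrightarrow> Re (hform I H v v) \<le> Re (hform I H x x)"
    using continuous_attains_inf[of K "\<lambda>x. Re (hform I H x x)", OF _ _ continuous_on_Re[OF continuous_on_hform]] by blast
  have vmin: "Re (hform I H v v) * (\<Sum>k\<in>I. (norm (x k))\<^sup>2) \<le> Re (hform I H x x)" if x: "x \<in> X" for x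
  proof -
    define s where "s = (\<Sum>k\<in>I. (norm (x k))\<^sup>2)"
    have "s \<ge> 0" by (auto simp: s_def sum_nonneg)
    show ?thesis
    proof (cases "s = 0")
      case True
      then have "\<forall>k\<in>I. x k = 0" using I by (simp add: s_def sum_nonneg_eq_0_iff)
      then show ?thesis using True by (simp add: hform_def s_def)
    next
      case False
      with \<open>s \<ge> 0\<close> have s: "s > 0" by simp
      let ?c = "complex_of_real (1 / sqrt s)"
      have "hform I H (\<lambda>k. ?c * x k) (\<lambda>k. ?c * x k) = ?c * cnj ?c * hform I H x x"
        unfolding hform_def sum_distrib_left by (intro sum.cong refl) (simp add: mult_ac)
      also have "?c * cnj ?c = of_real (1 / s)" using s
        by (simp flip: of_real_mult)
      finally have "Re (hform I H v v) \<le> Re (hform I H x x) / s"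
        using v(2)[OF scaleK[OF x s_def s]] by simp
      then show ?thesis using s by (simp add: s_def[symmetric] field_simps)
    qed
  qed
  have v1: "(\<Sum>k\<in>I. (norm (v k))\<^sup>2) = 1"
  proof -
    have "complex_of_real (\<Sum>k\<in>I. (norm (v k))\<^sup>2) = 1" unfolding hform_kdelta_self[OF I, symmetric] using v(1) by (simp add: K_def)
    then show ?thesis by (simp only: of_real_eq_1_iff)
  qed
  have vX: "v \<in> X" using v(1) by (simp add: K_def)
  let ?u = "u(n := v)"
  have old: "hform I kdelta x (?u j) = hform I kdelta x (u j)" if "j < n" for x j using that by simp
  show ?case
  proof (rule exI[of _ ?u], intro allI impI)
    fix i assume "i < Suc n"
    show "(\<forall>k. k \<notin> I \<longrightarrow> ?u i k = 0) \<and> (\<Sum>k\<in>I. (norm (?u i k))\<^sup>2) = 1 \<and> (\<forall>j<i. hform I kdelta (?u i) (?u j) = 0) \<and>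
     (\<forall>x. (\<forall>k. k \<notin> I \<longrightarrow> x k = 0) \<longrightarrow> (\<forall>j<i. hform I kdelta x (?u j) = 0) \<longrightarrow>
        Re (hform I H (?u i) (?u i)) * (\<Sum>k\<in>I. (norm (x k))\<^sup>2) \<le> Re (hform I H x x))"
    proof (cases "i = n")
      case True
      then show ?thesis using vX v1 vmin by (simp add: X_def)
    next
      case False
      with \<open>i < Suc n\<close> have "i < n" by simp
      with u[OF this] show ?thesis by simp
    qed
  qed
qed simp

text \<open>\<open>v k\<close> holds the coordinates of the k-th unit vector projected to the first
  d minimising vectors. The Gram defect is the scalar product of two residuals, and each residual
  has squared norm at most H k k / c, because all remaining directions have form value at least
  c.\<close>

lemma low_rank_approximation:
  fixes H :: "'a \<Rightarrow> 'a \<Rightarrow> complex" and a :: "nat \<Rightarrow> 'a \<Rightarrow> complex"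
  assumes I: "finite I"
    and herm: "\<And>j k. j \<in> I \<Longrightarrow> k \<in> I \<Longrightarrow> H k j = cnj (H j k)"
    and psd: "\<And>x. 0 \<le> Re (hform I H x x)"
    and c: "c > 0"
    and lower: "\<And>x. (\<forall>j<d. (\<Sum>i\<in>I. a j i * x i) = 0) \<Longrightarrow> c * (\<Sum>i\<in>I. (norm (x i))\<^sup>2) \<le> Re (hform I H x x)"
  obtains v :: "'a \<Rightarrow> nat \<Rightarrow> complex"
  where "\<And>j k. j \<in> I \<Longrightarrow> k \<in> I \<Longrightarrow>
    (norm (kdelta j k - (\<Sum>i<d. v j i * cnj (v k i))))\<^sup>2 \<le> (Re (H j j) / c) * (Re (H k k) / c)"
proof (cases "card I \<le> d")
  \<comment> \<open>With at most d indices, distinct coordinate vectors of C^d reproduce the Gram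
    matrix exactly.\<close>
  case True
  from I obtain idx where idx: "bij_betw idx I {0..<card I}" using ex_bij_betw_finite_nat by blast
  have diag: "0 \<le> Re (H k k)" if "k \<in> I" for k
    using psd[of "\<lambda>i. kdelta i k"] unfolding hform_unit[OF I that] .
  show ?thesis
  proof (rule that[of "\<lambda>k i. if i = idx k then 1 else 0"])
    fix j k assume jk: "j \<in> I" "k \<in> I"
    have "idx j < d" using bij_betwE[OF idx] jk(1) True by force
    moreover have "idx j = idx k \<longleftrightarrow> j = k" using idx jk by (auto simp: bij_betw_def inj_on_def)
    ultimately have "(\<Sum>i<d. (if i = idx j then 1 else 0) * cnj (if i = idx k then 1 else 0 :: complex)) = kdelta j k"
    proof -
      assume *: "idx j < d" "idx j = idx k \<longleftrightarrow> j = k"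
      have "(\<Sum>i<d. (if i = idx j then 1 else 0) * cnj (if i = idx k then 1 else 0 :: complex))
          = (\<Sum>i<d. if i = idx j then kdelta j k else 0)"
        using *(2) by (intro sum.cong refl) (auto simp: kdelta_def)
      then show ?thesis using *(1) by simp
    qed
    then show "(norm (kdelta j k - (\<Sum>i<d. (if i = idx j then 1 else 0) * cnj (if i = idx k then 1 else 0))))\<^sup>2
        \<le> (Re (H j j) / c) * (Re (H k k) / c)"
      using diag jk c by simp
  qed
next
  case False
  \<comment> \<open>One vector more than the dimension d is produced: \<open>u d\<close> is not
    projected onto, but its value \<open>\<mu> d\<close> bounds the form from below on everything
    orthogonal to the first d.\<close>
  then have "Suc d \<le> card I" by simp
  from minimizing_system_exists[OF I this, of H] obtain u where "\<forall>i<Suc d. (\<forall>k. k \<notin> I \<longrightarrow> u i k = 0) \<and>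
     (\<Sum>k\<in>I. (norm (u i k))\<^sup>2) = 1 \<and> (\<forall>j<i. hform I kdelta (u i) (u j) = 0) \<and>
     (\<forall>x. (\<forall>k. k \<notin> I \<longrightarrow> x k = 0) \<longrightarrow> (\<forall>j<i. hform I kdelta x (u j) = 0) \<longrightarrow>
        Re (hform I H (u i) (u i)) * (\<Sum>k\<in>I. (norm (x k))\<^sup>2) \<le> Re (hform I H x x))" by blast
  then have u:
    "\<And>i k. i \<le> d \<Longrightarrow> k \<notin> I \<Longrightarrow> u i k = 0"
    "\<And>i. i \<le> d \<Longrightarrow> (\<Sum>k\<in>I. (norm (u i k))\<^sup>2) = 1"
    "\<And>i j. i \<le> d \<Longrightarrow> j < i \<Longrightarrow> hform I kdelta (u i) (u j) = 0"
    "\<And>i x. i \<le> d \<Longrightarrow> (\<forall>k. k \<notin> I \<longrightarrow> x k = 0) \<Longrightarrow> (\<forall>j<i. hform I kdelta x (u j) = 0) \<Longrightarrow>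
        Re (hform I H (u i) (u i)) * (\<Sum>k\<in>I. (norm (x k))\<^sup>2) \<le> Re (hform I H x x)"
    by (simp_all add: less_Suc_eq_le)
  define \<mu> where "\<mu> i = Re (hform I H (u i) (u i))" for i
  note kd_cnj = hform_cnj[of I kdelta, OF kdelta_cnj]
  have self: "hform I kdelta (u i) (u i) = 1" if "i \<le> d" for i
    by (simp only: hform_kdelta_self[OF I] u(2)[OF that] of_real_1)
  have uu: "hform I kdelta (u i) (u j) = (if i = j then 1 else 0)" if "i \<le> d" "j \<le> d" for i j
    using u(3)[of i j] u(3)[of j i] kd_cnj[of "u i" "u j"] self[of i] that
    by (cases i j rule: linorder_cases) auto
  have Huu: "hform I H (u i) (u i) = of_real (\<mu> i)" for i
    using hform_cnj[of I H "u i" "u i", OF herm] by (simp add: \<mu>_def complex_eq_iff)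
  have orth: "hform I H (u i) x = 0"
    if i: "i \<le> d" and x: "\<forall>k. k \<notin> I \<longrightarrow> x k = 0" "\<forall>j\<le>i. hform I kdelta x (u j) = 0" for i x
  proof -
    \<comment> \<open>Shifted by its minimum \<open>\<mu> i\<close>, the form is nonnegative on
      vectors orthogonal to the predecessors of \<open>u i\<close> and zero at \<open>u i\<close>,
      so the first variation applies.\<close>
    define R where "R j k = H j k - of_real (\<mu> i) * kdelta j k" for j k
    have R: "hform I R y z = hform I H y z - of_real (\<mu> i) * hform I kdelta y z" for y z
      unfolding R_def by (rule hform_diff)
    have "hform I R (u i) x = 0"
    proof (rule hform_zero_of_minimizer)
      show "R k j = cnj (R j k)" if "j \<in> I" "k \<in> I" for j k
        using herm[OF that] by (simp add: R_def kdelta_def)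
      show "hform I R (u i) (u i) = 0" using uu[OF i i] by (simp add: R Huu)
      fix c
      let ?y = "\<lambda>k. x k + c * u i k"
      have "\<mu> i * (\<Sum>k\<in>I. (norm (?y k))\<^sup>2) \<le> Re (hform I H ?y ?y)"
        unfolding \<mu>_def
      proof (rule u(4)[OF i])
        show "\<forall>j<i. hform I kdelta ?y (u j) = 0"
          unfolding hform_add_left using x(2) u(3)[OF i] by auto
      qed (use x(1) u(1)[OF i] in auto)
      then show "0 \<le> Re (hform I R ?y ?y)"
        unfolding R hform_kdelta_self[OF I] by simp
    qed
    moreover have "hform I kdelta (u i) x = 0"
      using kd_cnj[of x "u i"] x(2) by simp
    ultimately show ?thesis by (simp add: R)
  qed
  have Huu': "hform I H (u i) (u j) = (if i = j then of_real (\<mu> i) else 0)" if "i \<le> d" "j \<le> d" for i j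
  proof (cases i j rule: linorder_cases)
    case less
    have "hform I H (u i) (u j) = 0"
      by (rule orth) (use less that u(1)[of j] u(3)[of j] in auto)
    with less show ?thesis by simp
  next
    case greater
    have "hform I H (u j) (u i) = 0"
      by (rule orth) (use greater that u(1)[of i] u(3)[of i] in auto)
    with greater hform_cnj[of I H "u j" "u i", OF herm] show ?thesis by simp
  qed (simp add: Huu)
  have mono: "\<mu> i \<le> \<mu> d" if "i \<le> d" for i
  proof -
    have "\<mu> i * (\<Sum>k\<in>I. (norm (u d k))\<^sup>2) \<le> Re (hform I H (u d) (u d))"
      unfolding \<mu>_def by (rule u(4)[OF that]) (use u(1) u(3)[of d] that in auto)
    then show ?thesis using u(2)[of d] by (simp add: \<mu>_def)
  qed
  have quad: "hform I K (\<lambda>k. \<Sum>i\<le>d. y i * u i k) (\<lambda>k. \<Sum>i\<le>d. y i * u i k) = of_real (\<Sum>i\<le>d. (norm (y i))\<^sup>2 * m i)"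
    if K: "\<And>j k. j \<in> I \<Longrightarrow> k \<in> I \<Longrightarrow> K k j = cnj (K j k)"
      and m: "\<And>i j. i \<le> d \<Longrightarrow> j \<le> d \<Longrightarrow> hform I K (u i) (u j) = (if i = j then of_real (m i) else 0)" for K m y
  proof -
    have *: "hform I K (\<lambda>k. \<Sum>i\<le>d. y i * u i k) (u j) = y j * of_real (m j)" if "j \<le> d" for j
    proof -
      have "(\<Sum>i\<le>d. y i * hform I K (u i) (u j)) = (\<Sum>i\<le>d. if i = j then y j * of_real (m j) else 0)"
        using m[OF _ that] by (intro sum.cong refl) auto
      then show ?thesis unfolding hform_sum_left using that by simp
    qed
    have "hform I K (u j) (\<lambda>k. \<Sum>i\<le>d. y i * u i k) = cnj (y j) * of_real (m j)" if "j \<le> d" for j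
      using hform_cnj[of I K, OF K] *[OF that] by (metis complex_cnj_complex_of_real complex_cnj_mult)
    then show ?thesis
      by (subst hform_sum_left) (simp add: complex_norm_square mult.assoc[symmetric] del: of_real_power)
  qed
  \<comment> \<open>Minimax: the d conditions have a nonzero solution in the span of the d + 1
    vectors u 0, ..., u d. Its Rayleigh quotient is at least c by \<open>lower\<close> and at most
    \<open>\<mu> d\<close>.\<close>
  have mu_c: "c \<le> \<mu> d"
  proof -
    obtain y where y: "\<exists>i\<in>{..d}. y i \<noteq> 0" "\<And>j. j < d \<Longrightarrow> (\<Sum>i\<in>{..d}. (\<Sum>k\<in>I. a j k * u i k) * y i) = 0"
      using underdetermined_system[of "{..d}" d "\<lambda>j i. \<Sum>k\<in>I. a j k * u i k"] by auto
    define x where "x k = (\<Sum>i\<le>d. y i * u i k)" for k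
    have "(\<Sum>k\<in>I. a j k * x k) = 0" if "j < d" for j
    proof -
      have "(\<Sum>k\<in>I. a j k * x k) = (\<Sum>k\<in>I. \<Sum>i\<le>d. a j k * u i k * y i)"
        by (simp add: x_def sum_distrib_left mult_ac)
      also have "\<dots> = (\<Sum>i\<le>d. \<Sum>k\<in>I. a j k * u i k * y i)" by (rule sum.swap)
      finally show ?thesis using y(2)[OF that] by (simp add: sum_distrib_right)
    qed
    then have "c * (\<Sum>k\<in>I. (norm (x k))\<^sup>2) \<le> Re (hform I H x x)" by (intro lower) auto
    also have "hform I H x x = of_real (\<Sum>i\<le>d. (norm (y i))\<^sup>2 * \<mu> i)"
      unfolding x_def by (rule quad[OF herm Huu'])
    also have "Re \<dots> \<le> (\<Sum>i\<le>d. (norm (y i))\<^sup>2 * \<mu> d)"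
      by (auto intro!: sum_mono mult_left_mono mono)
    also have "\<dots> = \<mu> d * (\<Sum>i\<le>d. (norm (y i))\<^sup>2)" by (simp add: sum_distrib_left mult.commute)
    also have "complex_of_real (\<Sum>k\<in>I. (norm (x k))\<^sup>2) = of_real (\<Sum>i\<le>d. (norm (y i))\<^sup>2 * 1)"
      unfolding hform_kdelta_self[OF I, symmetric] x_def
      by (rule quad[where K = kdelta, OF kdelta_cnj]) (simp add: uu)
    then have "(\<Sum>k\<in>I. (norm (x k))\<^sup>2) = (\<Sum>i\<le>d. (norm (y i))\<^sup>2)" by (simp only: of_real_eq_iff mult_1_right)
    finally have "c * (\<Sum>i\<le>d. (norm (y i))\<^sup>2) \<le> \<mu> d * (\<Sum>i\<le>d. (norm (y i))\<^sup>2)" .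
    moreover have "(\<Sum>i\<le>d. (norm (y i))\<^sup>2) > 0" by (rule sum_norm_square_pos) (use y(1) in auto)
    ultimately show ?thesis by simp
  qed
  \<comment> \<open>Residual of the k-th unit vector; \<open>cnj (u i k)\<close> is its scalar
    product with \<open>u i\<close>.\<close>
  define r where "r k = (\<lambda>l. kdelta l k - (\<Sum>i<d. cnj (u i k) * u i l))" for k
  have ek: "hform I kdelta (\<lambda>l. kdelta l k) x = cnj (x k)" if "k \<in> I" for k x
  proof -
    have "(\<Sum>i\<in>I. kdelta i k * cnj (x i)) = (\<Sum>i\<in>I. if i = k then cnj (x k) else 0)"
      by (intro sum.cong refl) (simp add: kdelta_def)
    then show ?thesis using that I by (simp add: hform_kdelta)
  qed
  have rr: "hform I kdelta (r j) (r k) = kdelta j k - (\<Sum>i<d. cnj (u i j) * cnj (cnj (u i k)))"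
    and rq: "c * Re (hform I kdelta (r k) (r k)) \<le> Re (H k k)"
    if jk: "j \<in> I" "k \<in> I" for j k
  proof -
    have ru: "hform I kdelta (r k) (u i) = 0" if "i < d" "k \<in> I" for i k
    proof -
      have "hform I kdelta (r k) (u i) = hform I kdelta (\<lambda>l. kdelta l k) (u i) - (\<Sum>s<d. cnj (u s k) * hform I kdelta (u s) (u i))"
        unfolding r_def hform_sum_left[symmetric]
        using hform_add_left[of I kdelta "\<lambda>l. kdelta l k" "-1" "\<lambda>l. \<Sum>s<d. cnj (u s k) * u s l" "u i"] by simp
      then show ?thesis using that ek[OF that(2)]
        by (simp add: uu if_distrib cong: if_cong)
    qed
    have r_split: "hform I K (r k) z = hform I K (\<lambda>l. kdelta l k) z - (\<Sum>s<d. cnj (u s k) * hform I K (u s) z)" for K k z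
      unfolding r_def hform_sum_left[symmetric]
      using hform_add_left[of I K "\<lambda>l. kdelta l k" "-1" "\<lambda>l. \<Sum>s<d. cnj (u s k) * u s l" z] by simp
    have ur: "hform I kdelta (u i) (r k) = 0" if "i < d" "k \<in> I" for i k
      using ru[OF that] kd_cnj[of "r k" "u i"] by simp
    show "hform I kdelta (r j) (r k) = kdelta j k - (\<Sum>i<d. cnj (u i j) * cnj (cnj (u i k)))"
      unfolding r_split[of kdelta j] using ur[OF _ jk(2)] ek[OF jk(1), of "r k"]
      by (simp add: r_def kdelta_def mult.commute)
    have supp: "r k l = 0" if "l \<notin> I" for l
      using that jk(2) u(1) by (auto simp: r_def kdelta_def intro!: sum.neutral)
    have Hur: "hform I H (u i) (r k) = 0" if "i < d" for i
      by (rule orth) (use that supp ru[OF _ jk(2)] in auto)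
    define p where "p l = (\<Sum>i<d. cnj (u i k) * u i l)" for l
    have pr: "hform I H p (r k) = 0" unfolding p_def hform_sum_left using Hur by simp
    have rp: "hform I H (r k) p = 0" using hform_cnj[of I H p "r k", OF herm] pr by simp
    \<comment> \<open>Projection p and residual are orthogonal for H too, so H k k splits without
      cross terms and dominates the share of the residual.\<close>
    have dk: "(\<lambda>l. kdelta l k) = (\<lambda>l. r k l + 1 * p l)" by (simp add: r_def p_def)
    have "hform I H (\<lambda>l. kdelta l k) (\<lambda>l. kdelta l k) = hform I H (r k) (r k) + hform I H p p"
      unfolding dk hform_add_left hform_add_right by (simp add: pr rp)
    moreover note hform_unit[OF I jk(2), of H]
    ultimately have "H k k = hform I H (r k) (r k) + hform I H p p" by simp
    then have "Re (hform I H (r k) (r k)) \<le> Re (H k k)" using psd[of p] by simp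
    moreover have "\<mu> d * (\<Sum>l\<in>I. (norm (r k l))\<^sup>2) \<le> Re (hform I H (r k) (r k))"
      unfolding \<mu>_def by (rule u(4)) (use supp ru[OF _ jk(2)] in auto)
    moreover have "c * (\<Sum>l\<in>I. (norm (r k l))\<^sup>2) \<le> \<mu> d * (\<Sum>l\<in>I. (norm (r k l))\<^sup>2)"
      by (intro mult_right_mono mu_c sum_nonneg) auto
    ultimately show "c * Re (hform I kdelta (r k) (r k)) \<le> Re (H k k)"
      unfolding hform_kdelta_self[OF I] by simp
  qed
  show ?thesis
  proof (rule that[of "\<lambda>k i. cnj (u i k)"])
    fix j k assume jk: "j \<in> I" "k \<in> I"
    have le: "(\<Sum>l\<in>I. (norm (r k l))\<^sup>2) \<le> Re (H k k) / c" if "k \<in> I" for k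
      using rq[OF that that] c unfolding hform_kdelta_self[OF I] by (simp add: field_simps)
    have "norm (hform I kdelta (r j) (r k)) \<le> (\<Sum>l\<in>I. norm (r j l) * norm (r k l))"
      unfolding hform_kdelta[OF I] by (rule order_trans[OF norm_sum]) (simp add: norm_mult)
    then have "(norm (hform I kdelta (r j) (r k)))\<^sup>2 \<le> (\<Sum>l\<in>I. norm (r j l) * norm (r k l))\<^sup>2"
      by (intro power_mono) auto
    also have "\<dots> \<le> (\<Sum>l\<in>I. (norm (r j l))\<^sup>2) * (\<Sum>l\<in>I. (norm (r k l))\<^sup>2)"
      by (rule Cauchy_Schwarz_ineq_sum)
    also have "\<dots> \<le> (Re (H j j) / c) * (Re (H k k) / c)"
    proof (rule mult_mono)
      show "0 \<le> Re (H j j) / c"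
        using le[OF jk(1)] by (rule order_trans[rotated]) (auto intro: sum_nonneg)
    qed (use le jk in \<open>auto intro: sum_nonneg\<close>)
    finally show "(norm (kdelta j k - (\<Sum>i<d. cnj (u i j) * cnj (cnj (u i k)))))\<^sup>2 \<le> (Re (H j j) / c) * (Re (H k k) / c)"
      unfolding rr[OF jk] .
  qed
qed

section \<open>Spherical codes\<close>

definition realify :: "nat \<Rightarrow> complex Matrix.vec \<Rightarrow> real Matrix.vec" where
  "realify d v = Matrix.vec (2 * d) (\<lambda>i. if i < d then Re (vec_index v i) else Im (vec_index v (i - d)))"

lemma realify_inner:
  assumes "u \<in> carrier_vec d" "v \<in> carrier_vec d"
  shows "realify d u \<bullet>c realify d v = Re (u \<bullet>c v)"
proof -
  have dims: "dim_vec u = d" "dim_vec v = d" using assms by auto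
  let ?f = "\<lambda>i. vec_index (realify d u) i * vec_index (realify d v) i"
  have "realify d u \<bullet>c realify d v = (\<Sum>i = 0..<2 * d. ?f i)"
    by (auto simp: scalar_prod_def realify_def intro!: sum.cong)
  also have "\<dots> = (\<Sum>i = 0..<d. ?f i) + (\<Sum>i = d..<2 * d. ?f i)"
    by (rule sum.atLeastLessThan_concat[symmetric]) auto
  also have "(\<Sum>i = d..<2 * d. ?f i) = (\<Sum>i = 0..<d. ?f (i + d))"
    using sum.shift_bounds_nat_ivl[of ?f 0 d d] by (simp add: mult_2)
  also have "(\<Sum>i = 0..<d. ?f i) + (\<Sum>i = 0..<d. ?f (i + d)) =
      (\<Sum>i = 0..<d. Re (vec_index u i) * Re (vec_index v i) + Im (vec_index u i) * Im (vec_index v i))"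
    unfolding sum.distrib[symmetric] by (intro sum.cong) (auto simp: realify_def)
  also have "\<dots> = Re (u \<bullet>c v)"
    using dims by (auto simp: scalar_prod_def conjugate_complex_def intro!: sum.cong)
  finally show ?thesis .
qed

lemma inj_on_realify: "inj_on (realify d) (carrier_vec d)"
proof (rule inj_onI)
  fix u v :: "complex Matrix.vec"
  assume uv: "u \<in> carrier_vec d" "v \<in> carrier_vec d" "realify d u = realify d v"
  show "u = v"
  proof (rule eq_vecI)
    fix i assume "i < dim_vec v"
    then have i: "i < d" using uv by simp
    have "vec_index (realify d u) i = vec_index (realify d v) i" "vec_index (realify d u) (d + i) = vec_index (realify d v) (d + i)"
      using uv(3) by simp_all
    then show "vec_index u i = vec_index v i" using i by (simp add: realify_def complex_eq_iff)
  qed (use uv in simp)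
qed

text \<open>Reading C^d as R^(2d) replaces each scalar product by its real part, which stays within
  the modulus bound.\<close>

lemma max_code_complex_le_real: "max_code_complex \<alpha> d \<le> max_code_real \<alpha> (2 * d)"
  unfolding max_code_complex_def max_code_def
proof (rule SUP_least)
  fix V assume "V \<in> {V. spherical_code {z :: complex. norm z \<le> \<alpha>} d V}"
  then have V: "finite V" "\<And>v. v \<in> V \<Longrightarrow> v \<in> carrier_vec d" "\<And>v. v \<in> V \<Longrightarrow> v \<bullet>c v = 1"
    "\<And>u v. u \<in> V \<Longrightarrow> v \<in> V \<Longrightarrow> u \<noteq> v \<Longrightarrow> norm (u \<bullet>c v) \<le> \<alpha>"
    unfolding spherical_code_def by auto
  have inj: "inj_on (realify d) V" by (rule inj_on_subset[OF inj_on_realify]) (use V(2) in auto)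
  have "spherical_code {-\<alpha>..\<alpha>} (2 * d) (realify d ` V)"
    unfolding spherical_code_def
  proof (intro conjI subsetI ballI impI)
    fix w assume "w \<in> realify d ` V"
    then obtain v where "v \<in> V" "w = realify d v" by blast
    then show "w \<in> {v \<in> carrier_vec (2 * d). v \<bullet>c v = 1}"
      using V(2,3) realify_inner[of v d v] by (auto simp: realify_def)
  next
    fix w w' assume w: "w \<in> realify d ` V" "w' \<in> realify d ` V" "w \<noteq> w'"
    then obtain u v where uv: "u \<in> V" "v \<in> V" "w = realify d u" "w' = realify d v" "u \<noteq> v" by blast
    have "w \<bullet>c w' = Re (u \<bullet>c v)"
      unfolding uv(3,4) by (rule realify_inner[OF V(2)[OF uv(1)] V(2)[OF uv(2)]])
    moreover have "\<bar>Re (u \<bullet>c v)\<bar> \<le> \<alpha>" using V(4)[OF uv(1,2,5)] abs_Re_le_cmod[of "u \<bullet>c v"] by linarith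
    ultimately show "w \<bullet>c w' \<in> {-\<alpha>..\<alpha>}" by auto
  qed (use V in simp)
  then have "enat (card (realify d ` V)) \<le> (SUP V\<in>{V. spherical_code {-\<alpha>..\<alpha>} (2 * d) V}. enat (card V))"
    by (intro SUP_upper) simp
  then show "enat (card V) \<le> max_code_real \<alpha> (2 * d)"
    using card_image[OF inj] by (simp add: max_code_real_def max_code_def)
qed

text \<open>The squared norms are at least 1 - \<delta>, so normalising enlarges the off-diagonal
  products from \<delta> to at most \<delta> / (1 - \<delta>).\<close>

lemma card_le_max_code_complex:
  fixes v :: "'a \<Rightarrow> nat \<Rightarrow> complex"
  assumes I: "finite I" and \<delta>: "\<delta> < 1" "\<delta> / (1 - \<delta>) \<le> \<alpha>" and \<alpha>: "\<alpha> < 1"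
    and gram: "\<And>j k. j \<in> I \<Longrightarrow> k \<in> I \<Longrightarrow> norm (kdelta j k - (\<Sum>i<d. v j i * cnj (v k i))) \<le> \<delta>"
  shows "enat (card I) \<le> max_code_complex \<alpha> d"
proof -
  define s where "s k = (\<Sum>i<d. (norm (v k i))\<^sup>2)" for k
  define w where "w k = Matrix.vec d (\<lambda>i. v k i / of_real (sqrt (s k)))" for k
  have self: "(\<Sum>i<d. v k i * cnj (v k i)) = of_real (s k)" for k
    by (simp add: s_def complex_norm_square del: of_real_power)
  have s_ge: "1 - \<delta> \<le> s k" if "k \<in> I" for k
  proof -
    have "norm (complex_of_real (1 - s k)) \<le> \<delta>"
      using gram[OF that that] unfolding self by (simp add: kdelta_def)
    then have "\<bar>1 - s k\<bar> \<le> \<delta>" by (simp only: norm_of_real)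
    then show ?thesis by linarith
  qed
  have s_pos: "s k > 0" if "k \<in> I" for k using s_ge[OF that] \<delta> by linarith
  have inner: "w j \<bullet>c w k = (\<Sum>i<d. v j i * cnj (v k i)) / (of_real (sqrt (s j)) * of_real (sqrt (s k)))" for j k
    unfolding sum_divide_distrib w_def
    by (auto simp: scalar_prod_def conjugate_complex_def atLeast0LessThan intro!: sum.cong)
  have unit: "w k \<bullet>c w k = 1" if "k \<in> I" for k
    unfolding inner self using s_pos[OF that] by (simp flip: of_real_mult)
  have off: "norm (w j \<bullet>c w k) \<le> \<alpha>" if jk: "j \<in> I" "k \<in> I" "j \<noteq> k" for j k
  proof -
    have d0: "0 \<le> \<delta>" using gram[OF jk(1,1)] norm_ge_zero order_trans by blast
    have "1 - \<delta> = sqrt (1 - \<delta>) * sqrt (1 - \<delta>)" using \<delta>(1) by simp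
    also have "\<dots> \<le> sqrt (s j) * sqrt (s k)"
      using s_ge[OF jk(1)] s_ge[OF jk(2)] \<delta>(1) by (intro mult_mono) auto
    finally have le: "1 - \<delta> \<le> sqrt (s j) * sqrt (s k)" .
    have "norm (\<Sum>i<d. v j i * cnj (v k i)) \<le> \<delta>"
      using gram[OF jk(1,2)] jk(3) by (simp add: kdelta_def)
    then have "norm (w j \<bullet>c w k) \<le> \<delta> / (1 - \<delta>)"
    proof -
      assume *: "norm (\<Sum>i<d. v j i * cnj (v k i)) \<le> \<delta>"
      have "norm (w j \<bullet>c w k) = norm (\<Sum>i<d. v j i * cnj (v k i)) / (sqrt (s j) * sqrt (s k))"
        unfolding inner using s_pos[OF jk(1)] s_pos[OF jk(2)] by (simp add: norm_divide norm_mult)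
      also have "\<dots> \<le> \<delta> / (1 - \<delta>)" using * le d0 \<delta>(1) by (intro frac_le) auto
      finally show ?thesis .
    qed
    then show ?thesis using \<delta>(2) by linarith
  qed
  \<comment> \<open>Two coinciding unit vectors would have product 1, exceeding \<alpha>; thus no
    index is lost in passing to a set of vectors.\<close>
  have inj: "inj_on w I"
  proof (rule inj_onI, rule ccontr)
    fix j k assume jk: "j \<in> I" "k \<in> I" "w j = w k" "j \<noteq> k"
    then have "norm (w j \<bullet>c w k) = 1" using unit by simp
    with off[OF jk(1,2,4)] \<alpha> show False by simp
  qed
  have "spherical_code {z :: complex. norm z \<le> \<alpha>} d (w ` I)"
    unfolding spherical_code_def using I unit off by (auto simp: w_def[abs_def])
  then have "enat (card (w ` I)) \<le> (SUP V\<in>{V. spherical_code {z :: complex. norm z \<le> \<alpha>} d V}. enat (card V))"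
    by (intro SUP_upper) simp
  then show ?thesis using card_image[OF inj] by (simp add: max_code_complex_def max_code_def)
qed

section \<open>The bound on orthonormal families\<close>

lemma hform_gram:
  assumes I: "finite I" and u: "\<And>k. k \<in> I \<Longrightarrow> square_integrable (u k)"
  shows "hform I (\<lambda>j k. LINT t|lebesgue. u j t * cnj (u k t)) x x = of_real (sqnorm (\<lambda>t. \<Sum>k\<in>I. x k * u k t))"
proof -
  have int: "integrable lebesgue (\<lambda>t. u j t * cnj (u k t))" if "j \<in> I" "k \<in> I" for j k
    by (intro square_integrable_mult_integrable square_integrable_cnj u that)
  have "of_real ((norm (\<Sum>k\<in>I. x k * u k t))\<^sup>2) = (\<Sum>j\<in>I. \<Sum>k\<in>I. x j * cnj (x k) * (u j t * cnj (u k t)))" for t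
    unfolding complex_norm_square cnj_sum sum_product by (intro sum.cong refl) (simp add: mult_ac)
  then have "complex_of_real (sqnorm (\<lambda>t. \<Sum>k\<in>I. x k * u k t)) =
      (LINT t|lebesgue. (\<Sum>j\<in>I. \<Sum>k\<in>I. x j * cnj (x k) * (u j t * cnj (u k t))))"
    unfolding sqnorm_def integral_complex_of_real[symmetric] by (simp only:)
  also have "\<dots> = (\<Sum>j\<in>I. LINT t|lebesgue. (\<Sum>k\<in>I. x j * cnj (x k) * (u j t * cnj (u k t))))"
    by (intro Bochner_Integration.integral_sum Bochner_Integration.integrable_sum integrable_mult_right int)
  also have "\<dots> = (\<Sum>j\<in>I. \<Sum>k\<in>I. x j * cnj (x k) * (LINT t|lebesgue. u j t * cnj (u k t)))"
    by (intro sum.cong refl)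
      (simp only: Bochner_Integration.integral_sum integrable_mult_right int integral_mult_right_zero)
  finally show ?thesis by (simp add: hform_def)
qed

theorem corollary3p7:
  fixes A p \<epsilon> \<alpha> :: real and d N :: nat and e :: "nat \<Rightarrow> real \<Rightarrow> complex"
  assumes "A > 0" and "1 < p" and "0 < \<epsilon>" and "\<epsilon> < 1 / (7 * sqrt 2)"
    and "\<alpha> = 49 * \<epsilon>\<^sup>2 / (1 - 49 * \<epsilon>\<^sup>2)"
    and "d = nat \<lfloor>4 * (A + (A / \<epsilon>) powr (2 / p))\<^sup>2\<rfloor> + 1"
    and "orthonormal_family {1..N} e"
    and "\<And>k. k \<in> {1..N} \<Longrightarrow> \<bar>p_mean p (e k)\<bar> \<le> A"
    and "\<And>k. k \<in> {1..N} \<Longrightarrow> \<bar>p_mean p (fourier_L2 (e k))\<bar> \<le> A"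
    and "\<And>k. k \<in> {1..N} \<Longrightarrow> p_dispersion p (e k) \<le> ennreal A"
    and "\<And>k. k \<in> {1..N} \<Longrightarrow> p_dispersion p (fourier_L2 (e k)) \<le> ennreal A"
  shows "enat N \<le> max_code_complex \<alpha> d \<and> max_code_complex \<alpha> d \<le> max_code_real \<alpha> (2 * d)"
proof
  show "max_code_complex \<alpha> d \<le> max_code_real \<alpha> (2 * d)" by (rule max_code_complex_le_real)
  define I where "I = {1..N}"
  define T where "T = A + (A / \<epsilon>) powr (2 / p)"
  define out where "out = {t::real. T \<le> \<bar>t\<bar>}"
  define g where "g k = fourier_L2 (e k)" for k
  have I: "finite I" by (simp add: I_def)
  have T: "T > 0" unfolding T_def using assms(1) by (intro add_pos_nonneg) auto
  have "closed out" unfolding out_def by (intro closed_Collect_le continuous_intros)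
  then have out: "out \<in> sets lebesgue" by auto
  have e: "square_integrable (e k)" if "k \<in> I" for k
    using assms(7) that by (simp add: orthonormal_family_def I_def)
  have pair: "fourier_pair (e k) (g k)" if "k \<in> I" for k
    unfolding g_def by (intro is_fourier_L2_imp_fourier_pair is_fourier_L2_fourier_L2 e that)
  then have g: "square_integrable (g k)" if "k \<in> I" for k using that by (simp add: fourier_pair_def)
  define eo where "eo k t = indicator out t * e k t" for k t
  define go where "go k t = indicator out t * g k t" for k t
  have eo: "square_integrable (eo k)" and go: "square_integrable (go k)" if "k \<in> I" for k
    unfolding eo_def go_def by (intro square_integrable_indicator_mult e g out that)+
  \<comment> \<open>Gram matrix of the time tails plus that of the frequency tails: the form q of
    the overview in the basis \<open>e k\<close>.\<close>
  define H where "H j k = (LINT t|lebesgue. eo j t * cnj (eo k t)) + (LINT t|lebesgue. go j t * cnj (go k t))" for j k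
  have diag: "H k k = of_real (sqnorm (eo k) + sqnorm (go k))" for k
    by (simp add: H_def sqnorm_def complex_norm_square flip: integral_complex_of_real del: of_real_power)
  have small: "Re (H k k) \<le> 2 * \<epsilon>\<^sup>2" if "k \<in> I" for k
  proof -
    have k: "k \<in> {1..N}" using that by (simp add: I_def)
    have "sqnorm (eo k) \<le> \<epsilon>\<^sup>2"
      unfolding eo_def out_def
      by (rule sqnorm_tail_le[OF assms(1-3) e[OF that] assms(8)[OF k] assms(10)[OF k] T_def])
    moreover have "sqnorm (go k) \<le> \<epsilon>\<^sup>2"
      unfolding go_def out_def g_def
      by (rule sqnorm_tail_le[OF assms(1-3) g[OF that, unfolded g_def] assms(9)[OF k] assms(11)[OF k] T_def])
    ultimately show ?thesis by (simp add: diag)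
  qed
  have Hxx: "hform I H x x = of_real (sqnorm (\<lambda>t. indicator out t * (\<Sum>k\<in>I. x k * e k t)) + sqnorm (\<lambda>t. indicator out t * (\<Sum>k\<in>I. x k * g k t)))" for x
  proof -
    have "hform I H x x = hform I (\<lambda>j k. LINT t|lebesgue. eo j t * cnj (eo k t)) x x + hform I (\<lambda>j k. LINT t|lebesgue. go j t * cnj (go k t)) x x"
      by (simp add: hform_def H_def distrib_left sum.distrib)
    also have "\<dots> = of_real (sqnorm (\<lambda>t. \<Sum>k\<in>I. x k * eo k t) + sqnorm (\<lambda>t. \<Sum>k\<in>I. x k * go k t))"
      using hform_gram[OF I eo, where x = x] hform_gram[OF I go, where x = x] by simp
    also have "(\<lambda>t. \<Sum>k\<in>I. x k * eo k t) = (\<lambda>t. indicator out t * (\<Sum>k\<in>I. x k * e k t))"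
      unfolding eo_def sum_distrib_left by (simp only: mult_ac)
    also have "(\<lambda>t. \<Sum>k\<in>I. x k * go k t) = (\<lambda>t. indicator out t * (\<Sum>k\<in>I. x k * g k t))"
      unfolding go_def sum_distrib_left by (simp only: mult_ac)
    finally show ?thesis .
  qed
  have norm_x: "sqnorm (\<lambda>t. \<Sum>k\<in>I. x k * e k t) = (\<Sum>k\<in>I. (norm (x k))\<^sup>2)" for x
  proof -
    have "complex_of_real (sqnorm (\<lambda>t. \<Sum>k\<in>I. x k * e k t)) = hform I (\<lambda>j k. LINT t|lebesgue. e j t * cnj (e k t)) x x"
      by (rule hform_gram[OF I e, symmetric])
    also have "\<dots> = hform I kdelta x x"
      unfolding hform_def using assms(7)
      by (intro sum.cong refl) (simp add: kdelta_def orthonormal_family_def I_def)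
    finally show ?thesis unfolding hform_kdelta_self[OF I] by (simp only: of_real_eq_iff)
  qed
  define cell where "cell j = {- T + real j * (1 / (2 * T))..<- T + (real j + 1) * (1 / (2 * T))}" for j :: nat
  define a where "a j k = (LINT \<xi>|lebesgue. indicator (cell j) \<xi> * g k \<xi>)" for j k
  \<comment> \<open>The added 1 in d makes up for the floor.\<close>
  have d: "4 * T\<^sup>2 \<le> real d" unfolding assms(6) T_def[symmetric] by linarith
  have lower: "1 / 19 * (\<Sum>k\<in>I. (norm (x k))\<^sup>2) \<le> Re (hform I H x x)"
    if x: "\<forall>j<d. (\<Sum>k\<in>I. a j k * x k) = 0" for x
  proof -
    have "(LINT \<xi>|lebesgue. indicator (cell j) \<xi> * (\<Sum>k\<in>I. x k * g k \<xi>)) = 0" if "j < d" for j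
    proof -
      have "(LINT \<xi>|lebesgue. indicator (cell j) \<xi> * (\<Sum>k\<in>I. x k * g k \<xi>)) = (LINT \<xi>|lebesgue. (\<Sum>k\<in>I. x k * (indicator (cell j) \<xi> * g k \<xi>)))"
        by (simp only: sum_distrib_left mult_ac)
      also have "\<dots> = (\<Sum>k\<in>I. x k * a j k)"
        unfolding a_def cell_def
        by (simp only: Bochner_Integration.integral_sum integrable_mult_right square_integrable_mult_integrable
            square_integrable_indicator_Ico g integral_mult_right_zero)
      also have "\<dots> = 0" using x that by (simp add: mult.commute)
      finally show ?thesis .
    qed
    then have "sqnorm (\<lambda>t. \<Sum>k\<in>I. x k * e k t) \<le> 19 * (sqnorm (\<lambda>t. indicator out t * (\<Sum>k\<in>I. x k * e k t)) + sqnorm (\<lambda>t. indicator out t * (\<Sum>k\<in>I. x k * g k t)))"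
      unfolding out_def cell_def by (intro concentration_bound[OF fourier_pair_sum[OF pair] T d])
    then show ?thesis unfolding norm_x Hxx by simp
  qed
  have herm: "H k j = cnj (H j k)" for j k
    unfolding H_def complex_cnj_add Bochner_Integration.integral_cnj[symmetric] complex_cnj_mult complex_cnj_cnj
    by (simp only: mult.commute)
  have psd: "0 \<le> Re (hform I H x x)" for x unfolding Hxx by simp
  obtain v :: "nat \<Rightarrow> nat \<Rightarrow> complex" where v: "\<And>j k. j \<in> I \<Longrightarrow> k \<in> I \<Longrightarrow>
    (norm (kdelta j k - (\<Sum>i<d. v j i * cnj (v k i))))\<^sup>2 \<le> (Re (H j j) / (1 / 19)) * (Re (H k k) / (1 / 19))"
    using low_rank_approximation[where a = a and d = d, OF I herm psd _ lower] by auto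
  \<comment> \<open>This is equivalent to 49 \<epsilon>^2 / (1 - 49 \<epsilon>^2) < 1, that is
    \<alpha> < 1, on which the distinctness of the code vectors rests.\<close>
  have eps: "98 * \<epsilon>\<^sup>2 < 1"
  proof -
    have "\<epsilon> * (7 * sqrt 2) < 1" using assms(4) by (simp add: field_simps)
    then have "(\<epsilon> * (7 * sqrt 2))\<^sup>2 < 1" using assms(3) by (simp add: power_less_one_iff)
    then show ?thesis by (simp add: power_mult_distrib)
  qed
  have "enat (card I) \<le> max_code_complex \<alpha> d"
  proof (rule card_le_max_code_complex[OF I])
    show "38 * \<epsilon>\<^sup>2 < 1" using eps zero_le_power2[of \<epsilon>] by linarith
    \<comment> \<open>38 = 19 * 2, from the concentration constant and the two tails. As x / (1 - x)
      increases on [0,1), it suffices that 38 \<le> 49.\<close>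
    show "38 * \<epsilon>\<^sup>2 / (1 - 38 * \<epsilon>\<^sup>2) \<le> \<alpha>"
      unfolding assms(5) using eps zero_le_power2[of \<epsilon>] by (intro frac_le) auto
    show "\<alpha> < 1" unfolding assms(5) using eps zero_le_power2[of \<epsilon>] by (simp add: divide_less_eq)
    fix j k assume jk: "j \<in> I" "k \<in> I"
    have nonneg: "0 \<le> Re (H k k)" for k by (simp add: diag)
    have "(norm (kdelta j k - (\<Sum>i<d. v j i * cnj (v k i))))\<^sup>2 \<le> (Re (H j j) / (1 / 19)) * (Re (H k k) / (1 / 19))"
      by (rule v[OF jk])
    also have "\<dots> \<le> (38 * \<epsilon>\<^sup>2) * (38 * \<epsilon>\<^sup>2)"
      using small jk nonneg by (intro mult_mono) (auto simp: field_simps)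
    finally show "norm (kdelta j k - (\<Sum>i<d. v j i * cnj (v k i))) \<le> 38 * \<epsilon>\<^sup>2"
      unfolding power2_eq_square[of "38 * \<epsilon>\<^sup>2", symmetric] by (rule power2_le_imp_le) simp
  qed
  then show "enat N \<le> max_code_complex \<alpha> d" by (simp add: I_def)
qed

end
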